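(* Let $[a,b]\subset\mathbb{R}$ be a compact interval and consider the equation $$-y''+p(x)y'+q(x)y=\lambda^2\rho(x)y,\qquad x\in[a,b],$$ where $p$ and $q$ are complex-valued, $p\in L_2[a,b]$, $q\in W_2^{-1}[a,b]$ (i.e. $q=u'$ in the sense of distributions for some $u\in L_2[a,b]$), $\rho\in W_1^1[a,b]=AC[a,b]$, $\rho(x)>0$ for all $x\in[a,b]$, and $\rho' u\in L_1[a,b]$. Put $$P(x)=\int_a^x p(\tau)\,d\tau,\qquad h=\int\frac{q}{\sqrt{\rho}}\,dx,\qquad y^{[1]}=y'-h(x)\sqrt{\rho(x)}\,y ,$$ where $h\in L_2[a,b]$ is an antiderivative in the sense of distributions and $y'$ is the derivative in $x$. Solutions are understood in the quasi-derivative sense specified in the context. Then for every $r\geq 0$ there is $R>0$ such that for all $\lambda\in\mathbb{C}$ with $\operatorname{Im}\lambda\geq -r$ and $|\lambda|>R$ the equation has on $[a,b]$ a fundamental system of solutions $y_+(x,\lambda),y_-(x,\lambda)$ of the form $$y_\pm(x,\lambda)=[\rho(x)]^{-1/4}\exp\Big(\tfrac12 P(x)\pm i\lambda\int_a^x\sqrt{\rho(\tau)}\,d\tau\Big)\big(1+\varphi_\pm(x,\lambda)\big),$$ whose quasi-derivatives satisfy $$y_\pm^{[1]}(x,\lambda)=\pm i\lambda\,[\rho(x)]^{1/4}\exp\Big(\tfrac12 P(x)\pm i\lambda\int_a^x\sqrt{\rho(\tau)}\,d\tau\Big)\big(1+\psi_\pm(x,\lambda)\big),$$ where $$|\varphi_+(x,\lambda)|+|\varphi_-(x,\lambda)|=o(1),\qquad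 |\psi_+(x,\lambda)|+|\psi_-(x,\lambda)|=o(1)$$ as $|\lambda|\to\infty$ in the half-plane $\operatorname{Im}\lambda\geq -r$, uniformly in $x\in[a,b]$. The same assertion holds with the half-plane $\operatorname{Im}\lambda\geq -r$ replaced by the half-plane $\operatorname{Im}\lambda\leq r$.
   Context: $W_1^1[a,b]$ is the space of functions with $y'\in L_1[a,b]$, i.e. the absolutely continuous functions. For $q=u'$ with $u\in L_2[a,b]$, the product of $q$ with an absolutely continuous function is defined by the Leibniz rule; thus $q/\sqrt\rho=(u/\sqrt\rho)'+u\rho'/(2\rho^{3/2})$, and so, up to an additive constant, $h(x)=\dfrac{u(x)}{\sqrt{\rho(x)}}+\displaystyle\int_a^x\frac{u(\tau)\rho'(\tau)}{2\rho(\tau)^{3/2}}\,d\tau\in L_2[a,b]$. Meaning of solution. Put $t=t(x)=\int_a^x\sqrt{\rho(\xi)}\,d\xi$, $t\in[0,\ell]$, $\ell=\int_a^b\sqrt{\rho(\xi)}\,d\xi$, and regard all functions as functions of $t$. Let $\sigma(t)=\int \frac{q}{\rho}\,dt$, that is, $\sigma(t(x))=h(x)$, so $\sigma\in L_2[0,\ell]$. Let $$f=\frac{p}{\sqrt\rho}-\frac12\frac{\rho'_t}{\rho},\qquad g=f\sigma-\sigma^2,$$ where $\rho'_t$ is the derivative with respect to $t$; both $f,g\in L_1[0,\ell]$. A solution of the equation is a function $y(t(x))$, where $(y,w)$ is a pair of absolutely continuous functions on $[0,\ell]$ satisfying almost everywhere $$\frac{d}{dt}\begin{pmatrix}y\\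 w\end{pmatrix}=\begin{pmatrix}\sigma&1\\ -\lambda^2+g&f-\sigma\end{pmatrix}\begin{pmatrix}y\\ w\end{pmatrix}.$$ Here $w=y'_t-\sigma y$ is the quasi-derivative in the variable $t$, and the quasi-derivative in the variable $x$ is $y^{[1]}=y'_x-h\sqrt\rho\,y=\sqrt{\rho}\,w$ (taken as the continuous representative). A fundamental system is a pair of linearly independent solutions. *)

theory Defs
  imports "HOL-Analysis.Analysis"
begin

definition L2_on :: "real \<Rightarrow> real \<Rightarrow> (real \<Rightarrow> complex) \<Rightarrow> bool" where
  "L2_on a b f \<longleftrightarrow>
     f \<in> borel_measurable (lebesgue_on {a..b}) \<and>
     integrable (lebesgue_on {a..b}) (\<lambda>x. (cmod (f x))\<^sup>2)"

text \<open>
  The space $W_1^1[a,b]$ of absolutely continuous functions: \<open>f\<close> is an indefinite Lebesgue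
  integral of \<open>f'\<close>. The derivative \<open>f'\<close> is determined only up to a null set.
\<close>

definition has_AC_derivative ::
    "(real \<Rightarrow> 'a::euclidean_space) \<Rightarrow> (real \<Rightarrow> 'a) \<Rightarrow> real \<Rightarrow> real \<Rightarrow> bool" where
  "has_AC_derivative f f' a b \<longleftrightarrow>
     f' absolutely_integrable_on {a..b} \<and>
     (\<forall>x\<in>{a..b}. f x = f a + integral {a..x} f')"

definition test_functions :: "real \<Rightarrow> real \<Rightarrow> (real \<Rightarrow> complex) set" where
  "test_functions a b =
     {\<phi>. (\<forall>n. ((\<lambda>g x. vector_derivative g (at x)) ^^ n) \<phi> differentiable_on UNIV) \<and>
         closure {x. \<phi> x \<noteq> 0} \<subseteq> {a<..<b}}"

text \<open>
  Distributions on $(a,b)$ are represented as functionals whose values matter only on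
  \<^const>\<open>test_functions\<close>. No linearity or continuity is imposed separately, because only
  functionals that are first-order expressions in integrable functions occur below.
\<close>

definition has_distr_antiderivative ::
    "((real \<Rightarrow> complex) \<Rightarrow> complex) \<Rightarrow> (real \<Rightarrow> complex) \<Rightarrow> real \<Rightarrow> real \<Rightarrow> bool" where
  "has_distr_antiderivative q u a b \<longleftrightarrow>
     (\<forall>\<phi>\<in>test_functions a b.
        q \<phi> = - integral {a..b} (\<lambda>x. u x * vector_derivative \<phi> (at x)))"

text \<open>
  \<open>Q\<close> is the product of $q = u' \in W_2^{-1}[a,b]$ with the absolutely continuous function \<open>f\<close>,
  given by the Leibniz rule $u' f = (u f)' - u f'$. It does not depend on the choice of the
  antiderivative $u$, which is unique up to an additive constant.
\<close>

definition is_distr_product ::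
    "((real \<Rightarrow> complex) \<Rightarrow> complex) \<Rightarrow> ((real \<Rightarrow> complex) \<Rightarrow> complex) \<Rightarrow> (real \<Rightarrow> complex) \<Rightarrow>
     real \<Rightarrow> real \<Rightarrow> bool" where
  "is_distr_product Q q f a b \<longleftrightarrow>
     (\<exists>u f'. L2_on a b u \<and> has_distr_antiderivative q u a b \<and>
        has_AC_derivative f f' a b \<and> (\<lambda>x. u x * f' x) absolutely_integrable_on {a..b} \<and>
        (\<forall>\<phi>\<in>test_functions a b.
           Q \<phi> = - integral {a..b} (\<lambda>x. u x * f x * vector_derivative \<phi> (at x))
                 - integral {a..b} (\<lambda>x. u x * f' x * \<phi> x)))"

text \<open>$h = \int q/\sqrt{\rho}\,dx$ in the sense of distributions.\<close>

definition is_antiderivative_q_sqrt ::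
    "(real \<Rightarrow> complex) \<Rightarrow> ((real \<Rightarrow> complex) \<Rightarrow> complex) \<Rightarrow> (real \<Rightarrow> real) \<Rightarrow> real \<Rightarrow> real \<Rightarrow> bool" where
  "is_antiderivative_q_sqrt h q \<rho> a b \<longleftrightarrow>
     L2_on a b h \<and>
     (\<exists>Q. is_distr_product Q q (\<lambda>x. 1 / of_real (sqrt (\<rho> x))) a b \<and>
          has_distr_antiderivative Q h a b)"

definition t_of :: "(real \<Rightarrow> real) \<Rightarrow> real \<Rightarrow> real \<Rightarrow> real" where
  "t_of \<rho> a x = integral {a..x} (\<lambda>\<xi>. sqrt (\<rho> \<xi>))"

definition x_of :: "(real \<Rightarrow> real) \<Rightarrow> real \<Rightarrow> real \<Rightarrow> real \<Rightarrow> real" where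
  "x_of \<rho> a b = the_inv_into {a..b} (t_of \<rho> a)"

text \<open>
  \<open>Y\<close> solves $-y'' + p y' + q y = \lambda^2 \rho y$ on $[a,b]$; the distribution $q$ enters only
  through \<open>h\<close>, i.e. through \<open>\<sigma>\<close>. In the variable $t$, \<open>y'\<close>, \<open>w'\<close> and \<open>\<rho>t'\<close> are the
  derivatives of \<open>y\<close>, \<open>w\<close> and of $\rho$.
\<close>

definition is_solution ::
    "(real \<Rightarrow> complex) \<Rightarrow> (real \<Rightarrow> complex) \<Rightarrow> (real \<Rightarrow> complex) \<Rightarrow> (real \<Rightarrow> real) \<Rightarrow> complex \<Rightarrow>
     real \<Rightarrow> real \<Rightarrow> bool" where
  "is_solution Y p h \<rho> lam a b \<longleftrightarrow>
     (let l = t_of \<rho> a b; X = x_of \<rho> a b; \<sigma> = (\<lambda>t. h (X t)) in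
      \<exists>y y' w w' \<rho>t'.
        has_AC_derivative y y' 0 l \<and> has_AC_derivative w w' 0 l \<and>
        has_AC_derivative (\<lambda>t. \<rho> (X t)) \<rho>t' 0 l \<and>
        (AE t in lebesgue_on {0..l}.
           let f = p (X t) / of_real (sqrt (\<rho> (X t))) - 1/2 * of_real (\<rho>t' t / \<rho> (X t));
               g = f * \<sigma> t - (\<sigma> t)\<^sup>2
           in y' t = \<sigma> t * y t + w t \<and>
              w' t = (- lam\<^sup>2 + g) * y t + (f - \<sigma> t) * w t) \<and>
        (\<forall>x\<in>{a..b}. Y x = y (t_of \<rho> a x)))"

text \<open>\<open>Y1\<close> is the continuous representative of $Y' - h \sqrt{\rho}\, Y$.\<close>

definition is_quasi_derivative ::
    "(real \<Rightarrow> complex) \<Rightarrow> (real \<Rightarrow> complex) \<Rightarrow> (real \<Rightarrow> complex) \<Rightarrow> (real \<Rightarrow> real) \<Rightarrow>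
     real \<Rightarrow> real \<Rightarrow> bool" where
  "is_quasi_derivative Y1 Y h \<rho> a b \<longleftrightarrow>
     continuous_on {a..b} Y1 \<and>
     (\<exists>Y'. has_AC_derivative Y Y' a b \<and>
        (AE x in lebesgue_on {a..b}. Y1 x = Y' x - h x * of_real (sqrt (\<rho> x)) * Y x))"

definition is_fundamental_system ::
    "(real \<Rightarrow> complex) \<Rightarrow> (real \<Rightarrow> complex) \<Rightarrow> (real \<Rightarrow> complex) \<Rightarrow> (real \<Rightarrow> complex) \<Rightarrow>
     (real \<Rightarrow> real) \<Rightarrow> complex \<Rightarrow> real \<Rightarrow> real \<Rightarrow> bool" where
  "is_fundamental_system Y Z p h \<rho> lam a b \<longleftrightarrow>
     is_solution Y p h \<rho> lam a b \<and> is_solution Z p h \<rho> lam a b \<and>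
     (\<forall>c d :: complex. (\<forall>x\<in>{a..b}. c * Y x + d * Z x = 0) \<longrightarrow> c = 0 \<and> d = 0)"

end

theory Submission
  imports Defs
begin

text \<open>
  In the variable \<open>t\<close>, write \<open>y = B (u\<^sub>1 + u\<^sub>2)\<close> and \<open>w = \<i> lam B (u\<^sub>1 - u\<^sub>2)\<close> with \<open>B' = B f / 2\<close>; in
  the variable \<open>x\<close> this amplitude is \<open>B = \<rho>\<^sup>-\<^sup>1\<^sup>/\<^sup>4 exp (P / 2)\<close>. The system for \<open>(y, w)\<close> becomes
  \<open>u\<^sub>1' = \<i> lam u\<^sub>1 + s u\<^sub>2 + G (u\<^sub>1 + u\<^sub>2)\<close>, \<open>u\<^sub>2' = - \<i> lam u\<^sub>2 + s u\<^sub>1 - G (u\<^sub>1 + u\<^sub>2)\<close> with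
  \<open>s = \<sigma> - f / 2\<close> and \<open>G = g / (2 \<i> lam)\<close>, whose off-diagonal entries are integrable. For
  \<open>Im lam \<ge> - r\<close> the solution \<open>y\<^sub>-\<close> is obtained from initial data at \<open>t = 0\<close> and \<open>y\<^sub>+\<close> from data at the
  right end, so that the exponential kernels stay bounded uniformly in \<open>lam\<close>. Gronwall's
  inequality bounds the solutions, and the subordinate component tends to \<open>0\<close> by a Riemann-Lebesgue
  argument: \<open>s\<close> is approximated in \<open>L\<^sub>1\<close> by a polynomial, for which one integrates by parts. The
  distribution \<open>q\<close> matters only through \<open>\<rho>' h \<in> L\<^sub>1\<close>, which follows from the lemma of du
  Bois-Reymond.
\<close>

subsection \<open>Integrable functions on an interval\<close>

text \<open>The obstacle is that all coefficients are merely integrable: they cannot be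
  differentiated, so the remainders are o(1) without a rate, and smoothness enters only through a
  polynomial that is fixed before \<open>lam\<close> grows. The amplitude \<open>B\<close> is chosen
  to absorb the entry \<open>f / 2\<close>. Without it the dominant component would tend to the
  exponential of an integral; with it the only diagonal entries left beside
  \<open>\<plusminus> \<i> lam\<close> are of order \<open>1 / lam\<close>, and the dominant
  component tends to 1. Since the integral of \<open>f / 2\<close> in \<open>t\<close> equals
  \<open>P / 2 - ln \<rho> / 4\<close> up to a constant, this is the origin of the factor in the
  theorem. The delicate coefficient is \<open>g\<close>: it contains the product of
  \<open>\<sigma>\<close>, which is only square integrable, with \<open>\<rho>' / \<rho>\<close>,
  which is only integrable, and so it needs the integrability of \<open>\<rho>' h\<close>. One
  asymptotic theorem serves both solutions, because the reversal \<open>t -> l - t\<close> turns the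
  system into one of the same form with \<open>s\<close> replaced by its negative reflection and
  \<open>lam\<close> by \<open>- lam\<close>.\<close>

lemma absolutely_integrable_continuous_mult:
  fixes f g :: "real \<Rightarrow> 'a::{real_normed_field,euclidean_space}"
  assumes "continuous_on {a..b} g" and "f absolutely_integrable_on {a..b}"
  shows "(\<lambda>x. g x * f x) absolutely_integrable_on {a..b}"
proof (rule absolutely_integrable_bounded_measurable_product[where h = "(*)"])
  show "bilinear ((*) :: 'a \<Rightarrow> 'a \<Rightarrow> 'a)"
    by (simp add: bilinear_conv_bounded_bilinear bounded_bilinear_mult)
  show "g \<in> borel_measurable (lebesgue_on {a..b})"
    by (intro continuous_imp_measurable_on_sets_lebesgue assms) auto
  show "bounded (g ` {a..b})"
    by (intro compact_imp_bounded compact_continuous_image assms) auto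
qed (use assms in auto)

lemma absolutely_integrable_on_subinterval_Icc:
  fixes f :: "real \<Rightarrow> 'a::euclidean_space"
  assumes "f absolutely_integrable_on {a..b}" "a \<le> c" "d \<le> b"
  shows "f absolutely_integrable_on {c..d}"
  using assms by (intro absolutely_integrable_on_subinterval[OF assms(1)]) auto

lemma integrable_norm_Icc:
  fixes f :: "real \<Rightarrow> 'a::euclidean_space"
  assumes "f absolutely_integrable_on {a..b}" "a \<le> c" "d \<le> b"
  shows "(\<lambda>x. norm (f x)) integrable_on {c..d}" "f integrable_on {c..d}"
  using absolutely_integrable_on_subinterval_Icc[OF assms]
  by (auto simp: absolutely_integrable_on_def)

text \<open>The majorant is integrated over all of \<open>{a..b}\<close>, so one bound serves every
  subinterval; this is what makes later estimates uniform in the upper limit of integration.\<close>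

lemma norm_integral_subinterval_le:
  fixes f :: "real \<Rightarrow> 'a::euclidean_space"
  assumes "f absolutely_integrable_on {a..b}" "a \<le> c" "d \<le> b"
    and "g integrable_on {a..b}" "\<And>x. x \<in> {a..b} \<Longrightarrow> norm (f x) \<le> g x"
  shows "norm (integral {c..d} f) \<le> integral {a..b} g"
proof -
  have "norm (integral {c..d} f) \<le> integral {c..d} (\<lambda>x. norm (f x))"
    using absolutely_integrable_on_subinterval_Icc[OF assms(1-3)]
    by (intro integral_norm_bound_integral) (auto simp: absolutely_integrable_on_def)
  also have "\<dots> \<le> integral {a..b} (\<lambda>x. norm (f x))"
    using assms by (intro integral_subset_le integrable_norm_Icc[OF assms(1)]) auto
  also have "\<dots> \<le> integral {a..b} g"
    using assms by (intro integral_le integrable_norm_Icc[OF assms(1)]) auto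
  finally show ?thesis .
qed

text \<open>Truncate, replace the truncation by an a.e. limit of continuous functions that obey the same
  bound, and apply Weierstrass.\<close>

lemma absolutely_integrable_approx_polynomial:
  fixes f :: "real \<Rightarrow> 'a::euclidean_space"
  assumes f: "f absolutely_integrable_on {a..b}" and "\<epsilon> > 0"
  obtains g where "polynomial_function g" "integral {a..b} (\<lambda>x. norm (f x - g x)) < \<epsilon>"
proof -
  \<comment> \<open>Radial retraction onto the ball of radius \<open>Suc n\<close>: continuous,
    never norm-increasing, and at each fixed point eventually the identity.\<close>
  define clip where "clip = (\<lambda>(n::nat) (z::'a). (1 / max 1 (norm z / real (Suc n))) *\<^sub>R z)"
  have clip_cont: "continuous_on UNIV (clip n)" for n
    unfolding clip_def by (intro continuous_intros) (auto simp: max_def)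
  have clip_le: "norm (clip n z) \<le> norm z" for n z
    unfolding clip_def by (auto simp: divide_simps max_def)
  have clip_bd: "norm (clip n z) \<le> real (Suc n)" for n z
  proof (cases "norm z \<le> real (Suc n)")
    case False
    then have "norm z > 0" "1 < norm z / real (Suc n)" by (auto simp: field_simps intro: less_le_trans)
    then show ?thesis unfolding clip_def by (auto simp: max_def)
  qed (use clip_le[of n z] in auto)
  have clip_lim: "(\<lambda>n. clip n z) \<longlonglongrightarrow> z" for z
  proof (rule tendsto_eventually)
    obtain N where N: "norm z \<le> real N" using real_arch_simple by blast
    have "clip n z = z" if "n \<ge> N" for n
    proof -
      have "norm z \<le> real (Suc n)" using N that by (smt (verit) of_nat_Suc of_nat_mono)
      then show ?thesis by (simp add: clip_def max_def divide_simps)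
    qed
    then show "\<forall>\<^sub>F n in sequentially. clip n z = z"
      by (auto simp: eventually_sequentially)
  qed
  let ?S = "{a..b}"
  have meas: "f \<in> borel_measurable (lebesgue_on ?S)"
    by (rule absolutely_integrable_imp_borel_measurable[OF f]) auto
  have comp: "(\<lambda>x. clip n (h x)) \<in> borel_measurable (lebesgue_on ?S)"
    if "h \<in> borel_measurable (lebesgue_on ?S)" for h n
    using measurable_compose[OF that borel_measurable_continuous_onI[OF clip_cont]] .
  have cf: "(\<lambda>x. clip n (f x)) absolutely_integrable_on ?S" for n
    by (rule measurable_bounded_by_integrable_imp_absolutely_integrable[where g = "\<lambda>x. norm (f x)"])
       (use comp[OF meas] integrable_norm_Icc(1)[OF f] clip_le in auto)
  have "(\<lambda>n. integral ?S (\<lambda>x. norm (f x - clip n (f x)))) \<longlonglongrightarrow> integral ?S (\<lambda>x. 0)"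
  proof (rule dominated_convergence(2)[where h = "\<lambda>x. 2 * norm (f x)"])
    show "(\<lambda>x. norm (f x - clip n (f x))) integrable_on ?S" for n
      by (rule integrable_norm_Icc(1)[OF set_integral_diff(1)[OF f cf]]) auto
    show "(\<lambda>x. 2 * norm (f x)) integrable_on ?S"
      using integrable_norm_Icc(1)[OF f] by auto
    show "norm (norm (f x - clip n (f x))) \<le> 2 * norm (f x)" for n x
      using norm_triangle_ineq4[of "f x" "clip n (f x)"] clip_le[of n "f x"] by simp
    show "(\<lambda>n. norm (f x - clip n (f x))) \<longlonglongrightarrow> 0" for x
      using tendsto_norm[OF tendsto_diff[OF tendsto_const[of "f x"] clip_lim[of "f x"]]] by simp
  qed
  then have "\<forall>\<^sub>F n in sequentially. integral ?S (\<lambda>x. norm (f x - clip n (f x))) < \<epsilon> / 3"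
    using assms(2) by (intro order_tendstoD(2)[where a="\<epsilon>/3"]) auto
  then obtain n where n: "integral ?S (\<lambda>x. norm (f x - clip n (f x))) < \<epsilon> / 3"
    by (auto simp: eventually_sequentially)
  \<comment> \<open>Measurability supplies continuous \<open>g k\<close> that converge to
    \<open>f\<close> off a null set but come without a common majorant. Since \<open>clip n\<close>
    is continuous, it preserves the convergence while bounding everything by
    \<open>Suc n\<close>.\<close>
  have "f measurable_on ?S"
    using meas by (subst measurable_on_iff_borel_measurable) auto
  then obtain N g where N: "negligible N" and gc: "\<And>k. continuous_on UNIV (g k)"
    and gl: "\<And>x. x \<notin> N \<Longrightarrow> (\<lambda>k. g k x) \<longlonglongrightarrow> (if x \<in> ?S then f x else 0)"
    unfolding measurable_on_def by blast
  have cgc: "continuous_on ?S (\<lambda>x. clip n (g k x))" for k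
    using continuous_on_compose2[OF clip_cont[of n] continuous_on_subset[OF gc]] by auto
  have cg: "(\<lambda>x. clip n (g k x)) absolutely_integrable_on ?S" for k
    by (intro absolutely_integrable_continuous_real cgc)
  \<comment> \<open>Dominated convergence asks for the limit at every point, so the null set
    \<open>N\<close> is cut out of the domain and restored afterwards.\<close>
  have "(\<lambda>k. integral (?S - N) (\<lambda>x. norm (clip n (f x) - clip n (g k x)))) \<longlonglongrightarrow> integral (?S - N) (\<lambda>x. 0)"
  proof (rule dominated_convergence(2)[where h = "\<lambda>x. 2 * real (Suc n)"])
    have "{x \<in> ?S - (?S - N). c x \<noteq> 0} \<subseteq> N" "{x \<in> ?S - N - ?S. c x \<noteq> 0} \<subseteq> N" for c :: "real \<Rightarrow> real"
      by auto
    note nn = negligible_subset[OF N this(1)] negligible_subset[OF N this(2)]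
    show "(\<lambda>x. norm (clip n (f x) - clip n (g k x))) integrable_on (?S - N)" for k
      using integrable_norm_Icc(1)[OF set_integral_diff(1)[OF cf[of n] cg[of k]] order_refl order_refl]
      by (rule integrable_spike_set) (rule nn)+
    show "(\<lambda>x. 2 * real (Suc n)) integrable_on (?S - N)"
      by (rule integrable_spike_set[of _ ?S]) (rule integrable_const_ivl nn)+
    show "norm (norm (clip n (f x) - clip n (g k x))) \<le> 2 * real (Suc n)" for k x
      using norm_triangle_ineq4[of "clip n (f x)" "clip n (g k x)"] clip_bd[of n "f x"] clip_bd[of n "g k x"]
      by simp
    show "(\<lambda>k. norm (clip n (f x) - clip n (g k x))) \<longlonglongrightarrow> 0" if "x \<in> ?S - N" for x
    proof -
      have "(\<lambda>k. g k x) \<longlonglongrightarrow> f x" using gl[of x] that by auto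
      then have "(\<lambda>k. clip n (g k x)) \<longlonglongrightarrow> clip n (f x)"
        by (rule continuous_on_tendsto_compose[OF clip_cont]) auto
      then show ?thesis
        using tendsto_norm[OF tendsto_diff[OF tendsto_const[of "clip n (f x)"]]] by fastforce
    qed
  qed
  moreover have "integral (?S - N) (\<lambda>x. norm (clip n (f x) - clip n (g k x)))
      = integral ?S (\<lambda>x. norm (clip n (f x) - clip n (g k x)))" for k
    by (rule integral_subset_negligible) (auto intro: negligible_subset[OF N])
  ultimately have "\<forall>\<^sub>F k in sequentially. integral ?S (\<lambda>x. norm (clip n (f x) - clip n (g k x))) < \<epsilon> / 3"
    using assms(2) by (intro order_tendstoD(2)[where a="\<epsilon>/3"]) auto
  then obtain k where k: "integral ?S (\<lambda>x. norm (clip n (f x) - clip n (g k x))) < \<epsilon> / 3"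
    by (auto simp: eventually_sequentially)
  \<comment> \<open>A uniform error \<open>\<delta>\<close> costs at most
    \<open>\<delta> * (b - a) < \<epsilon> / 3\<close>; the summand 1 keeps the denominator positive
    on a degenerate interval.\<close>
  define \<delta> where "\<delta> = \<epsilon> / (3 * (\<bar>b - a\<bar> + 1))"
  have "\<delta> > 0" unfolding \<delta>_def using assms(2) by (intro divide_pos_pos mult_pos_pos) linarith+
  then obtain p where p: "polynomial_function p" "\<And>x. x \<in> ?S \<Longrightarrow> norm (clip n (g k x) - p x) < \<delta>"
    using Stone_Weierstrass_polynomial_function[OF _ cgc, of \<delta> k] by auto
  have pc: "continuous_on ?S p" by (rule continuous_on_polymonial_function[OF p(1)])
  have pa: "p absolutely_integrable_on ?S" by (intro absolutely_integrable_continuous_real pc)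
  have "integral ?S (\<lambda>x. norm (clip n (g k x) - p x)) \<le> integral ?S (\<lambda>x. \<delta>)"
    using p(2) by (intro integral_le integrable_norm_Icc(1)[OF set_integral_diff(1)[OF cg pa]]) (auto intro: less_imp_le)
  also have "\<dots> < \<epsilon> / 3"
    using assms(2) by (cases "a \<le> b") (auto simp: \<delta>_def field_simps)
  finally have 3: "integral ?S (\<lambda>x. norm (clip n (g k x) - p x)) < \<epsilon> / 3" .
  let ?F = "\<lambda>x. norm (f x - clip n (f x)) + norm (clip n (f x) - clip n (g k x)) + norm (clip n (g k x) - p x)"
  note ints = integrable_norm_Icc(1)[OF set_integral_diff(1)[OF f cf[of n]] order_refl order_refl]
    integrable_norm_Icc(1)[OF set_integral_diff(1)[OF cf[of n] cg[of k]] order_refl order_refl]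
    integrable_norm_Icc(1)[OF set_integral_diff(1)[OF cg[of k] pa] order_refl order_refl]
  have "integral ?S (\<lambda>x. norm (f x - p x)) \<le> integral ?S ?F"
  proof (intro integral_le)
    show "(\<lambda>x. norm (f x - p x)) integrable_on ?S"
      by (rule integrable_norm_Icc(1)[OF set_integral_diff(1)[OF f pa]]) auto
    show "?F integrable_on ?S" by (intro integrable_add ints)
    fix x
    have "f x - p x = (f x - clip n (f x)) + (clip n (f x) - clip n (g k x)) + (clip n (g k x) - p x)" by simp
    then show "norm (f x - p x) \<le> ?F x"
      by (metis (no_types, lifting) norm_triangle_ineq norm_triangle_mono order_refl)
  qed
  also have "\<dots> < \<epsilon>"
    using n k 3 by (subst integral_add; (intro integrable_add ints)?)
      (subst integral_add; (intro integrable_add ints)?; linarith)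
  finally show ?thesis using that[OF p(1)] by blast
qed

subsection \<open>Calculus of absolutely continuous functions\<close>

lemma has_AC_derivative_integrable:
  "has_AC_derivative f f' a b \<Longrightarrow> f' absolutely_integrable_on {a..b}"
  by (simp add: has_AC_derivative_def)

lemma has_AC_derivative_eq:
  "has_AC_derivative f f' a b \<Longrightarrow> x \<in> {a..b} \<Longrightarrow> f x = f a + integral {a..x} f'"
  unfolding has_AC_derivative_def by blast

lemma has_AC_derivative_diff_integral:
  assumes "has_AC_derivative f f' a b" "a \<le> c" "c \<le> d" "d \<le> b"
  shows "integral {c..d} f' = f d - f c"
proof -
  have "integral {a..c} f' + integral {c..d} f' = integral {a..d} f'"
    using assms integrable_norm_Icc(2)[OF has_AC_derivative_integrable[OF assms(1)], of a d]
    by (intro Henstock_Kurzweil_Integration.integral_combine) auto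
  then show ?thesis
    using has_AC_derivative_eq[OF assms(1), of c] has_AC_derivative_eq[OF assms(1), of d] assms
    by (auto simp: algebra_simps)
qed

lemma has_AC_derivative_cong:
  assumes "has_AC_derivative f f' a b" "\<And>x. x \<in> {a..b} \<Longrightarrow> f x = g x"
    "\<And>x. x \<in> {a..b} \<Longrightarrow> f' x = g' x"
  shows "has_AC_derivative g g' a b"
  unfolding has_AC_derivative_def
proof (intro conjI ballI)
  show "g' absolutely_integrable_on {a..b}"
    by (rule absolutely_integrable_spike[OF has_AC_derivative_integrable[OF assms(1)] negligible_empty])
      (simp add: assms(3))
  fix x assume x: "x \<in> {a..b}"
  have "integral {a..x} g' = integral {a..x} f'"
    using x assms(3) by (intro integral_cong) auto
  then show "g x = g a + integral {a..x} g'"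
    using has_AC_derivative_eq[OF assms(1) x] assms(2) x by auto
qed

lemma has_AC_derivative_integral:
  "f' absolutely_integrable_on {a..b} \<Longrightarrow> has_AC_derivative (\<lambda>x. c + integral {a..x} f') f' a b"
  by (auto simp: has_AC_derivative_def)

lemma has_AC_derivative_continuous:
  assumes "has_AC_derivative f f' a b"
  shows "continuous_on {a..b} f"
proof -
  have "continuous_on {a..b} (\<lambda>x. f a + integral {a..x} f')"
    using has_AC_derivative_integrable[OF assms]
    by (intro continuous_intros indefinite_integral_continuous_1)
      (auto simp: absolutely_integrable_on_def)
  then show ?thesis
    by (rule continuous_on_eq) (rule has_AC_derivative_eq[OF assms, symmetric])
qed

lemma has_AC_derivative_C1:
  assumes "\<And>x. x \<in> {a..b} \<Longrightarrow> (f has_vector_derivative f' x) (at x within {a..b})"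
    and "continuous_on {a..b} f'"
  shows "has_AC_derivative f f' a b"
  unfolding has_AC_derivative_def
proof (intro conjI ballI)
  show "f' absolutely_integrable_on {a..b}"
    by (intro absolutely_integrable_continuous_real assms)
  fix x assume x: "x \<in> {a..b}"
  have "(f' has_integral f x - f a) {a..x}"
    using x
    by (intro fundamental_theorem_of_calculus)
      (auto intro: has_vector_derivative_within_subset[OF assms(1)])
  then show "f x = f a + integral {a..x} f'"
    by (simp add: integral_unique)
qed

lemma has_AC_derivative_const: "has_AC_derivative (\<lambda>x. c) (\<lambda>x. 0) a b"
  by (intro has_AC_derivative_C1) (auto intro: derivative_eq_intros)

lemma has_AC_derivative_add:
  assumes "has_AC_derivative f f' a b" "has_AC_derivative g g' a b"
  shows "has_AC_derivative (\<lambda>x. f x + g x) (\<lambda>x. f' x + g' x) a b"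
  unfolding has_AC_derivative_def
proof (intro conjI ballI)
  show "(\<lambda>x. f' x + g' x) absolutely_integrable_on {a..b}"
    using assms by (auto simp: has_AC_derivative_def)
  fix x assume x: "x \<in> {a..b}"
  have "integral {a..x} (\<lambda>x. f' x + g' x) = integral {a..x} f' + integral {a..x} g'"
    using x assms by (intro integral_add integrable_norm_Icc(2)) (auto simp: has_AC_derivative_def)
  then show "f x + g x = f a + g a + integral {a..x} (\<lambda>x. f' x + g' x)"
    using has_AC_derivative_eq[OF assms(1) x] has_AC_derivative_eq[OF assms(2) x] by simp
qed

lemma has_AC_derivative_linear:
  assumes "bounded_linear L" "has_AC_derivative f f' a b"
  shows "has_AC_derivative (\<lambda>x. L (f x)) (\<lambda>x. L (f' x)) a b"
  unfolding has_AC_derivative_def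
proof (intro conjI ballI)
  interpret bounded_linear L by fact
  show "(\<lambda>x. L (f' x)) absolutely_integrable_on {a..b}"
    using absolutely_integrable_linear[OF has_AC_derivative_integrable[OF assms(2)] assms(1)]
    by (simp add: o_def)
  fix x assume x: "x \<in> {a..b}"
  have "integral {a..x} (\<lambda>x. L (f' x)) = L (integral {a..x} f')"
    using integral_linear[OF integrable_norm_Icc(2)[OF has_AC_derivative_integrable[OF assms(2)]] assms(1), of a x] x
    by (simp add: o_def)
  then show "L (f x) = L (f a) + integral {a..x} (\<lambda>x. L (f' x))"
    using has_AC_derivative_eq[OF assms(2) x] by (simp add: add)
qed

lemmas has_AC_derivative_cmult = has_AC_derivative_linear[OF bounded_linear_mult_right]
lemmas has_AC_derivative_minus = has_AC_derivative_linear[OF bounded_linear_minus[OF bounded_linear_ident]]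

lemma has_AC_derivative_diff:
  assumes "has_AC_derivative f f' a b" "has_AC_derivative g g' a b"
  shows "has_AC_derivative (\<lambda>x. f x - g x) (\<lambda>x. f' x - g' x) a b"
  using has_AC_derivative_add[OF assms(1) has_AC_derivative_minus[OF assms(2)]] by simp

lemma continuous_on_Icc_bounded:
  fixes f :: "real \<Rightarrow> 'a::real_normed_vector"
  assumes "continuous_on {a..b} f"
  obtains B where "B \<ge> 0" "\<And>x. x \<in> {a..b} \<Longrightarrow> norm (f x) \<le> B"
proof -
  have "bounded (f ` {a..b})"
    by (intro compact_imp_bounded compact_continuous_image assms) auto
  then obtain B where "B > 0" "\<And>y. y \<in> f ` {a..b} \<Longrightarrow> norm y \<le> B"
    unfolding bounded_pos by blast
  then show ?thesis by (intro that[of B]) auto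
qed

text \<open>The product and exponential rules follow from the \<open>C\<^sup>1\<close> case because \<open>f'\<close> can be approximated
  in \<open>L\<^sub>1\<close> by polynomials.\<close>

lemma has_AC_derivative_approx:
  fixes f :: "real \<Rightarrow> 'a::euclidean_space"
  assumes "has_AC_derivative f f' a b"
  obtains F F' where "\<And>n. continuous_on {a..b} (F' n)"
    "\<And>n x. x \<in> {a..b} \<Longrightarrow> (F n has_vector_derivative F' n x) (at x within {a..b})"
    "\<And>n. F n a = f a"
    "(\<lambda>n. integral {a..b} (\<lambda>x. norm (F' n x - f' x))) \<longlonglongrightarrow> 0"
    "uniform_limit {a..b} F f sequentially"
proof -
  have f': "f' absolutely_integrable_on {a..b}" by (rule has_AC_derivative_integrable[OF assms])
  have "\<exists>g. polynomial_function g \<and> integral {a..b} (\<lambda>x. norm (f' x - g x)) < 1 / Suc n" for n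
    by (rule absolutely_integrable_approx_polynomial[OF f', of "1 / Suc n"]) (simp, blast)
  then obtain F' where F': "\<And>n. polynomial_function (F' n)"
    and lt: "\<And>n. integral {a..b} (\<lambda>x. norm (f' x - F' n x)) < 1 / Suc n" by metis
  define F where "F = (\<lambda>n x. f a + integral {a..x} (F' n))"
  have c: "continuous_on {a..b} (F' n)" for n by (rule continuous_on_polymonial_function[OF F'])
  have ai: "F' n absolutely_integrable_on {a..b}" for n
    by (intro absolutely_integrable_continuous_real c)
  have lim: "(\<lambda>n. integral {a..b} (\<lambda>x. norm (F' n x - f' x))) \<longlonglongrightarrow> 0"
  proof (rule Lim_null_comparison[OF always_eventually[OF allI] LIMSEQ_inverse_real_of_nat])
    fix n
    have "integral {a..b} (\<lambda>x. norm (F' n x - f' x)) \<ge> 0"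
      by (intro integral_nonneg integrable_norm_Icc(1)[OF set_integral_diff(1)[OF ai f']]) auto
    then show "norm (integral {a..b} (\<lambda>x. norm (F' n x - f' x))) \<le> inverse (real (Suc n))"
      using lt[of n] by (simp add: norm_minus_commute inverse_eq_divide)
  qed
  \<comment> \<open>\<open>F n\<close> and \<open>f\<close> agree at \<open>a\<close>, so their
    difference is the integral of \<open>F' n - f'\<close>: \<open>L1\<close> convergence of the
    derivatives forces uniform convergence of the functions.\<close>
  have le: "norm (F n x - f x) \<le> integral {a..b} (\<lambda>x. norm (F' n x - f' x))" if "x \<in> {a..b}" for n x
  proof -
    have "F n x - f x = integral {a..x} (\<lambda>x. F' n x - f' x)"
      using that has_AC_derivative_eq[OF assms that]
      by (subst integral_diff) (auto simp: F_def intro!: integrable_norm_Icc(2)[OF ai] integrable_norm_Icc(2)[OF f'])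
    also have "norm \<dots> \<le> integral {a..b} (\<lambda>x. norm (F' n x - f' x))"
      using that by (intro norm_integral_subinterval_le[OF set_integral_diff(1)[OF ai f']] integrable_norm_Icc(1)[OF set_integral_diff(1)[OF ai f']]) auto
    finally show ?thesis .
  qed
  show ?thesis
  proof (rule that[of F' F])
    show "uniform_limit {a..b} F f sequentially"
    proof (rule uniform_limitI)
      fix e :: real assume "e > 0"
      from order_tendstoD(2)[OF lim this]
      show "\<forall>\<^sub>F n in sequentially. \<forall>x\<in>{a..b}. dist (F n x) (f x) < e"
      proof (rule eventually_mono, intro ballI)
        fix n x assume I: "integral {a..b} (\<lambda>x. norm (F' n x - f' x)) < e" and x: "x \<in> {a..b}"
        show "dist (F n x) (f x) < e"
          unfolding dist_norm by (rule le_less_trans[OF le[OF x] I])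
      qed
    qed
    show "(F n has_vector_derivative F' n x) (at x within {a..b})" if "x \<in> {a..b}" for n x
      unfolding F_def using has_vector_derivative_add[OF has_vector_derivative_const[of "f a"] integral_has_vector_derivative[OF c[of n] that]]
      unfolding add_0 .
    show "F n a = f a" for n by (simp add: F_def)
  qed (rule c lim)+
qed

text \<open>Split \<open>G F - g f = G (F - f) + (G - g) f\<close>: the first term is small by
  \<open>L1\<close> convergence and boundedness of \<open>G\<close>, the second by uniform
  convergence and integrability of \<open>f\<close>. The limit passages in the product and
  exponential rules have exactly this shape.\<close>

lemma integral_mult_tendsto:
  fixes F :: "nat \<Rightarrow> real \<Rightarrow> 'a::{real_normed_field,euclidean_space}"
  assumes F: "\<And>n. F n absolutely_integrable_on {a..b}" and f: "f absolutely_integrable_on {a..b}"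
    and lim: "(\<lambda>n. integral {a..b} (\<lambda>x. norm (F n x - f x))) \<longlonglongrightarrow> 0"
    and G: "\<And>n. continuous_on {a..b} (G n)" and ul: "uniform_limit {a..b} G g sequentially"
    and x: "x \<in> {a..b}"
  shows "(\<lambda>n. integral {a..x} (\<lambda>t. G n t * F n t)) \<longlonglongrightarrow> integral {a..x} (\<lambda>t. g t * f t)"
proof -
  have gc: "continuous_on {a..b} g"
    by (rule uniform_limit_theorem[OF always_eventually[OF allI[OF G]] ul]) simp
  obtain B where B: "\<And>t. t \<in> {a..b} \<Longrightarrow> norm (g t) \<le> B"
    by (rule continuous_on_Icc_bounded[OF gc]) blast
  have nf: "(\<lambda>t. norm (f t)) integrable_on {a..b}" by (rule integrable_norm_Icc(1)[OF f]) auto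
  let ?I = "integral {a..b} (\<lambda>t. norm (f t))"
  have I0: "?I \<ge> 0" by (intro integral_nonneg nf) auto
  have nd: "(\<lambda>t. norm (F n t - f t)) integrable_on {a..b}" for n
    by (rule integrable_norm_Icc(1)[OF set_integral_diff(1)[OF F f]]) auto
  have key: "norm (integral {a..x} (\<lambda>t. G n t * F n t) - integral {a..x} (\<lambda>t. g t * f t))
      \<le> (B + e) * integral {a..b} (\<lambda>x. norm (F n x - f x)) + e * ?I"
    if e: "\<And>t. t \<in> {a..b} \<Longrightarrow> dist (G n t) (g t) < e" for n e
  proof -
    have Gn: "norm (G n t) \<le> B + e" if "t \<in> {a..b}" for t
      using e[OF that] B[OF that] by (smt (verit) dist_norm norm_triangle_sub)
    note ai = absolutely_integrable_continuous_mult[OF G F] absolutely_integrable_continuous_mult[OF gc f]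
    have "integral {a..x} (\<lambda>t. G n t * F n t) - integral {a..x} (\<lambda>t. g t * f t)
        = integral {a..x} (\<lambda>t. G n t * F n t - g t * f t)"
      using x by (intro integral_diff[symmetric] integrable_norm_Icc(2)[OF ai(1)] integrable_norm_Icc(2)[OF ai(2)]) auto
    also have "norm \<dots> \<le> integral {a..b} (\<lambda>t. (B + e) * norm (F n t - f t) + e * norm (f t))"
    proof (rule norm_integral_subinterval_le[OF set_integral_diff(1)[OF ai(1) ai(2)]])
      fix t assume t: "t \<in> {a..b}"
      have "G n t * F n t - g t * f t = G n t * (F n t - f t) + (G n t - g t) * f t"
        by (simp add: algebra_simps)
      also have "norm \<dots> \<le> norm (G n t) * norm (F n t - f t) + norm (G n t - g t) * norm (f t)"
        by (metis norm_mult norm_triangle_ineq)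
      also have "\<dots> \<le> (B + e) * norm (F n t - f t) + e * norm (f t)"
        using Gn[OF t] e[OF t] by (intro add_mono mult_right_mono) (auto simp: dist_norm)
      finally show "norm (G n t * F n t - g t * f t) \<le> (B + e) * norm (F n t - f t) + e * norm (f t)" .
    qed (use x in \<open>auto intro!: integrable_add integrable_on_mult_right nd nf\<close>)
    also have "\<dots> = (B + e) * integral {a..b} (\<lambda>x. norm (F n x - f x)) + e * ?I"
      by (subst integral_add) (auto intro!: integrable_on_mult_right nd nf)
    finally show ?thesis .
  qed
  have B0: "B \<ge> 0" using B[OF x] norm_ge_zero[of "g x"] by linarith
  show ?thesis
  proof (rule LIMSEQ_I)
    fix r :: real assume r: "r > 0"
    \<comment> \<open>Half of \<open>r\<close> pays for \<open>e * ?I\<close>; the other half is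
      left for the \<open>L1\<close> error, whose factor is \<open>B + e\<close>.\<close>
    define e where "e = r / (2 * (?I + 1))"
    have e: "e > 0" "e * ?I < r / 2 + 0"
      using r I0 by (auto simp: e_def field_simps)
    have be: "B + e > 0" using B0 e by simp
    have 1: "\<forall>\<^sub>F n in sequentially. integral {a..b} (\<lambda>x. norm (F n x - f x)) < r / (2 * (B + e))"
      using r be by (intro order_tendstoD(2)[OF lim]) auto
    have 2: "\<forall>\<^sub>F n in sequentially. \<forall>t\<in>{a..b}. dist (G n t) (g t) < e"
      using uniform_limitD[OF ul e(1)] .
    have "\<forall>\<^sub>F n in sequentially. norm (integral {a..x} (\<lambda>t. G n t * F n t) - integral {a..x} (\<lambda>t. g t * f t)) < r"
      using 1 2
    proof eventually_elim
      case (elim n)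
      have "(B + e) * integral {a..b} (\<lambda>x. norm (F n x - f x)) < r / 2"
        using elim(1) be by (simp add: field_simps)
      then show ?case using key[of n e] elim(2) e(2) by force
    qed
    then show "\<exists>no. \<forall>n\<ge>no. norm (integral {a..x} (\<lambda>t. G n t * F n t) - integral {a..x} (\<lambda>t. g t * f t)) < r"
      by (simp add: eventually_sequentially)
  qed
qed

lemma has_AC_derivative_mult:
  fixes f g :: "real \<Rightarrow> 'a::{real_normed_field,euclidean_space}"
  assumes f: "has_AC_derivative f f' a b" and g: "has_AC_derivative g g' a b"
  shows "has_AC_derivative (\<lambda>x. f x * g x) (\<lambda>x. f x * g' x + g x * f' x) a b"
  unfolding has_AC_derivative_def
proof (intro conjI ballI)
  note ai = absolutely_integrable_continuous_mult[OF has_AC_derivative_continuous[OF f] has_AC_derivative_integrable[OF g]]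
     absolutely_integrable_continuous_mult[OF has_AC_derivative_continuous[OF g] has_AC_derivative_integrable[OF f]]
  show "(\<lambda>x. f x * g' x + g x * f' x) absolutely_integrable_on {a..b}"
    using ai by (rule set_integral_add(1))
  fix x assume x: "x \<in> {a..b}"
  obtain F F' where F: "\<And>n. continuous_on {a..b} (F' n)"
    "\<And>n x. x \<in> {a..b} \<Longrightarrow> (F n has_vector_derivative F' n x) (at x within {a..b})"
    "\<And>n. F n a = f a"
    "(\<lambda>n. integral {a..b} (\<lambda>x. norm (F' n x - f' x))) \<longlonglongrightarrow> 0"
    "uniform_limit {a..b} F f sequentially"
    by (rule has_AC_derivative_approx[OF f]) blast
  obtain G G' where G: "\<And>n. continuous_on {a..b} (G' n)"
    "\<And>n x. x \<in> {a..b} \<Longrightarrow> (G n has_vector_derivative G' n x) (at x within {a..b})"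
    "\<And>n. G n a = g a"
    "(\<lambda>n. integral {a..b} (\<lambda>x. norm (G' n x - g' x))) \<longlonglongrightarrow> 0"
    "uniform_limit {a..b} G g sequentially"
    by (rule has_AC_derivative_approx[OF g]) blast
  have cont: "continuous_on {a..b} (F n)" "continuous_on {a..b} (G n)" for n
    by (rule continuous_on_vector_derivative, erule F(2))
      (rule continuous_on_vector_derivative, erule G(2))
  note aiF = absolutely_integrable_continuous_real[OF F(1)] and aiG = absolutely_integrable_continuous_real[OF G(1)]
  \<comment> \<open>Classical product rule for the smooth approximants. Each integrand pairs a
    uniformly convergent factor with an \<open>L1\<close> convergent one, so both sides pass to the
    limit.\<close>
  have eq: "F n x * G n x = f a * g a + (integral {a..x} (\<lambda>x. F n x * G' n x) + integral {a..x} (\<lambda>x. G n x * F' n x))" for n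
  proof -
    have "((\<lambda>t. F n t * G n t) has_vector_derivative (F n t * G' n t + G n t * F' n t)) (at t within {a..b})"
      if "t \<in> {a..b}" for t
      using has_vector_derivative_mult[OF F(2) G(2), OF that that] by (simp add: mult.commute)
    then have "has_AC_derivative (\<lambda>x. F n x * G n x) (\<lambda>x. F n x * G' n x + G n x * F' n x) a b"
      by (intro has_AC_derivative_C1 continuous_intros cont F G) auto
    from has_AC_derivative_eq[OF this x] show ?thesis
      using x by (subst integral_add[symmetric])
        (auto simp: F G intro!: integrable_norm_Icc(2)[OF absolutely_integrable_continuous_mult[OF cont(1) aiG]]
             integrable_norm_Icc(2)[OF absolutely_integrable_continuous_mult[OF cont(2) aiF]])
  qed
  have "(\<lambda>n. F n x * G n x) \<longlonglongrightarrow> f x * g x"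
    using x by (intro tendsto_mult tendsto_uniform_limitI[OF F(5)] tendsto_uniform_limitI[OF G(5)])
  moreover have "(\<lambda>n. F n x * G n x) \<longlonglongrightarrow>
      f a * g a + (integral {a..x} (\<lambda>x. f x * g' x) + integral {a..x} (\<lambda>x. g x * f' x))"
    unfolding eq
    by (intro tendsto_add tendsto_const
        integral_mult_tendsto[OF aiG has_AC_derivative_integrable[OF g] G(4) cont(1) F(5) x]
        integral_mult_tendsto[OF aiF has_AC_derivative_integrable[OF f] F(4) cont(2) G(5) x])
  ultimately have "f x * g x = f a * g a + (integral {a..x} (\<lambda>x. f x * g' x) + integral {a..x} (\<lambda>x. g x * f' x))"
    by (rule LIMSEQ_unique)
  also have "integral {a..x} (\<lambda>x. f x * g' x) + integral {a..x} (\<lambda>x. g x * f' x) = integral {a..x} (\<lambda>x. f x * g' x + g x * f' x)"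
    using x by (intro integral_add[symmetric] integrable_norm_Icc(2)[OF ai(1)] integrable_norm_Icc(2)[OF ai(2)]) auto
  finally show "f x * g x = f a * g a + integral {a..x} (\<lambda>x. f x * g' x + g x * f' x)" .
qed

lemma has_AC_derivative_exp:
  fixes f :: "real \<Rightarrow> 'a::{real_normed_field,euclidean_space}"
  assumes f: "has_AC_derivative f f' a b"
  shows "has_AC_derivative (\<lambda>x. exp (f x)) (\<lambda>x. exp (f x) * f' x) a b"
  unfolding has_AC_derivative_def
proof (intro conjI ballI)
  have fc: "continuous_on {a..b} f" by (rule has_AC_derivative_continuous[OF f])
  show "(\<lambda>x. exp (f x) * f' x) absolutely_integrable_on {a..b}"
    using absolutely_integrable_continuous_mult[OF continuous_on_exp[OF fc] has_AC_derivative_integrable[OF f]] .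
  fix x assume x: "x \<in> {a..b}"
  obtain F F' where F: "\<And>n. continuous_on {a..b} (F' n)"
    "\<And>n x. x \<in> {a..b} \<Longrightarrow> (F n has_vector_derivative F' n x) (at x within {a..b})"
    "\<And>n. F n a = f a"
    "(\<lambda>n. integral {a..b} (\<lambda>x. norm (F' n x - f' x))) \<longlonglongrightarrow> 0"
    "uniform_limit {a..b} F f sequentially"
    by (rule has_AC_derivative_approx[OF f]) blast
  have cont: "continuous_on {a..b} (F n)" for n
    by (rule continuous_on_vector_derivative) (rule F(2))
  note aiF = absolutely_integrable_continuous_real[OF F(1)]
  obtain B where B: "\<And>t. t \<in> {a..b} \<Longrightarrow> norm (f t) \<le> B"
    by (rule continuous_on_Icc_bounded[OF fc]) blast
  \<comment> \<open>Once \<open>F n\<close> is within distance 1 of \<open>f\<close>, all values lie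
    in the compact ball of radius \<open>B + 1\<close>, where \<open>exp\<close> is uniformly
    continuous.\<close>
  have ul: "uniform_limit {a..b} (\<lambda>n x. exp (F n x)) (\<lambda>x. exp (f x)) sequentially"
  proof (rule uniform_limit_compose_uniformly_continuous_on[OF F(5)])
    show "uniformly_continuous_on (cball 0 (B + 1)) (exp :: 'a \<Rightarrow> 'a)"
      by (intro compact_uniformly_continuous continuous_intros) auto
    show "\<forall>\<^sub>F n in sequentially. \<forall>y\<in>{a..b}. F n y \<in> cball 0 (B + 1)"
      using uniform_limitD[OF F(5), of 1]
    proof (rule eventually_mono)
      fix n assume *: "\<forall>x\<in>{a..b}. dist (F n x) (f x) < 1"
      show "\<forall>y\<in>{a..b}. F n y \<in> cball 0 (B + 1)"
      proof
        fix y assume y: "y \<in> {a..b}"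
        have "norm (F n y) \<le> norm (f y) + norm (F n y - f y)" by (rule norm_triangle_sub)
        then show "F n y \<in> cball 0 (B + 1)"
          using B[OF y] *[rule_format, OF y] by (simp add: dist_norm)
      qed
    qed simp
  qed simp
  have eq: "exp (F n x) = exp (f a) + integral {a..x} (\<lambda>x. exp (F n x) * F' n x)" for n
  proof -
    have "((\<lambda>t. exp (F n t)) has_vector_derivative (exp (F n t) * F' n t)) (at t within {a..b})"
      if "t \<in> {a..b}" for t
      using field_vector_diff_chain_within[OF F(2)[OF that] DERIV_subset[OF DERIV_exp]]
      by (simp add: o_def mult.commute)
    then have "has_AC_derivative (\<lambda>x. exp (F n x)) (\<lambda>x. exp (F n x) * F' n x) a b"
      by (intro has_AC_derivative_C1 continuous_intros cont F) auto
    from has_AC_derivative_eq[OF this x] show ?thesis by (simp add: F)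
  qed
  have "(\<lambda>n. exp (F n x)) \<longlonglongrightarrow> exp (f x)"
    using x by (intro tendsto_uniform_limitI[OF ul])
  moreover have "(\<lambda>n. exp (F n x)) \<longlonglongrightarrow> exp (f a) + integral {a..x} (\<lambda>x. exp (f x) * f' x)"
    unfolding eq
    by (intro tendsto_add tendsto_const
        integral_mult_tendsto[OF aiF has_AC_derivative_integrable[OF f] F(4) _ ul x] continuous_intros cont)
  ultimately show "exp (f x) = exp (f a) + integral {a..x} (\<lambda>x. exp (f x) * f' x)"
    by (rule LIMSEQ_unique)
qed

section \<open>Almost everywhere uniqueness, Gronwall's inequality, existence of solutions\<close>

lemma AE_eq_0_if_integral_Ioo_subintervals:
  fixes f :: "real \<Rightarrow> 'a::euclidean_space"
  assumes f: "f absolutely_integrable_on {a..b}"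
    and 0: "\<And>c d. a < c \<Longrightarrow> c < d \<Longrightarrow> d < b \<Longrightarrow> integral {c..d} f = 0"
  shows "negligible {x \<in> {a..b}. f x \<noteq> 0}"
proof -
  define F where "F = (\<lambda>x. if x \<in> {a..b} then f x else 0)"
  have "f integrable_on {a..b}" using f by (simp add: absolutely_integrable_on_def)
  then have "F integrable_on UNIV"
    unfolding F_def by (subst integrable_restrict_UNIV)
  then have "F integrable_on cbox c d" for c d
    by (rule integrable_on_subcbox) auto
  \<comment> \<open>Lebesgue differentiation: off a null set the means over
    \<open>{x..x + h}\<close> converge to the value at \<open>x\<close>. These means vanish for
    small \<open>h\<close>, so the value does as well.\<close>
  then obtain N where N: "negligible N" and
    lim: "\<And>x e. \<lbrakk>x \<notin> N; 0 < e\<rbrakk> \<Longrightarrow> \<exists>d>0. \<forall>h. 0 < h \<and> h < d \<longrightarrow>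
         norm (integral (cbox x (x + h *\<^sub>R One)) F /\<^sub>R h ^ DIM(real) - F x) < e"
    by (rule integrable_ccontinuous_explicit) blast
  have "f x = 0" if x: "x \<notin> N" "x \<in> {a<..<b}" for x
  proof (rule ccontr)
    assume nz: "f x \<noteq> 0"
    then obtain d where d: "d > 0" "\<And>h. 0 < h \<and> h < d \<Longrightarrow>
         norm (integral (cbox x (x + h *\<^sub>R One)) F /\<^sub>R h ^ DIM(real) - F x) < norm (f x)"
      using lim[OF x(1), of "norm (f x)"] by auto
    \<comment> \<open>Both halvings give strict inequalities: \<open>h\<close> stays inside the
      window \<open>d\<close>, and \<open>x + h\<close> stays below \<open>b\<close>.\<close>
    define h where "h = min (d/2) ((b - x)/2)"
    have "h \<le> d/2" "h \<le> (b - x)/2"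
      unfolding h_def by (rule min.cobounded1, rule min.cobounded2)
    moreover have "0 < h" using d(1) x by (simp add: h_def)
    ultimately have h: "0 < h" "h < d" "x + h < b" using d(1) x by (auto simp: field_simps)
    have "integral {x..x+h} F = integral {x..x+h} f"
      using h x by (intro integral_cong) (auto simp: F_def)
    also have "\<dots> = 0" using h x by (intro 0) auto
    finally show False using d(2)[of h] h x by (auto simp: F_def)
  qed
  then have "{x \<in> {a..b}. f x \<noteq> 0} \<subseteq> N \<union> {a, b}" by force
  then show ?thesis
    by (rule negligible_subset[rotated]) (auto intro: N)
qed

text \<open>Needed because the derivative in \<open>is_distr_product\<close> is an arbitrary
  representative, which has to be identified with the explicit derivative of
  \<open>1 / sqrt \<rho>\<close>.\<close>

lemma has_AC_derivative_unique:
  assumes "has_AC_derivative f f' a b" "has_AC_derivative f f'' a b"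
  shows "negligible {x \<in> {a..b}. f' x \<noteq> f'' x}"
proof -
  have D: "has_AC_derivative (\<lambda>x. 0) (\<lambda>x. f' x - f'' x) a b"
    using has_AC_derivative_diff[OF assms] by simp
  have "negligible {x \<in> {a..b}. f' x - f'' x \<noteq> 0}"
    by (rule AE_eq_0_if_integral_Ioo_subintervals[OF has_AC_derivative_integrable[OF D]])
       (simp add: has_AC_derivative_diff_integral[OF D])
  then show ?thesis by simp
qed

text \<open>Let \<open>V\<close> be the right-hand side of the integral inequality and
  \<open>E\<close> the exponential of \<open>- \<integral>m\<close>. Then \<open>V E\<close> has
  derivative \<open>- E m (V - \<phi>)\<close>, which is nonpositive, so \<open>V E\<close> never
  exceeds its initial value \<open>c\<close>. The product rule for absolutely continuous functions
  allows \<open>m\<close> to be merely integrable.\<close>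

lemma gronwall_integrable:
  fixes \<phi> m :: "real \<Rightarrow> real"
  assumes m: "m absolutely_integrable_on {a..b}" and m0: "\<And>t. t \<in> {a..b} \<Longrightarrow> m t \<ge> 0"
    and \<phi>: "continuous_on {a..b} \<phi>"
    and le: "\<And>t. t \<in> {a..b} \<Longrightarrow> \<phi> t \<le> c + integral {a..t} (\<lambda>\<tau>. \<phi> \<tau> * m \<tau>)"
    and t: "t \<in> {a..b}"
  shows "\<phi> t \<le> c * exp (integral {a..t} m)"
proof -
  define V where "V = (\<lambda>t. c + integral {a..t} (\<lambda>\<tau>. \<phi> \<tau> * m \<tau>))"
  define E where "E = (\<lambda>t. exp (- (0 + integral {a..t} m)))"
  have V: "has_AC_derivative V (\<lambda>\<tau>. \<phi> \<tau> * m \<tau>) a b"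
    unfolding V_def by (intro has_AC_derivative_integral absolutely_integrable_continuous_mult \<phi> m)
  have E: "has_AC_derivative E (\<lambda>t. E t * - m t) a b"
    unfolding E_def
    by (intro has_AC_derivative_exp has_AC_derivative_minus has_AC_derivative_integral m)
  note VE = has_AC_derivative_mult[OF V E]
  have "V t * E t = V a * E a + integral {a..t} (\<lambda>x. V x * (E x * - m x) + E x * (\<phi> x * m x))"
    by (rule has_AC_derivative_eq[OF VE t])
  also have "\<dots> \<le> V a * E a + integral {a..t} (\<lambda>x. 0)"
  proof (intro add_mono order_refl integral_le)
    show "(\<lambda>x. V x * (E x * - m x) + E x * (\<phi> x * m x)) integrable_on {a..t}"
      using t by (intro integrable_norm_Icc(2)[OF has_AC_derivative_integrable[OF VE]]) auto
    fix x assume "x \<in> {a..t}"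
    then have x: "x \<in> {a..b}" using t by auto
    have "V x * (E x * - m x) + E x * (\<phi> x * m x) = - (E x * m x * (V x - \<phi> x))"
      by (simp add: algebra_simps)
    also have "\<dots> \<le> 0" using m0[OF x] le[OF x] by (simp add: E_def V_def)
    finally show "V x * (E x * - m x) + E x * (\<phi> x * m x) \<le> 0" .
  qed auto
  finally have "V t * E t \<le> c" by (simp add: V_def E_def)
  then have "V t \<le> c * exp (integral {a..t} m)"
    by (simp add: E_def exp_minus field_simps)
  then show ?thesis using le[OF t] by (simp add: V_def)
qed

text \<open>Picard iteration; the weight \<open>exp (2 \<integral>m)\<close> makes every step gain a factor \<open>1/2\<close>.\<close>

lemma caratheodory_exists:
  fixes F :: "real \<Rightarrow> 'a::euclidean_space \<Rightarrow> 'a"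
  assumes ab: "a \<le> b" and m: "m absolutely_integrable_on {a..b}"
    and lip: "\<And>t x y. t \<in> {a..b} \<Longrightarrow> norm (F t x - F t y) \<le> m t * norm (x - y)"
    and int: "\<And>z. continuous_on {a..b} z \<Longrightarrow> (\<lambda>t. F t (z t)) absolutely_integrable_on {a..b}"
  obtains z where "has_AC_derivative z (\<lambda>t. F t (z t)) a b" "z a = z0"
proof -
  define T where "T = (\<lambda>z t. z0 + integral {a..t} (\<lambda>\<tau>. F \<tau> (z \<tau>)))"
  define Z where "Z = (\<lambda>n. (T ^^ n) (\<lambda>t. z0))"
  have T: "has_AC_derivative (T z) (\<lambda>t. F t (z t)) a b" if "continuous_on {a..b} z" for z
    unfolding T_def by (intro has_AC_derivative_integral int that)
  have cont: "continuous_on {a..b} (Z n)" for n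
    by (induction n) (auto simp: Z_def intro: has_AC_derivative_continuous[OF T])
  have ZSuc: "Z (Suc n) = T (Z n)" for n by (simp add: Z_def)
  define M where "M = (\<lambda>t. integral {a..t} m)"
  \<comment> \<open>Applying the Lipschitz bound to a unit vector and 0 already forces the sign of
    \<open>m\<close>.\<close>
  have m0: "m t \<ge> 0" if "t \<in> {a..b}" for t
  proof -
    obtain e :: 'a where e: "norm e = 1" using nonempty_Basis norm_Basis by blast
    have "0 \<le> norm (F t e - F t 0)" by simp
    also have "\<dots> \<le> m t" using lip[OF that, of e 0] e by simp
    finally show ?thesis .
  qed
  have M: "has_AC_derivative M m a b"
    using has_AC_derivative_integral[OF m, of 0] unfolding M_def by simp
  have e2M: "has_AC_derivative (\<lambda>t. exp (2 * M t)) (\<lambda>t. exp (2 * M t) * (2 * m t)) a b"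
    by (intro has_AC_derivative_exp has_AC_derivative_cmult M)
  have diff: "T x t - T y t = integral {a..t} (\<lambda>\<tau>. F \<tau> (x \<tau>) - F \<tau> (y \<tau>))"
    if "continuous_on {a..b} x" "continuous_on {a..b} y" "t \<in> {a..b}" for x y t
    using that by (subst integral_diff)
      (auto simp: T_def intro!: integrable_norm_Icc(2)[OF int[OF that(1)]] integrable_norm_Icc(2)[OF int[OF that(2)]])
  obtain D where D: "D \<ge> 0" "\<And>t. t \<in> {a..b} \<Longrightarrow> norm (Z 1 t - Z 0 t) \<le> D"
    by (rule continuous_on_Icc_bounded[OF continuous_on_diff[OF cont[of 1] cont[of 0]]]) blast
  have step: "norm (Z (Suc n) t - Z n t) \<le> D * (1/2) ^ n * exp (2 * M t)" if "t \<in> {a..b}" for n t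
    using that
  proof (induction n arbitrary: t)
    case 0
    have "M t \<ge> 0" unfolding M_def
      using 0 m0 by (intro integral_nonneg integrable_norm_Icc(2)[OF m]) auto
    then have "D * 1 \<le> D * exp (2 * M t)" using D(1) by (intro mult_left_mono) auto
    then show ?case using D(2)[OF 0] by simp
  next
    case (Suc n)
    let ?c = "D * (1/2) ^ n"
    have ai: "(\<lambda>\<tau>. F \<tau> (Z (Suc n) \<tau>) - F \<tau> (Z n \<tau>)) absolutely_integrable_on {a..t}"
      using Suc.prems by (intro absolutely_integrable_on_subinterval_Icc[OF set_integral_diff(1)[OF int int]] cont) auto
    have "norm (Z (Suc (Suc n)) t - Z (Suc n) t) = norm (integral {a..t} (\<lambda>\<tau>. F \<tau> (Z (Suc n) \<tau>) - F \<tau> (Z n \<tau>)))"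
      unfolding ZSuc[of "Suc n"] by (subst (2) ZSuc) (simp only: diff[OF cont cont Suc.prems])
    \<comment> \<open>\<open>m exp (2 M)\<close> is half the derivative of the weight
      \<open>exp (2 M)\<close>; integrating it returns the weight with the factor
      \<open>1/2\<close>.\<close>
    also have "\<dots> \<le> integral {a..t} (\<lambda>\<tau>. ?c / 2 * (exp (2 * M \<tau>) * (2 * m \<tau>)))"
    proof (rule norm_integral_subinterval_le[OF ai order_refl order_refl])
      show "(\<lambda>\<tau>. ?c / 2 * (exp (2 * M \<tau>) * (2 * m \<tau>))) integrable_on {a..t}"
        using Suc.prems
        by (intro integrable_on_mult_right integrable_norm_Icc(2)[OF has_AC_derivative_integrable[OF e2M]]) auto
      fix \<tau> assume "\<tau> \<in> {a..t}"
      then have \<tau>: "\<tau> \<in> {a..b}" using Suc.prems by auto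
      have "norm (F \<tau> (Z (Suc n) \<tau>) - F \<tau> (Z n \<tau>)) \<le> m \<tau> * (?c * exp (2 * M \<tau>))"
        by (rule order_trans[OF lip[OF \<tau>] mult_left_mono[OF Suc.IH[OF \<tau>] m0[OF \<tau>]]])
      then show "norm (F \<tau> (Z (Suc n) \<tau>) - F \<tau> (Z n \<tau>)) \<le> ?c / 2 * (exp (2 * M \<tau>) * (2 * m \<tau>))"
        by (simp add: algebra_simps)
    qed
    also have "\<dots> = ?c / 2 * (exp (2 * M t) - exp (2 * M a))"
      using has_AC_derivative_diff_integral[OF e2M, of a t] Suc.prems by (simp only: integral_mult_right) auto
    also have "\<dots> \<le> ?c / 2 * exp (2 * M t)"
      using D(1) by (intro mult_left_mono) auto
    finally show ?case by simp
  qed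
  obtain E where E: "E \<ge> 0" "\<And>t. t \<in> {a..b} \<Longrightarrow> norm (exp (2 * M t)) \<le> E"
    by (rule continuous_on_Icc_bounded[OF has_AC_derivative_continuous[OF e2M]]) blast
  have "norm (Z (Suc n) t - Z n t) \<le> D * E * (1/2) ^ n" if "t \<in> {a..b}" for n t
  proof -
    have "D * (1/2) ^ n * exp (2 * M t) \<le> D * (1/2) ^ n * E"
      using D(1) E(2)[OF that] by (intro mult_left_mono) auto
    then show ?thesis using step[OF that, of n] by (simp add: mult_ac)
  qed
  \<comment> \<open>The iterates are partial sums of a telescoping series dominated by a geometric
    one.\<close>
  then have "uniform_limit {a..b} (\<lambda>n t. \<Sum>i<n. Z (Suc i) t - Z i t) (\<lambda>t. \<Sum>i. Z (Suc i) t - Z i t) sequentially"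
    by (rule Weierstrass_m_test) (auto intro!: summable_mult summable_geometric)
  then have "uniform_limit {a..b} (\<lambda>n t. (\<Sum>i<n. Z (Suc i) t - Z i t) + Z 0 t)
      (\<lambda>t. (\<Sum>i. Z (Suc i) t - Z i t) + Z 0 t) sequentially"
    by (intro uniform_limit_add uniform_limit_const)
  moreover have "(\<Sum>i<n. Z (Suc i) t - Z i t) + Z 0 t = Z n t" for n t
    using sum_lessThan_telescope[of "\<lambda>i. Z i t" n] by simp
  ultimately obtain z where ul: "uniform_limit {a..b} Z z sequentially" by auto
  have zc: "continuous_on {a..b} z"
    by (rule uniform_limit_theorem[OF always_eventually[OF allI[OF cont]] ul]) simp
  have Mb: "M b \<ge> 0" unfolding M_def
    using ab m0 by (intro integral_nonneg integrable_norm_Icc(2)[OF m]) auto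
  \<comment> \<open>\<open>T\<close> is Lipschitz in the uniform norm with constant
    \<open>M b\<close>, so \<open>Z (Suc n) = T (Z n)\<close> passes to the limit and makes
    \<open>z\<close> a fixed point.\<close>
  have zT: "z t = T z t" if t: "t \<in> {a..b}" for t
  proof (rule LIMSEQ_unique)
    show "(\<lambda>n. Z (Suc n) t) \<longlonglongrightarrow> z t"
      using LIMSEQ_Suc[OF tendsto_uniform_limitI[OF ul t]] .
    show "(\<lambda>n. Z (Suc n) t) \<longlonglongrightarrow> T z t"
    proof (rule metric_LIMSEQ_I)
      fix e :: real assume e: "e > 0"
      define d where "d = e / (M b + 1)"
      have d: "d > 0" "d * M b < e" using e Mb by (auto simp: d_def field_simps)
      have "\<forall>\<^sub>F n in sequentially. dist (Z (Suc n) t) (T z t) < e"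
        using uniform_limitD[OF ul d(1)]
      proof (rule eventually_mono)
        fix n assume n: "\<forall>x\<in>{a..b}. dist (Z n x) (z x) < d"
        have "norm (T (Z n) t - T z t) = norm (integral {a..t} (\<lambda>\<tau>. F \<tau> (Z n \<tau>) - F \<tau> (z \<tau>)))"
          by (simp only: diff[OF cont zc t])
        also have "\<dots> \<le> integral {a..b} (\<lambda>\<tau>. d * m \<tau>)"
        proof (rule norm_integral_subinterval_le[OF set_integral_diff(1)[OF int[OF cont] int[OF zc]]])
          show "(\<lambda>\<tau>. d * m \<tau>) integrable_on {a..b}"
            by (intro integrable_on_mult_right integrable_norm_Icc(2)[OF m]) auto
          fix \<tau> assume \<tau>: "\<tau> \<in> {a..b}"
          have "norm (F \<tau> (Z n \<tau>) - F \<tau> (z \<tau>)) \<le> m \<tau> * norm (Z n \<tau> - z \<tau>)" by (rule lip[OF \<tau>])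
          also have "\<dots> \<le> m \<tau> * d"
            using n \<tau> m0[OF \<tau>] by (intro mult_left_mono) (auto simp: dist_norm intro: less_imp_le)
          finally show "norm (F \<tau> (Z n \<tau>) - F \<tau> (z \<tau>)) \<le> d * m \<tau>" by (simp add: mult.commute)
        qed (use t in auto)
        also have "\<dots> = d * M b" by (simp add: M_def)
        also have "\<dots> < e" by (rule d(2))
        finally show "dist (Z (Suc n) t) (T z t) < e" by (simp add: ZSuc dist_norm)
      qed
      then show "\<exists>no. \<forall>n\<ge>no. dist (Z (Suc n) t) (T z t) < e"
        by (simp add: eventually_sequentially)
    qed
  qed
  show ?thesis
  proof (rule that)
    show "has_AC_derivative z (\<lambda>t. F t (z t)) a b"
      by (rule has_AC_derivative_cong[OF T[OF zc]]) (simp_all add: zT[symmetric])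
    show "z a = z0" using zT[of a] ab by (simp add: T_def)
  qed
qed

subsection \<open>The oscillatory system\<close>

text \<open>\<open>m\<close> is the component of the solution that dominates once the factor \<open>exp (\<plusminus> \<i> lam t)\<close> is split
  off, \<open>k\<close> is the subordinate one.\<close>

definition osc_system :: "(real \<Rightarrow> complex) \<Rightarrow> (real \<Rightarrow> complex) \<Rightarrow> complex \<Rightarrow> real \<Rightarrow>
    (real \<Rightarrow> complex) \<Rightarrow> (real \<Rightarrow> complex) \<Rightarrow> bool" where
  "osc_system s g lam l m k \<longleftrightarrow>
     has_AC_derivative m (\<lambda>t. s t * k t - g t / (2 * \<i> * lam) * (m t + k t)) 0 l \<and>
     has_AC_derivative k (\<lambda>t. 2 * \<i> * lam * k t + s t * m t + g t / (2 * \<i> * lam) * (m t + k t)) 0 l \<and>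
     m 0 = 1 \<and> k 0 = 0"

lemma absolutely_integrable_mult_continuous:
  fixes f g :: "real \<Rightarrow> 'a::{real_normed_field,euclidean_space}"
  assumes "continuous_on {a..b} g" and "f absolutely_integrable_on {a..b}"
  shows "(\<lambda>x. f x * g x) absolutely_integrable_on {a..b}"
  using absolutely_integrable_continuous_mult[OF assms] by (simp add: mult.commute)

lemma absolutely_integrable_divide_const:
  fixes f :: "real \<Rightarrow> 'a::{real_normed_field,euclidean_space}"
  assumes "f absolutely_integrable_on {a..b}"
  shows "(\<lambda>x. f x / c) absolutely_integrable_on {a..b}"
  using absolutely_integrable_mult_continuous[OF continuous_on_const[of _ "1 / c"] assms] by simp

lemma osc_system_exists:
  assumes l: "0 \<le> l" and s: "s absolutely_integrable_on {0..l}" and g: "g absolutely_integrable_on {0..l}"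
  shows "\<exists>m k. osc_system s g lam l m k"
proof -
  \<comment> \<open>For \<open>lam = 0\<close> division by zero gives \<open>G = 0\<close>, so
    solutions exist for every \<open>lam\<close> and can later be chosen as functions of
    \<open>lam\<close>.\<close>
  define G where "G = (\<lambda>t. g t / (2 * \<i> * lam))"
  have G: "G absolutely_integrable_on {0..l}"
    unfolding G_def by (intro absolutely_integrable_divide_const g)
  define F :: "real \<Rightarrow> complex \<times> complex \<Rightarrow> complex \<times> complex" where
    "F = (\<lambda>t z. (s t * snd z - G t * (fst z + snd z), 2 * \<i> * lam * snd z + s t * fst z + G t * (fst z + snd z)))"
  \<comment> \<open>\<open>s\<close> and \<open>G\<close> each enter both components;
    \<open>G\<close> multiplies the sum of the two coordinates, whose norm is at most twice that of
    the pair, hence the constants 2 and 4.\<close>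
  define M where "M = (\<lambda>t. 2 * norm (s t) + 4 * norm (G t) + norm (2 * \<i> * lam))"
  obtain z where z: "has_AC_derivative z (\<lambda>t. F t (z t)) 0 l" "z 0 = (1, 0)"
  proof (rule caratheodory_exists[OF l])
    show "M absolutely_integrable_on {0..l}"
      unfolding M_def using absolutely_integrable_norm[OF s] absolutely_integrable_norm[OF G]
      by (intro set_integral_add(1) set_integrable_mult_right absolutely_integrable_on_const) (auto simp: o_def)
    show "norm (F t x - F t y) \<le> M t * norm (x - y)" for t x y
    proof -
      define d e where "d = fst (x - y)" and "e = snd (x - y)"
      have le: "norm d \<le> norm (x - y)" "norm e \<le> norm (x - y)"
        unfolding d_def e_def by (metis norm_fst_le prod.collapse, metis norm_snd_le prod.collapse)
      have de: "norm (d + e) \<le> 2 * norm (x - y)" using norm_triangle_ineq[of d e] le by linarith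
      have "F t x - F t y = (s t * e - G t * (d + e), 2 * \<i> * lam * e + s t * d + G t * (d + e))"
        by (simp add: F_def d_def e_def algebra_simps)
      also have "norm \<dots> \<le> norm (s t * e - G t * (d + e)) + norm (2 * \<i> * lam * e + s t * d + G t * (d + e))"
        by (rule norm_Pair_le)
      also have "\<dots> \<le> (norm (s t) * norm e + norm (G t) * norm (d + e))
          + (norm (2 * \<i> * lam) * norm e + norm (s t) * norm d + norm (G t) * norm (d + e))"
        unfolding norm_mult[symmetric]
        by (intro add_mono norm_triangle_ineq4 order_trans[OF norm_triangle_ineq] norm_triangle_ineq order_refl)
      also have "\<dots> \<le> (norm (s t) * norm (x - y) + norm (G t) * (2 * norm (x - y)))
          + (norm (2 * \<i> * lam) * norm (x - y) + norm (s t) * norm (x - y) + norm (G t) * (2 * norm (x - y)))"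
        by (intro add_mono mult_left_mono le de) auto
      finally show ?thesis by (simp add: M_def algebra_simps)
    qed
    show "(\<lambda>t. F t (z t)) absolutely_integrable_on {0..l}" if z: "continuous_on {0..l} z" for z
    proof -
      have "(\<lambda>t. (s t * snd (z t) - G t * (fst (z t) + snd (z t)))) absolutely_integrable_on {0..l}"
        by (intro set_integral_diff(1) absolutely_integrable_mult_continuous s G continuous_intros z)
      from absolutely_integrable_linear[OF this bounded_linear_Pair[OF bounded_linear_ident bounded_linear_zero]]
      have 1: "(\<lambda>t. (s t * snd (z t) - G t * (fst (z t) + snd (z t)), 0::complex)) absolutely_integrable_on {0..l}"
        by (simp add: o_def)
      have "(\<lambda>t. 2 * \<i> * lam * snd (z t) + s t * fst (z t) + G t * (fst (z t) + snd (z t))) absolutely_integrable_on {0..l}"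
        by (intro set_integral_add(1) absolutely_integrable_mult_continuous[of _ _ _ s] absolutely_integrable_mult_continuous[of _ _ _ G]
             s G continuous_intros z absolutely_integrable_continuous_real)
      from absolutely_integrable_linear[OF this bounded_linear_Pair[OF bounded_linear_zero bounded_linear_ident]]
      have 2: "(\<lambda>t. (0::complex, 2 * \<i> * lam * snd (z t) + s t * fst (z t) + G t * (fst (z t) + snd (z t)))) absolutely_integrable_on {0..l}"
        by (simp add: o_def)
      show ?thesis using set_integral_add(1)[OF 1 2] by (simp add: F_def)
    qed
  qed
  have "osc_system s g lam l (\<lambda>t. fst (z t)) (\<lambda>t. snd (z t))"
    unfolding osc_system_def
    using has_AC_derivative_linear[OF bounded_linear_fst z(1)] has_AC_derivative_linear[OF bounded_linear_snd z(1)] z(2)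
    by (simp add: F_def G_def)
  then show ?thesis by blast
qed

text \<open>The modulus is the exponential of \<open>- 2 Im lam (t - \<tau>)\<close>, and
  \<open>t - \<tau>\<close> is nonnegative. This is why the subordinate component is integrated from
  the left end when \<open>Im lam \<ge> - r\<close>.\<close>

lemma norm_exp_diff_le:
  assumes "Im lam \<ge> - r" "r \<ge> 0" "0 \<le> \<tau>" "\<tau> \<le> t" "t \<le> l"
  shows "norm (exp (2 * \<i> * lam * of_real t) * exp (- (2 * \<i> * lam) * of_real \<tau>)) \<le> exp (2 * r * l)"
proof -
  have "exp (2 * \<i> * lam * of_real t) * exp (- (2 * \<i> * lam) * of_real \<tau>) = exp (2 * \<i> * lam * of_real (t - \<tau>))"
    by (simp add: exp_add[symmetric] algebra_simps)
  also have "norm \<dots> = exp (2 * (- Im lam * (t - \<tau>)))"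
    by (simp add: norm_exp_eq_Re)
  also have "\<dots> \<le> exp (2 * (r * l))"
    using assms by (intro iffD2[OF exp_le_cancel_iff] mult_left_mono order_trans[OF mult_right_mono[of "- Im lam" r "t - \<tau>"] mult_left_mono[of "t - \<tau>" l r]]) auto
  finally show ?thesis by (simp add: mult.assoc)
qed

text \<open>Each of the two exponentials alone may be unbounded in \<open>lam\<close>; they have to
  be merged under the integral before norms are taken.\<close>

lemma norm_oscillatory_convolution_le:
  assumes "Im lam \<ge> - r" "r \<ge> 0" and w: "w absolutely_integrable_on {0..l}" and t: "t \<in> {0..l}"
    and v: "v integrable_on {0..t}" "\<And>\<tau>. \<tau> \<in> {0..t} \<Longrightarrow> norm (w \<tau>) \<le> v \<tau>"
  shows "norm (exp (2 * \<i> * lam * of_real t) * integral {0..t} (\<lambda>\<tau>. exp (- (2 * \<i> * lam) * of_real \<tau>) * w \<tau>))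
      \<le> exp (2 * r * l) * integral {0..t} v"
proof -
  let ?e = "\<lambda>\<tau>. exp (2 * \<i> * lam * of_real t) * exp (- (2 * \<i> * lam) * of_real \<tau>)"
  have ai: "(\<lambda>\<tau>. ?e \<tau> * w \<tau>) absolutely_integrable_on {0..t}"
    using t by (intro absolutely_integrable_continuous_mult continuous_intros absolutely_integrable_on_subinterval_Icc[OF w]) auto
  have "norm (exp (2 * \<i> * lam * of_real t) * integral {0..t} (\<lambda>\<tau>. exp (- (2 * \<i> * lam) * of_real \<tau>) * w \<tau>))
      = norm (integral {0..t} (\<lambda>\<tau>. ?e \<tau> * w \<tau>))"
    by (simp add: mult.assoc)
  also have "\<dots> \<le> integral {0..t} (\<lambda>\<tau>. exp (2 * r * l) * v \<tau>)"
  proof (rule norm_integral_subinterval_le[OF ai order_refl order_refl])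
    show "(\<lambda>\<tau>. exp (2 * r * l) * v \<tau>) integrable_on {0..t}" by (intro integrable_on_mult_right v)
    fix \<tau> assume \<tau>: "\<tau> \<in> {0..t}"
    show "norm (?e \<tau> * w \<tau>) \<le> exp (2 * r * l) * v \<tau>"
      unfolding norm_mult[of _ "w \<tau>"]
      using \<tau> t by (intro mult_mono norm_exp_diff_le assms v) auto
  qed
  finally show ?thesis by simp
qed

text \<open>Multiplying \<open>k\<close> by \<open>exp (- 2 \<i> lam t)\<close> cancels the term
  \<open>2 \<i> lam k\<close> of the equation, and \<open>k 0 = 0\<close> leaves no boundary
  term.\<close>

lemma osc_system_variation_of_constants:
  assumes sys: "osc_system s g lam l m k" and t: "t \<in> {0..l}"
  shows "k t = exp (2 * \<i> * lam * of_real t) * integral {0..t} (\<lambda>\<tau>. exp (- (2 * \<i> * lam) * of_real \<tau>) *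
      (s \<tau> * m \<tau> + g \<tau> / (2 * \<i> * lam) * (m \<tau> + k \<tau>)))"
proof -
  let ?E = "\<lambda>\<tau>. exp (- (2 * \<i> * lam) * of_real \<tau>)"
  have E: "has_AC_derivative ?E (\<lambda>\<tau>. ?E \<tau> * (- (2 * \<i> * lam))) 0 l"
    by (intro has_AC_derivative_exp has_AC_derivative_C1 continuous_intros)
      (auto intro!: derivative_eq_intros)
  have k: "has_AC_derivative k (\<lambda>t. 2 * \<i> * lam * k t + s t * m t + g t / (2 * \<i> * lam) * (m t + k t)) 0 l" "k 0 = 0"
    using sys by (auto simp: osc_system_def)
  have "?E t * k t = ?E 0 * k 0 + integral {0..t} (\<lambda>\<tau>. ?E \<tau> * (2 * \<i> * lam * k \<tau> + s \<tau> * m \<tau> + g \<tau> / (2 * \<i> * lam) * (m \<tau> + k \<tau>))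
      + k \<tau> * (?E \<tau> * (- (2 * \<i> * lam))))"
    by (rule has_AC_derivative_eq[OF has_AC_derivative_mult[OF E k(1)] t])
  also have "\<dots> = integral {0..t} (\<lambda>\<tau>. ?E \<tau> * (s \<tau> * m \<tau> + g \<tau> / (2 * \<i> * lam) * (m \<tau> + k \<tau>)))"
    using k(2) by (simp add: algebra_simps)
  finally have "exp (2 * \<i> * lam * of_real t) * (?E t * k t) = exp (2 * \<i> * lam * of_real t) *
      integral {0..t} (\<lambda>\<tau>. ?E \<tau> * (s \<tau> * m \<tau> + g \<tau> / (2 * \<i> * lam) * (m \<tau> + k \<tau>)))" by simp
  moreover have "exp (2 * \<i> * lam * of_real t) * (?E t * k t) = k t"
    by (simp add: exp_minus)
  ultimately show ?thesis by simp
qed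

lemma osc_system_integrable:
  assumes sys: "osc_system s g lam l m k"
    and s: "s absolutely_integrable_on {0..l}" and g: "g absolutely_integrable_on {0..l}"
  shows "continuous_on {0..l} m" "continuous_on {0..l} k"
    "(\<lambda>\<tau>. s \<tau> * m \<tau>) absolutely_integrable_on {0..l}"
    "(\<lambda>\<tau>. g \<tau> / (2 * \<i> * lam) * (m \<tau> + k \<tau>)) absolutely_integrable_on {0..l}"
    "(\<lambda>\<tau>. s \<tau> * k \<tau> - g \<tau> / (2 * \<i> * lam) * (m \<tau> + k \<tau>)) absolutely_integrable_on {0..l}"
proof -
  show c: "continuous_on {0..l} m" "continuous_on {0..l} k"
    using sys by (auto simp: osc_system_def intro: has_AC_derivative_continuous)
  show "(\<lambda>\<tau>. s \<tau> * m \<tau>) absolutely_integrable_on {0..l}"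
    by (intro absolutely_integrable_mult_continuous s c)
  show "(\<lambda>\<tau>. g \<tau> / (2 * \<i> * lam) * (m \<tau> + k \<tau>)) absolutely_integrable_on {0..l}"
    by (intro absolutely_integrable_mult_continuous absolutely_integrable_divide_const g c continuous_intros)
  show "(\<lambda>\<tau>. s \<tau> * k \<tau> - g \<tau> / (2 * \<i> * lam) * (m \<tau> + k \<tau>)) absolutely_integrable_on {0..l}"
    using sys by (auto simp: osc_system_def dest: has_AC_derivative_integrable)
qed

text \<open>Gronwall for the sum of the two norms. The equation for \<open>m\<close> contributes the
  factor 1, the convolution formula for \<open>k\<close> the factor \<open>exp (2 r l)\<close>, and
  \<open>norm lam \<ge> 1\<close> allows \<open>g / (2 \<i> lam)\<close> to be bounded by
  \<open>g\<close>. The result is independent of \<open>lam\<close>.\<close>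

lemma osc_system_bounded:
  assumes sys: "osc_system s g lam l m k"
    and s: "s absolutely_integrable_on {0..l}" and g: "g absolutely_integrable_on {0..l}"
    and lam: "Im lam \<ge> - r" "r \<ge> 0" "norm lam \<ge> 1" and t: "t \<in> {0..l}"
  shows "norm (m t) + norm (k t) \<le> exp ((1 + exp (2 * r * l)) * integral {0..l} (\<lambda>\<tau>. norm (s \<tau>) + norm (g \<tau>)))"
proof -
  let ?C = "exp (2 * r * l)"
  let ?G = "\<lambda>\<tau>. g \<tau> / (2 * \<i> * lam) * (m \<tau> + k \<tau>)"
  define \<phi> where "\<phi> = (\<lambda>t. norm (m t) + norm (k t))"
  define N where "N = (\<lambda>\<tau>. norm (s \<tau>) + norm (g \<tau>))"
  define M where "M = (\<lambda>\<tau>. (1 + ?C) * N \<tau>)"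
  note ints = osc_system_integrable[OF sys s g]
  have N: "N absolutely_integrable_on {0..l}"
    unfolding N_def using absolutely_integrable_norm[OF s] absolutely_integrable_norm[OF g]
    by (intro set_integral_add(1)) (auto simp: o_def)
  then have M: "M absolutely_integrable_on {0..l}"
    unfolding M_def by (intro set_integrable_mult_right)
  have \<phi>: "continuous_on {0..l} \<phi>" unfolding \<phi>_def by (intro continuous_intros ints)
  have N\<phi>: "(\<lambda>\<tau>. N \<tau> * \<phi> \<tau>) absolutely_integrable_on {0..l}"
    by (intro absolutely_integrable_mult_continuous \<phi> N)
  have Gle: "norm (?G \<tau>) \<le> norm (g \<tau>) * \<phi> \<tau>" for \<tau>
  proof -
    have "norm (?G \<tau>) = norm (g \<tau>) * norm (m \<tau> + k \<tau>) / (2 * norm lam)"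
      by (simp add: norm_mult norm_divide)
    also have "\<dots> \<le> norm (g \<tau>) * norm (m \<tau> + k \<tau>) / 1"
      using lam(3) by (intro divide_left_mono) auto
    also have "\<dots> \<le> norm (g \<tau>) * \<phi> \<tau>"
      unfolding \<phi>_def by (simp add: mult_left_mono norm_triangle_ineq)
    finally show ?thesis .
  qed
  have le1: "norm (s \<tau> * m \<tau> + ?G \<tau>) \<le> N \<tau> * \<phi> \<tau>" for \<tau>
  proof -
    have "norm (s \<tau> * m \<tau>) \<le> norm (s \<tau>) * \<phi> \<tau>" by (simp add: norm_mult \<phi>_def mult_left_mono)
    then show ?thesis using Gle[of \<tau>] norm_triangle_ineq[of "s \<tau> * m \<tau>" "?G \<tau>"] by (simp add: N_def algebra_simps)
  qed
  have le2: "norm (s \<tau> * k \<tau> - ?G \<tau>) \<le> N \<tau> * \<phi> \<tau>" for \<tau>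
  proof -
    have "norm (s \<tau> * k \<tau>) \<le> norm (s \<tau>) * \<phi> \<tau>" by (simp add: norm_mult \<phi>_def mult_left_mono)
    then show ?thesis using Gle[of \<tau>] norm_triangle_ineq4[of "s \<tau> * k \<tau>" "?G \<tau>"] by (simp add: N_def algebra_simps)
  qed
  have "\<phi> t \<le> 1 + integral {0..t} (\<lambda>\<tau>. \<phi> \<tau> * M \<tau>)" if t: "t \<in> {0..l}" for t
  proof -
    have iN: "(\<lambda>\<tau>. N \<tau> * \<phi> \<tau>) integrable_on {0..t}"
      using t by (intro integrable_norm_Icc(2)[OF N\<phi>]) auto
    have "norm (k t) \<le> ?C * integral {0..t} (\<lambda>\<tau>. N \<tau> * \<phi> \<tau>)"
      unfolding osc_system_variation_of_constants[OF sys t]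
      by (intro norm_oscillatory_convolution_le lam t set_integral_add(1)[OF ints(3,4)] iN le1)
    moreover have "norm (m t) \<le> 1 + integral {0..t} (\<lambda>\<tau>. N \<tau> * \<phi> \<tau>)"
    proof -
      have "m t = 1 + integral {0..t} (\<lambda>\<tau>. s \<tau> * k \<tau> - ?G \<tau>)"
        using sys has_AC_derivative_eq[of m _ 0 l t] t unfolding osc_system_def by metis
      moreover have "norm (integral {0..t} (\<lambda>\<tau>. s \<tau> * k \<tau> - ?G \<tau>)) \<le> integral {0..t} (\<lambda>\<tau>. N \<tau> * \<phi> \<tau>)"
        using t by (intro norm_integral_subinterval_le[OF absolutely_integrable_on_subinterval_Icc[OF ints(5)]] iN le2) auto
      ultimately show ?thesis
        using norm_triangle_ineq[of 1 "integral {0..t} (\<lambda>\<tau>. s \<tau> * k \<tau> - ?G \<tau>)"] by simp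
    qed
    moreover have "integral {0..t} (\<lambda>\<tau>. \<phi> \<tau> * M \<tau>) = (1 + ?C) * integral {0..t} (\<lambda>\<tau>. N \<tau> * \<phi> \<tau>)"
      unfolding M_def by (subst integral_mult_right[symmetric]) (simp add: mult_ac)
    ultimately show ?thesis by (simp add: \<phi>_def algebra_simps)
  qed
  then have "\<phi> t \<le> 1 * exp (integral {0..t} M)"
    by (intro gronwall_integrable[OF M _ \<phi> _ t]) (auto simp: M_def N_def)
  also have "integral {0..t} M \<le> integral {0..l} M"
    using t by (intro integral_subset_le integrable_norm_Icc(2)[OF M]) (auto simp: M_def N_def)
  finally show ?thesis by (simp add: \<phi>_def M_def N_def)
qed

text \<open>Integration by parts against the exponential gains the factor
  \<open>1 / norm lam\<close>. The derivative falls on \<open>p m\<close>; that of \<open>m\<close>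
  is read off from the system and is bounded in \<open>L1\<close> uniformly in \<open>lam\<close>.
  The summands of the bound are the boundary terms at \<open>t\<close> and at 0 and the remaining
  integral.\<close>

lemma osc_system_C1_oscillation_le:
  assumes sys: "osc_system s g lam l m k"
    and s: "s absolutely_integrable_on {0..l}" and g: "g absolutely_integrable_on {0..l}"
    and lam: "Im lam \<ge> - r" "r \<ge> 0" "norm lam \<ge> 1" and t: "t \<in> {0..l}"
    and p: "\<And>x. x \<in> {0..l} \<Longrightarrow> (p has_vector_derivative p' x) (at x within {0..l})"
    and p': "continuous_on {0..l} p'"
    and B: "\<And>x. x \<in> {0..l} \<Longrightarrow> norm (m x) + norm (k x) \<le> B"
    and S: "\<And>x. x \<in> {0..l} \<Longrightarrow> norm (p x) \<le> S" and S': "\<And>x. x \<in> {0..l} \<Longrightarrow> norm (p' x) \<le> S'"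
  shows "norm (exp (2 * \<i> * lam * of_real t) * integral {0..t} (\<lambda>\<tau>. exp (- (2 * \<i> * lam) * of_real \<tau>) * (p \<tau> * m \<tau>)))
    \<le> (S * B + exp (2 * r * l) * (S * B + integral {0..l} (\<lambda>\<tau>. S * (B * (norm (s \<tau>) + norm (g \<tau>))) + B * S'))) / norm lam"
proof -
  let ?C = "exp (2 * r * l)"
  let ?L = "2 * \<i> * lam"
  let ?X = "exp (?L * of_real t)"
  let ?E = "\<lambda>\<tau>. exp (- ?L * of_real \<tau>)"
  define m' where "m' = (\<lambda>\<tau>. s \<tau> * k \<tau> - g \<tau> / ?L * (m \<tau> + k \<tau>))"
  have m: "has_AC_derivative m m' 0 l"
    using sys by (simp add: osc_system_def m'_def)
  note ints = osc_system_integrable[OF sys s g]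
  have lam0: "norm lam > 0" using lam(3) by linarith
  have Bm: "norm (m x) \<le> B" "norm (k x) \<le> B" if "x \<in> {0..l}" for x
    using B[OF that] norm_ge_zero[of "m x"] norm_ge_zero[of "k x"] by linarith+
  have 0: "0 \<in> {0..l}" using t by auto
  have B0: "B \<ge> 0" and S0: "S \<ge> 0" and S'0: "S' \<ge> 0"
    using order_trans[OF norm_ge_zero Bm(1)[OF t]] order_trans[OF norm_ge_zero S[OF t]]
      order_trans[OF norm_ge_zero S'[OF t]] .
  have m'le: "norm (m' x) \<le> B * (norm (s x) + norm (g x))" if x: "x \<in> {0..l}" for x
  proof -
    have "norm (s x * k x) \<le> norm (s x) * B"
      unfolding norm_mult by (intro mult_left_mono Bm x) auto
    moreover have "norm (g x / ?L * (m x + k x)) \<le> norm (g x) * B"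
    proof -
      have "norm (g x / ?L * (m x + k x)) = norm (g x) * norm (m x + k x) / (2 * norm lam)"
        by (simp add: norm_mult norm_divide)
      also have "\<dots> \<le> norm (g x) * norm (m x + k x) / 1"
        using lam(3) by (intro divide_left_mono) auto
      also have "\<dots> \<le> norm (g x) * B"
        using order_trans[OF norm_triangle_ineq B[OF x]] by (simp add: mult_left_mono)
      finally show ?thesis .
    qed
    ultimately show ?thesis
      unfolding m'_def using norm_triangle_ineq4[of "s x * k x" "g x / ?L * (m x + k x)"]
      by (simp add: algebra_simps)
  qed
  have pAC: "has_AC_derivative p p' 0 l"
    by (rule has_AC_derivative_C1[OF p p'])
  have pc: "continuous_on {0..l} p" by (rule has_AC_derivative_continuous[OF pAC])
  note pm = has_AC_derivative_mult[OF pAC m]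
  note pm_int = has_AC_derivative_integrable[OF pm]
  have E: "has_AC_derivative ?E (\<lambda>\<tau>. ?E \<tau> * (- ?L)) 0 l"
    by (intro has_AC_derivative_exp has_AC_derivative_C1 continuous_intros)
      (auto intro!: derivative_eq_intros)
  have Ec: "continuous_on {0..l} ?E" by (intro continuous_intros)
  define J where "J = integral {0..t} (\<lambda>\<tau>. ?E \<tau> * (p \<tau> * m \<tau>))"
  define Q where "Q = integral {0..t} (\<lambda>\<tau>. ?E \<tau> * (p \<tau> * m' \<tau> + m \<tau> * p' \<tau>))"
  have i1: "(\<lambda>\<tau>. ?E \<tau> * (p \<tau> * m' \<tau> + m \<tau> * p' \<tau>)) integrable_on {0..t}"
    using t by (intro integrable_norm_Icc(2)[OF absolutely_integrable_continuous_mult[OF Ec pm_int]]) auto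
  have "continuous_on {0..l} (\<lambda>\<tau>. ?E \<tau> * (p \<tau> * m \<tau>))" by (intro continuous_intros pc ints)
  then have i2: "(\<lambda>\<tau>. ?E \<tau> * (p \<tau> * m \<tau>)) integrable_on {0..t}"
    using t by (intro integrable_continuous_real) (auto elim: continuous_on_subset)
  have "?E t * (p t * m t) = ?E 0 * (p 0 * m 0) +
      integral {0..t} (\<lambda>\<tau>. ?E \<tau> * (p \<tau> * m' \<tau> + m \<tau> * p' \<tau>) + p \<tau> * m \<tau> * (?E \<tau> * (- ?L)))"
    by (rule has_AC_derivative_eq[OF has_AC_derivative_mult[OF E pm] t])
  also have "(\<lambda>\<tau>. ?E \<tau> * (p \<tau> * m' \<tau> + m \<tau> * p' \<tau>) + p \<tau> * m \<tau> * (?E \<tau> * (- ?L)))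
     = (\<lambda>\<tau>. ?E \<tau> * (p \<tau> * m' \<tau> + m \<tau> * p' \<tau>) - ?L * (?E \<tau> * (p \<tau> * m \<tau>)))"
    by (intro ext) (simp add: mult_ac)
  also have "integral {0..t} \<dots> = Q - ?L * J"
    unfolding Q_def J_def
    by (subst integral_diff[OF i1 integrable_on_mult_right[OF i2]]) (simp only: integral_mult_right)
  finally have "?L * J = Q + ?E 0 * (p 0 * m 0) - ?E t * (p t * m t)" by (simp add: algebra_simps)
  then have "?X * (?L * J) = ?X * (Q + ?E 0 * (p 0 * m 0) - ?E t * (p t * m t))" by (rule arg_cong)
  \<comment> \<open>The factor \<open>?X\<close> is distributed before norms are taken: it cancels
    \<open>?E t\<close> exactly and leaves \<open>?X * ?E 0\<close> bounded by
    \<open>?C\<close>.\<close>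
  then have "?L * (?X * J) = ?X * Q + (?X * ?E 0) * (p 0 * m 0) - (?X * ?E t) * (p t * m t)"
    by (simp only: ring_distribs mult_ac)
  also have "?X * ?E t = 1" by (simp add: exp_minus)
  finally have eq: "?L * (?X * J) = ?X * Q + (?X * ?E 0) * (p 0 * m 0) - p t * m t" by simp
  let ?V = "\<lambda>\<tau>. S * (B * (norm (s \<tau>) + norm (g \<tau>))) + B * S'"
  have V: "?V integrable_on {0..u}" if "u \<le> l" for u
    using that by (intro integrable_add integrable_on_mult_right integrable_const_ivl
       integrable_norm_Icc(1)[OF s] integrable_norm_Icc(1)[OF g]) auto
  have "norm (?X * Q) \<le> ?C * integral {0..t} ?V"
    unfolding Q_def
  proof (rule norm_oscillatory_convolution_le[OF lam(1,2) pm_int t])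
    show "?V integrable_on {0..t}" using t by (intro V) auto
    fix x assume "x \<in> {0..t}"
    then have x: "x \<in> {0..l}" using t by auto
    show "norm (p x * m' x + m x * p' x) \<le> ?V x"
      by (rule order_trans[OF norm_triangle_ineq], unfold norm_mult)
        (intro add_mono mult_mono S S' Bm m'le B0 S0 x norm_ge_zero)
  qed
  also have "\<dots> \<le> ?C * integral {0..l} ?V"
    using t B0 S0 S'0 by (intro mult_left_mono integral_subset_le V) auto
  finally have 1: "norm (?X * Q) \<le> ?C * integral {0..l} ?V" .
  have "norm (?X * ?E 0) \<le> ?C" using t norm_exp_diff_le[OF lam(1,2), of 0 t l] by simp
  then have 2: "norm ((?X * ?E 0) * (p 0 * m 0)) \<le> ?C * (S * B)"
    unfolding norm_mult[of _ "p 0 * m 0"] norm_mult[of "p 0"]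
    by (intro mult_mono S Bm 0 mult_nonneg_nonneg S0) auto
  have 3: "norm (p t * m t) \<le> S * B"
    unfolding norm_mult by (intro mult_mono S Bm t S0) auto
  have "norm lam * norm (?X * J) \<le> norm (?L * (?X * J))"
    unfolding norm_mult[of ?L] by (intro mult_right_mono) (auto simp: norm_mult)
  also have "\<dots> \<le> norm (?X * Q) + norm ((?X * ?E 0) * (p 0 * m 0)) + norm (p t * m t)"
    unfolding eq by (intro order_trans[OF norm_triangle_ineq4] add_mono norm_triangle_ineq order_refl)
  also have "\<dots> \<le> ?C * integral {0..l} ?V + ?C * (S * B) + S * B"
    by (intro add_mono 1 2 3)
  finally have "norm (?X * J) * norm lam \<le> S * B + ?C * (S * B + integral {0..l} ?V)"
    by (simp add: ring_distribs mult_ac)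
  then show ?thesis
    unfolding J_def[symmetric] by (rule mult_imp_le_div_pos[OF lam0])
qed

text \<open>In the convolution formula for \<open>k\<close> the coefficient \<open>s\<close> is
  split into a polynomial and a remainder small in \<open>L1\<close>. The remainder is harmless for
  all \<open>lam\<close> at once; the polynomial part and the \<open>g\<close> part decay like
  \<open>1 / norm lam\<close>. Smallness of \<open>m - 1\<close> follows from that of
  \<open>k\<close>, because \<open>s\<close> multiplies only \<open>k\<close> in the equation for
  \<open>m\<close>. \<open>R\<close> precedes \<open>lam\<close> and \<open>t\<close>, which gives
  the uniformity.\<close>

theorem osc_system_asymptotics:
  assumes s: "s absolutely_integrable_on {0..l}" and g: "g absolutely_integrable_on {0..l}"
    and l: "l \<ge> 0" and r: "r \<ge> 0" and \<epsilon>: "\<epsilon> > 0"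
  shows "\<exists>R. \<forall>lam m k. osc_system s g lam l m k \<longrightarrow> Im lam \<ge> - r \<longrightarrow> norm lam > R \<longrightarrow>
    (\<forall>t\<in>{0..l}. norm (m t - 1) < \<epsilon> \<and> norm (k t) < \<epsilon>)"
proof -
  define C where "C = exp (2 * r * l)"
  define B where "B = exp ((1 + C) * integral {0..l} (\<lambda>\<tau>. norm (s \<tau>) + norm (g \<tau>)))"
  define S1 where "S1 = integral {0..l} (\<lambda>\<tau>. norm (s \<tau>))"
  define N where "N = integral {0..l} (\<lambda>\<tau>. norm (g \<tau>))"
  \<comment> \<open>\<open>\<eta>\<close> is the target for \<open>k\<close>: its contribution
    \<open>\<eta> * S1\<close> to \<open>m - 1\<close> stays below \<open>\<epsilon> / 2\<close>,
    and \<open>\<eta> \<le> \<epsilon>\<close>. In turn \<open>\<delta>\<close> is chosen so that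
    the \<open>L1\<close> remainder uses half of \<open>\<eta>\<close>.\<close>
  define \<eta> where "\<eta> = \<epsilon> / (2 * (S1 + 1))"
  define \<delta> where "\<delta> = \<eta> / (2 * (C * B))"
  have ns: "(\<lambda>\<tau>. norm (s \<tau>)) integrable_on {0..t}" and ng: "(\<lambda>\<tau>. norm (g \<tau>)) integrable_on {0..t}"
    if "t \<le> l" for t
    using that by (intro integrable_norm_Icc(1)[OF s] integrable_norm_Icc(1)[OF g]; simp)+
  have nonneg: "C > 0" "B > 0" "S1 \<ge> 0" "N \<ge> 0"
    using ns ng by (auto simp: C_def B_def S1_def N_def intro!: integral_nonneg)
  have \<eta>: "\<eta> > 0" "\<eta> * S1 < \<epsilon> / 2" "\<eta> \<le> \<epsilon>"
    using \<epsilon> nonneg(3) mult_nonneg_nonneg[OF less_imp_le[OF \<epsilon>] nonneg(3)] by (auto simp: \<eta>_def field_simps)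
  have \<delta>: "\<delta> > 0" "C * (B * \<delta>) = \<eta> / 2"
    using \<eta> nonneg by (auto simp: \<delta>_def field_simps)
  obtain p where p: "polynomial_function p" "integral {0..l} (\<lambda>x. norm (s x - p x)) < \<delta>"
    by (rule absolutely_integrable_approx_polynomial[OF s \<delta>(1)])
  obtain p' where p': "polynomial_function p'" "\<And>x. (p has_vector_derivative p' x) (at x)"
    by (rule has_vector_derivative_polynomial_function[OF p(1)]) blast
  note pc = continuous_on_polymonial_function[OF p(1)] and p'c = continuous_on_polymonial_function[OF p'(1)]
  obtain S where S: "\<And>x. x \<in> {0..l} \<Longrightarrow> norm (p x) \<le> S"
    by (rule continuous_on_Icc_bounded[OF pc]) blast
  obtain S' where S': "\<And>x. x \<in> {0..l} \<Longrightarrow> norm (p' x) \<le> S'"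
    by (rule continuous_on_Icc_bounded[OF p'c]) blast
  define K where "K = S * B + C * (S * B + integral {0..l} (\<lambda>\<tau>. S * (B * (norm (s \<tau>) + norm (g \<tau>))) + B * S'))"
  \<comment> \<open>The three demands on \<open>norm lam\<close>: validity of the bound
    \<open>B\<close>, the decaying parts of \<open>k\<close> below \<open>\<eta> / 2\<close>, and
    the \<open>g\<close> part of \<open>m - 1\<close> below \<open>\<epsilon> / 2\<close>.\<close>
  define R where "R = max 1 (max (2 * (K + C * (B * N)) / \<eta>) (2 * (B * N) / \<epsilon>))"
  have sp: "(\<lambda>x. s x - p x) absolutely_integrable_on {0..l}"
    by (intro set_integral_diff(1) s absolutely_integrable_continuous_real pc)
  show ?thesis
  proof (intro exI[of _ R] allI impI ballI)
    fix lam m k t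
    assume sys: "osc_system s g lam l m k" and Im: "Im lam \<ge> - r" and R: "norm lam > R" and t: "t \<in> {0..l}"
    have "norm lam > 1" "norm lam > 2 * (K + C * (B * N)) / \<eta>" "norm lam > 2 * (B * N) / \<epsilon>"
      using R by (auto simp: R_def)
    moreover from this have "norm lam > 0" by linarith
    ultimately have lam1: "norm lam \<ge> 1" and lamK: "(K + C * (B * N)) / norm lam < \<eta> / 2"
      and lamN: "B * N / norm lam < \<epsilon> / 2"
      using \<eta>(1) \<epsilon> by (auto simp: field_simps)
    note ints = osc_system_integrable[OF sys s g]
    let ?G = "\<lambda>\<tau>. g \<tau> / (2 * \<i> * lam) * (m \<tau> + k \<tau>)"
    have B: "norm (m x) + norm (k x) \<le> B" if "x \<in> {0..l}" for x
      using osc_system_bounded[OF sys s g Im r lam1 that] by (simp add: B_def C_def)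
    have Gle: "norm (?G x) \<le> B / norm lam * norm (g x)" if x: "x \<in> {0..l}" for x
    proof -
      have "norm (?G x) = norm (m x + k x) / (2 * norm lam) * norm (g x)"
        by (simp add: norm_mult norm_divide)
      also have "\<dots> \<le> B / norm lam * norm (g x)"
        using order_trans[OF norm_triangle_ineq B[OF x]] lam1 nonneg
        by (intro mult_right_mono frac_le) auto
      finally show ?thesis .
    qed
    have klt: "norm (k t) < \<eta>" if t: "t \<in> {0..l}" for t
    proof -
      let ?X = "exp (2 * \<i> * lam * of_real t)"
      let ?I = "\<lambda>w. integral {0..t} (\<lambda>\<tau>. exp (- (2 * \<i> * lam) * of_real \<tau>) * w \<tau>)"
      have ai: "(\<lambda>\<tau>. (s \<tau> - p \<tau>) * m \<tau>) absolutely_integrable_on {0..l}"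
        "(\<lambda>\<tau>. p \<tau> * m \<tau>) absolutely_integrable_on {0..l}"
        by (intro absolutely_integrable_mult_continuous sp ints)
          (intro absolutely_integrable_continuous_real continuous_intros pc ints)
      have int: "(\<lambda>\<tau>. exp (- (2 * \<i> * lam) * of_real \<tau>) * w \<tau>) integrable_on {0..t}"
        if "w absolutely_integrable_on {0..l}" for w
        using t by (intro integrable_norm_Icc(2)[OF absolutely_integrable_continuous_mult[OF _ that]] continuous_intros) auto
      have "k t = ?X * ?I (\<lambda>\<tau>. s \<tau> * m \<tau> + ?G \<tau>)"
        by (rule osc_system_variation_of_constants[OF sys t])
      also have "(\<lambda>\<tau>. s \<tau> * m \<tau> + ?G \<tau>) = (\<lambda>\<tau>. (s \<tau> - p \<tau>) * m \<tau> + (p \<tau> * m \<tau> + ?G \<tau>))"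
        by (intro ext) (simp add: left_diff_distrib)
      also have "?I \<dots> = ?I (\<lambda>\<tau>. (s \<tau> - p \<tau>) * m \<tau>) + (?I (\<lambda>\<tau>. p \<tau> * m \<tau>) + ?I ?G)"
        unfolding distrib_left[of "exp _"]
        by (subst integral_add[OF int[OF ai(1)] integrable_add[OF int[OF ai(2)] int[OF ints(4)]]])
           (subst integral_add[OF int[OF ai(2)] int[OF ints(4)]], rule refl)
      finally have k: "k t = ?X * ?I (\<lambda>\<tau>. (s \<tau> - p \<tau>) * m \<tau>) + ?X * ?I (\<lambda>\<tau>. p \<tau> * m \<tau>) + ?X * ?I ?G"
        by (simp only: distrib_left add.assoc)
      have "norm (?X * ?I (\<lambda>\<tau>. (s \<tau> - p \<tau>) * m \<tau>)) \<le> C * integral {0..t} (\<lambda>\<tau>. B * norm (s \<tau> - p \<tau>))"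
        unfolding C_def
      proof (rule norm_oscillatory_convolution_le[OF Im r ai(1) t])
        show "(\<lambda>\<tau>. B * norm (s \<tau> - p \<tau>)) integrable_on {0..t}"
          using t by (intro integrable_on_mult_right integrable_norm_Icc(1)[OF sp]) auto
        fix x assume "x \<in> {0..t}"
        then have "norm (m x) \<le> B" using B[of x] t norm_ge_zero[of "k x"] by (auto intro: order_trans[rotated])
        then show "norm ((s x - p x) * m x) \<le> B * norm (s x - p x)"
          unfolding norm_mult by (simp add: mult.commute[of B] mult_left_mono)
      qed
      also have "\<dots> \<le> C * integral {0..l} (\<lambda>\<tau>. B * norm (s \<tau> - p \<tau>))"
        using t nonneg by (intro mult_left_mono integral_subset_le integrable_on_mult_right integrable_norm_Icc(1)[OF sp]) auto
      also have "\<dots> \<le> C * (B * \<delta>)"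
        using p(2) nonneg by auto
      also have "\<dots> = \<eta> / 2" by (rule \<delta>(2))
      finally have 1: "norm (?X * ?I (\<lambda>\<tau>. (s \<tau> - p \<tau>) * m \<tau>)) \<le> \<eta> / 2" .
      have 2: "norm (?X * ?I (\<lambda>\<tau>. p \<tau> * m \<tau>)) \<le> K / norm lam"
        unfolding K_def C_def
        by (rule osc_system_C1_oscillation_le[OF sys s g Im r lam1 t has_vector_derivative_at_within[OF p'(2)] p'c B S S'])
      have "norm (?X * ?I ?G) \<le> C * integral {0..t} (\<lambda>\<tau>. B / norm lam * norm (g \<tau>))"
        unfolding C_def using t
        by (intro norm_oscillatory_convolution_le[OF Im r ints(4) t] integrable_on_mult_right ng Gle) auto
      also have "\<dots> \<le> C * integral {0..l} (\<lambda>\<tau>. B / norm lam * norm (g \<tau>))"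
        using t nonneg by (intro mult_left_mono integral_subset_le integrable_on_mult_right ng) auto
      also have "\<dots> = C * (B * N) / norm lam" by (simp add: N_def)
      finally have 3: "norm (?X * ?I ?G) \<le> C * (B * N) / norm lam" .
      have "norm (k t) \<le> \<eta> / 2 + K / norm lam + C * (B * N) / norm lam"
        unfolding k by (intro order_trans[OF norm_triangle_ineq] add_mono 1 2 3)
      also have "\<dots> = \<eta> / 2 + (K + C * (B * N)) / norm lam" by (simp add: add_divide_distrib)
      also have "\<dots> < \<eta>" using lamK by linarith
      finally show ?thesis .
    qed
    have "m t = 1 + integral {0..t} (\<lambda>\<tau>. s \<tau> * k \<tau> - ?G \<tau>)"
      using sys has_AC_derivative_eq[of m _ 0 l t] t unfolding osc_system_def by metis
    then have "norm (m t - 1) = norm (integral {0..t} (\<lambda>\<tau>. s \<tau> * k \<tau> - ?G \<tau>))" by simp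
    also have "\<dots> \<le> integral {0..l} (\<lambda>\<tau>. \<eta> * norm (s \<tau>) + B / norm lam * norm (g \<tau>))"
    proof (rule norm_integral_subinterval_le[OF ints(5)])
      show "(\<lambda>\<tau>. \<eta> * norm (s \<tau>) + B / norm lam * norm (g \<tau>)) integrable_on {0..l}"
        by (intro integrable_add integrable_on_mult_right ns ng order_refl)
      fix x assume x: "x \<in> {0..l}"
      have "norm (s x * k x) \<le> \<eta> * norm (s x)"
        unfolding norm_mult using klt[OF x] by (simp add: mult.commute[of \<eta>] mult_left_mono)
      then show "norm (s x * k x - ?G x) \<le> \<eta> * norm (s x) + B / norm lam * norm (g x)"
        using Gle[OF x] by (intro order_trans[OF norm_triangle_ineq4] add_mono)
    qed (use t in auto)
    also have "\<dots> = \<eta> * S1 + B * N / norm lam"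
      by (subst integral_add[OF integrable_on_mult_right[OF ns] integrable_on_mult_right[OF ng]])
        (simp_all add: S1_def N_def)
    also have "\<dots> < \<epsilon>" using \<eta>(2) lamN by linarith
    finally show "norm (m t - 1) < \<epsilon> \<and> norm (k t) < \<epsilon>" using klt[OF t] \<eta>(3) by auto
  qed
qed

subsection \<open>The lemma of du Bois-Reymond\<close>

text \<open>The derivative is carried as a witness, so closure under sums, products and affine
  substitutions is a plain induction; the iterates of \<open>vector_derivative\<close> in
  \<open>test_functions\<close> do not lend themselves to this.\<close>

fun n_times_differentiable :: "nat \<Rightarrow> (real \<Rightarrow> complex) \<Rightarrow> bool" where
  "n_times_differentiable 0 f \<longleftrightarrow> True"
| "n_times_differentiable (Suc n) f \<longleftrightarrow>
     (\<exists>f'. (\<forall>x. (f has_vector_derivative f' x) (at x)) \<and> n_times_differentiable n f')"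

lemma n_times_differentiable_Suc_imp:
  "n_times_differentiable (Suc n) f \<Longrightarrow> n_times_differentiable n f"
proof (induction n arbitrary: f)
  case (Suc n)
  then obtain f' where "\<forall>x. (f has_vector_derivative f' x) (at x)" "n_times_differentiable (Suc n) f'"
    by (auto simp del: n_times_differentiable.simps simp: n_times_differentiable.simps(2)[of "Suc n"])
  then show ?case using Suc.IH[of f'] by auto
qed simp

text \<open>The bridge to \<open>test_functions\<close>. One more order is assumed because the n-th
  iterate itself has to be differentiable.\<close>

lemma n_times_differentiable_iterated_derivative:
  assumes "n_times_differentiable (Suc n) f"
  shows "((\<lambda>g x. vector_derivative g (at x)) ^^ n) f differentiable_on UNIV"
  using assms
proof (induction n arbitrary: f)
  case 0
  then show ?case
    by (auto simp: differentiable_on_def differentiable_def has_vector_derivative_def)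
next
  case (Suc n)
  then obtain f' where f': "\<forall>x. (f has_vector_derivative f' x) (at x)" "n_times_differentiable (Suc n) f'"
    by (auto simp del: n_times_differentiable.simps simp: n_times_differentiable.simps(2)[of "Suc n"])
  then have "(\<lambda>x. vector_derivative f (at x)) = f'" by (auto intro: vector_derivative_at)
  then show ?case using Suc.IH[OF f'(2)] by (simp add: funpow_Suc_right del: funpow.simps)
qed

lemma n_times_differentiable_const: "n_times_differentiable n (\<lambda>x. c)"
  by (induction n arbitrary: c) (auto intro!: exI[of _ "\<lambda>x. 0"])

lemma n_times_differentiable_add:
  "n_times_differentiable n f \<Longrightarrow> n_times_differentiable n g \<Longrightarrow> n_times_differentiable n (\<lambda>x. f x + g x)"
proof (induction n arbitrary: f g)
  case (Suc n)
  then obtain f' g' where "\<forall>x. (f has_vector_derivative f' x) (at x)" "n_times_differentiable n f'"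
    "\<forall>x. (g has_vector_derivative g' x) (at x)" "n_times_differentiable n g'" by auto
  then show ?case using Suc.IH[of f' g']
    by (auto intro!: exI[of _ "\<lambda>x. f' x + g' x"] has_vector_derivative_add)
qed simp

lemma n_times_differentiable_mult:
  "n_times_differentiable n f \<Longrightarrow> n_times_differentiable n g \<Longrightarrow> n_times_differentiable n (\<lambda>x. f x * g x)"
proof (induction n arbitrary: f g)
  case (Suc n)
  then obtain f' g' where *: "\<forall>x. (f has_vector_derivative f' x) (at x)" "n_times_differentiable n f'"
    "\<forall>x. (g has_vector_derivative g' x) (at x)" "n_times_differentiable n g'" by auto
  have "n_times_differentiable n f" "n_times_differentiable n g"
    using Suc.prems by (auto simp del: n_times_differentiable.simps intro: n_times_differentiable_Suc_imp)
  then have "n_times_differentiable n (\<lambda>x. f x * g' x + f' x * g x)"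
    using * by (intro n_times_differentiable_add Suc.IH)
  then show ?case using *
    by (auto intro!: exI[of _ "\<lambda>x. f x * g' x + f' x * g x"] has_vector_derivative_mult)
qed simp

lemma n_times_differentiable_affine:
  "n_times_differentiable n f \<Longrightarrow> n_times_differentiable n (\<lambda>x. f (c * x + d))"
proof (induction n arbitrary: f)
  case (Suc n)
  then obtain f' where *: "\<forall>x. (f has_vector_derivative f' x) (at x)" "n_times_differentiable n f'" by auto
  have "((\<lambda>x. f (c * x + d)) has_vector_derivative of_real c * f' (c * x + d)) (at x)" for x
  proof -
    have "((\<lambda>x. c * x + d) has_vector_derivative c) (at x)"
      by (auto intro!: derivative_eq_intros simp flip: has_real_derivative_iff_has_vector_derivative)
    from vector_diff_chain_at[OF this *(1)[rule_format]] show ?thesis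
      by (simp add: o_def scaleR_conv_of_real)
  qed
  moreover have "n_times_differentiable n (\<lambda>x. of_real c * f' (c * x + d))"
    by (intro n_times_differentiable_mult n_times_differentiable_const Suc.IH *)
  ultimately show ?case by (auto intro!: exI[of _ "\<lambda>x. of_real c * f' (c * x + d)"])
qed simp

text \<open>Derivatives of \<open>exp (- 1 / x)\<close> on the positive half-line stay in this family, with
  \<open>P\<close> replaced by \<open>X\<^sup>2 (P - P')\<close>.\<close>

definition flat_exp :: "real poly \<Rightarrow> real \<Rightarrow> real" where
  "flat_exp P x = (if x > 0 then poly P (1 / x) * exp (- (1 / x)) else 0)"

lemma poly_times_exp_minus_tendsto_0: "((\<lambda>y::real. poly P y * exp (- y)) \<longlongrightarrow> 0) at_top"
proof -
  have "((\<lambda>y::real. \<Sum>i\<le>degree P. coeff P i * (y ^ i / exp y)) \<longlongrightarrow> (\<Sum>i\<le>degree P. coeff P i * 0)) at_top"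
    by (intro tendsto_sum tendsto_mult tendsto_const tendsto_power_div_exp_0)
  then show ?thesis by (simp add: poly_altdef sum_distrib_right exp_minus divide_inverse mult.assoc)
qed

text \<open>The factor \<open>X\<^sup>2\<close>, written \<open>[:0, 0, 1:]\<close>, comes from the
  derivative of \<open>1 / x\<close>. At 0 the difference quotient from the right is
  \<open>y P(y) exp (- y)\<close> with \<open>y = 1 / h\<close>, which tends to 0 at
  infinity.\<close>

lemma has_real_derivative_flat_exp:
  "(flat_exp P has_real_derivative flat_exp ([:0, 0, 1:] * (P - pderiv P)) x) (at x)"
proof -
  consider "x < 0" | "x > 0" | "x = 0" by linarith
  then show ?thesis
  proof cases
    case 1
    have "((\<lambda>x. 0) has_real_derivative 0) (at x)" by simp
    then have "(flat_exp P has_real_derivative 0) (at x)"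
      by (rule has_field_derivative_transform_within_open[of _ _ _ "{..<0}"])
        (use 1 in \<open>auto simp: flat_exp_def\<close>)
    then show ?thesis using 1 by (simp add: flat_exp_def)
  next
    case 2
    have "((\<lambda>x. poly P (1 / x) * exp (- (1 / x))) has_real_derivative
        poly ([:0, 0, 1:] * (P - pderiv P)) (1 / x) * exp (- (1 / x))) (at x)"
      using 2 by (auto intro!: derivative_eq_intros DERIV_chain2[OF poly_DERIV] simp: field_simps power2_eq_square)
    then have "(flat_exp P has_real_derivative poly ([:0, 0, 1:] * (P - pderiv P)) (1 / x) * exp (- (1 / x))) (at x)"
      by (rule has_field_derivative_transform_within_open[of _ _ _ "{0<..}"])
        (use 2 in \<open>auto simp: flat_exp_def\<close>)
    then show ?thesis using 2 by (simp add: flat_exp_def)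
  next
    case 3
    have "((\<lambda>h. flat_exp P h / h) \<longlongrightarrow> 0) (at 0)"
    proof (rule filterlim_split_at)
      show "((\<lambda>h. flat_exp P h / h) \<longlongrightarrow> 0) (at_left 0)"
        by (rule tendsto_eventually)
          (auto simp: eventually_at_filter flat_exp_def)
      have "((\<lambda>h. poly ([:0, 1:] * P) (inverse h) * exp (- inverse h)) \<longlongrightarrow> 0) (at_right (0::real))"
        by (rule filterlim_compose[OF poly_times_exp_minus_tendsto_0 filterlim_inverse_at_top_right])
      then show "((\<lambda>h. flat_exp P h / h) \<longlongrightarrow> 0) (at_right 0)"
        by (rule Lim_transform_eventually)
          (auto simp: eventually_at_filter flat_exp_def field_simps)
    qed
    then show ?thesis using 3 by (simp add: has_field_derivative_iff flat_exp_def)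
  qed
qed

lemma n_times_differentiable_flat_exp: "n_times_differentiable n (\<lambda>x. of_real (flat_exp P x))"
proof (induction n arbitrary: P)
  case (Suc n)
  have "((\<lambda>x. of_real (flat_exp P x) :: complex) has_vector_derivative
      of_real (flat_exp ([:0, 0, 1:] * (P - pderiv P)) x)) (at x)" for x
    by (rule has_vector_derivative_of_real[OF has_real_derivative_flat_exp])
  then show ?case using Suc.IH[of "[:0, 0, 1:] * (P - pderiv P)"]
    unfolding n_times_differentiable.simps
    by (intro exI[of _ "\<lambda>x. of_real (flat_exp ([:0, 0, 1:] * (P - pderiv P)) x)"]) auto
qed simp

text \<open>Dilating both factors by \<open>Suc n\<close> divides the exponent by
  \<open>Suc n\<close>, so the bumps tend pointwise to the indicator of the open interval while
  staying below 1. The arguments are written as \<open>c * x + d\<close> to match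
  \<open>n_times_differentiable_affine\<close>.\<close>

definition bump :: "nat \<Rightarrow> real \<Rightarrow> real \<Rightarrow> real \<Rightarrow> real" where
  "bump n c d x = flat_exp 1 (real (Suc n) * x + - real (Suc n) * c) * flat_exp 1 (- real (Suc n) * x + real (Suc n) * d)"

lemma bump_eq: "bump n c d x = (if x \<in> {c<..<d} then
    exp (- (1 / (x - c) + 1 / (d - x)) / real (Suc n)) else 0)"
proof -
  define N where "N = real (Suc n)"
  have N: "N > 0" by (simp add: N_def)
  have arg: "N * x + - N * c = N * (x - c)" "- N * x + N * d = N * (d - x)" by (simp_all add: algebra_simps)
  show ?thesis
  proof (cases "x \<in> {c<..<d}")
    case True
    have "- (1 / (N * (x - c))) + - (1 / (N * (d - x))) = - (1 / (x - c) + 1 / (d - x)) / N"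
      using N True by (simp add: add_divide_distrib diff_divide_distrib mult.commute)
    then show ?thesis
      using True N unfolding bump_def N_def[symmetric] arg
      by (simp add: flat_exp_def exp_add[symmetric])
  next
    case False
    then show ?thesis
      using N unfolding bump_def N_def[symmetric] arg
      by (auto simp: flat_exp_def zero_less_mult_iff)
  qed
qed

lemma bump_le_1: "\<bar>bump n c d x\<bar> \<le> 1"
proof (cases "x \<in> {c<..<d}")
  case True
  then have "1 / (x - c) + 1 / (d - x) \<ge> 0" by simp
  then have "- (1 / (x - c) + 1 / (d - x)) / real (Suc n) \<le> 0"
    by (intro divide_nonpos_nonneg) auto
  then show ?thesis unfolding bump_eq using True by simp
qed (auto simp: bump_eq simp del: greaterThanLessThan_iff)

lemma bump_nonneg: "bump n c d x \<ge> 0"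
  unfolding bump_eq by auto

lemma bump_tendsto: "(\<lambda>n. bump n c d x) \<longlonglongrightarrow> (if x \<in> {c<..<d} then 1 else 0)"
proof -
  have "(\<lambda>n. exp (- (1 / (x - c) + 1 / (d - x)) * inverse (real (Suc n)))) \<longlonglongrightarrow> exp (- (1 / (x - c) + 1 / (d - x)) * 0)"
    by (intro tendsto_intros LIMSEQ_inverse_real_of_nat)
  then show ?thesis unfolding bump_eq by (auto simp: divide_inverse)
qed

lemma n_times_differentiable_bump: "n_times_differentiable m (\<lambda>x. of_real (bump n c d x))"
  unfolding bump_def of_real_mult
  by (intro n_times_differentiable_mult n_times_differentiable_affine[OF n_times_differentiable_flat_exp])

section \<open>Test functions with prescribed derivative\<close>

lemma continuous_on_n_times_differentiable:
  "n_times_differentiable (Suc 0) f \<Longrightarrow> continuous_on S f"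
  by (auto intro!: continuous_at_imp_continuous_on dest: has_vector_derivative_continuous)

text \<open>The zero mean is what makes the antiderivative based at \<open>a\<close> vanish to the
  right of the support as well.\<close>

lemma antiderivative_test_function:
  assumes \<psi>: "\<And>n. n_times_differentiable n \<psi>" and supp: "\<And>x. x \<notin> {c..d} \<Longrightarrow> \<psi> x = 0"
    and cd: "a < c" "c \<le> d" "d < b" and int: "integral {a..b} \<psi> = 0"
  obtains \<phi> where "\<phi> \<in> test_functions a b" "\<And>x. vector_derivative \<phi> (at x) = \<psi> x"
proof -
  define \<phi> where "\<phi> = (\<lambda>x. integral {a..x} \<psi>)"
  have cont: "continuous_on S \<psi>" for S
    using continuous_on_n_times_differentiable[OF \<psi>] .
  have left: "\<phi> x = 0" if "x < c" for x
  proof -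
    have "integral {a..x} \<psi> = integral {a..x} (\<lambda>x. 0)" using that by (intro integral_cong supp) auto
    then show ?thesis by (simp add: \<phi>_def)
  qed
  have right: "\<phi> x = 0" if "x > d" for x
  proof -
    have "integral {a..x} \<psi> = integral {a..d} \<psi> + integral {d..x} \<psi>" if "x > d" for x
      using that cd by (intro Henstock_Kurzweil_Integration.integral_combine[symmetric] integrable_continuous_real cont) auto
    moreover have "integral {d..x} \<psi> = 0" if "x > d" for x
    proof -
      have "integral {d..x} \<psi> = integral {d<..<x} \<psi>" by (simp add: integral_open_interval_real)
      also have "\<dots> = integral {d<..<x} (\<lambda>x. 0)" by (intro integral_cong supp) auto
      finally show ?thesis by simp
    qed
    ultimately have "integral {a..x} \<psi> = integral {a..d} \<psi>" if "x > d" for x using that by simp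
    from this[OF that] this[OF cd(3)] int show ?thesis by (simp add: \<phi>_def)
  qed
  have deriv: "(\<phi> has_vector_derivative \<psi> x) (at x)" for x
  \<comment> \<open>The fundamental theorem reaches only points right of \<open>a\<close>; to the
    left of \<open>c\<close>, and so in particular up to \<open>a\<close>, the antiderivative is
    locally the constant 0.\<close>
  proof (cases "x < c")
    case True
    have "((\<lambda>x. 0) has_vector_derivative 0) (at x)" by simp
    then have "(\<phi> has_vector_derivative 0) (at x)"
      by (rule has_vector_derivative_transform_within_open[of _ _ _ "{..<c}"])
        (use True left in auto)
    then show ?thesis using True supp[of x] by simp
  next
    case False
    then have x: "x \<in> {a<..<x + 1}" using cd by auto
    have "(\<phi> has_vector_derivative \<psi> x) (at x within {a..x + 1})"
      unfolding \<phi>_def using x by (intro integral_has_vector_derivative cont) auto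
    then have "(\<phi> has_vector_derivative \<psi> x) (at x within {a<..<x + 1})"
      by (rule has_vector_derivative_within_subset) auto
    then show ?thesis using at_within_open[OF x open_greaterThanLessThan] by simp
  qed
  show ?thesis
  proof (rule that)
    show D: "vector_derivative \<phi> (at x) = \<psi> x" for x using deriv vector_derivative_at by blast
    have "n_times_differentiable (Suc n) \<phi>" for n
      using deriv \<psi>[of n] by auto
    then have "((\<lambda>g x. vector_derivative g (at x)) ^^ n) \<phi> differentiable_on UNIV" for n
      by (rule n_times_differentiable_iterated_derivative)
    moreover have "closure {x. \<phi> x \<noteq> 0} \<subseteq> {c..d}"
      using left right by (intro closure_minimal) (auto simp: not_less[symmetric])
    ultimately show "\<phi> \<in> test_functions a b"
      using cd by (auto simp: test_functions_def)
  qed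
qed

text \<open>Subtracting from a bump the right multiple of one fixed bump gives mean zero, hence the
  derivative of a test function. So \<open>w - K\<close>, where \<open>K\<close> is the mean of
  \<open>w\<close> weighted by the fixed bump, is orthogonal to every bump, and in the limit to
  every indicator of an inner interval.\<close>

lemma du_bois_reymond:
  fixes w :: "real \<Rightarrow> complex"
  assumes ab: "a < b" and w: "w absolutely_integrable_on {a..b}"
    and 0: "\<And>\<phi>. \<phi> \<in> test_functions a b \<Longrightarrow> integral {a..b} (\<lambda>x. w x * vector_derivative \<phi> (at x)) = 0"
  obtains K where "negligible {x \<in> {a..b}. w x \<noteq> K}"
proof -
  define c0 d0 where "c0 = (2 * a + b) / 3" and "d0 = (a + 2 * b) / 3"
  have cd0: "a < c0" "c0 < d0" "d0 < b" using ab by (auto simp: c0_def d0_def field_simps)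
  define B where "B = (\<lambda>n c d x. of_real (bump n c d x) :: complex)"
  have Bc: "continuous_on S (B n c d)" for S n c d
    unfolding B_def by (rule continuous_on_n_times_differentiable[OF n_times_differentiable_bump])
  have Bi: "B n c d integrable_on {a..b}" for n c d
    by (intro integrable_continuous_real Bc)
  have wB: "(\<lambda>x. w x * B n c d x) integrable_on {a..b}" for n c d
    by (rule integrable_norm_Icc(2)[OF absolutely_integrable_mult_continuous[OF Bc w]]) auto
  define I0 where "I0 = integral {a..b} (B 0 c0 d0)"
  \<comment> \<open>A continuous nonnegative function with zero integral vanishes identically, but
    this one is positive at the midpoint of its support.\<close>
  have "I0 \<noteq> 0"
  proof
    assume "I0 = 0"
    have bc: "continuous_on {a..b} (bump 0 c0 d0)"
      using continuous_on_Re[OF Bc[of "{a..b}" 0 c0 d0]] by (simp add: B_def)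
    have "integral {a..b} (bump 0 c0 d0) = 0"
      using integral_linear[OF Bi[of 0 c0 d0] bounded_linear_Re] \<open>I0 = 0\<close>
      by (simp add: o_def B_def I0_def)
    then have "\<forall>x\<in>{a..b}. bump 0 c0 d0 x = 0"
      using integral_eq_0_iff[OF bc ab] bump_nonneg by blast
    moreover have "(c0 + d0) / 2 \<in> {a..b}" using cd0 by auto
    ultimately have "bump 0 c0 d0 ((c0 + d0) / 2) = 0" by blast
    moreover have "(c0 + d0) / 2 \<in> {c0<..<d0}" using cd0 by auto
    ultimately show False by (simp add: bump_eq del: greaterThanLessThan_iff)
  qed
  define K where "K = integral {a..b} (\<lambda>x. w x * B 0 c0 d0 x) / I0"
  have wK: "(\<lambda>x. w x - K) absolutely_integrable_on {a..b}"
    by (intro set_integral_diff(1) w) auto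
  have key: "integral {a..b} (\<lambda>x. (w x - K) * B n c d x) = 0" if cd: "a < c" "c < d" "d < b" for n c d
  proof -
    define \<beta> where "\<beta> = integral {a..b} (B n c d) / I0"
    define \<psi> where "\<psi> = (\<lambda>x. B n c d x + - \<beta> * B 0 c0 d0 x)"
    have "integral {a..b} \<psi> = integral {a..b} (B n c d) + - \<beta> * I0"
      unfolding \<psi>_def I0_def by (subst integral_add[OF Bi integrable_on_mult_right[OF Bi]]) simp
    then have int: "integral {a..b} \<psi> = 0" using \<open>I0 \<noteq> 0\<close> by (simp add: \<beta>_def)
    obtain \<phi> where \<phi>: "\<phi> \<in> test_functions a b" "\<And>x. vector_derivative \<phi> (at x) = \<psi> x"
    proof (rule antiderivative_test_function[of \<psi> "min c c0" "max d d0" a b])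
      show "n_times_differentiable m \<psi>" for m
        unfolding \<psi>_def B_def
        by (intro n_times_differentiable_add n_times_differentiable_mult n_times_differentiable_bump n_times_differentiable_const)
      show "\<psi> x = 0" if "x \<notin> {min c c0..max d d0}" for x
        using that by (auto simp: \<psi>_def B_def bump_eq)
    qed (use cd cd0 int in auto)
    have "0 = integral {a..b} (\<lambda>x. w x * \<psi> x)" using 0[OF \<phi>(1)] by (simp add: \<phi>(2))
    also have "(\<lambda>x. w x * \<psi> x) = (\<lambda>x. w x * B n c d x + - \<beta> * (w x * B 0 c0 d0 x))"
      by (intro ext) (simp add: \<psi>_def algebra_simps)
    also have "integral {a..b} \<dots> = integral {a..b} (\<lambda>x. w x * B n c d x) + - \<beta> * (K * I0)"
      using \<open>I0 \<noteq> 0\<close> by (subst integral_add[OF wB integrable_on_mult_right[OF wB]]) (simp add: K_def)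
    also have "\<dots> = integral {a..b} (\<lambda>x. w x * B n c d x) - K * integral {a..b} (B n c d)"
      using \<open>I0 \<noteq> 0\<close> by (simp add: \<beta>_def)
    also have "\<dots> = integral {a..b} (\<lambda>x. w x * B n c d x - K * B n c d x)"
      by (subst integral_diff[OF wB integrable_on_mult_right[OF Bi]]) simp
    finally show ?thesis by (simp add: left_diff_distrib)
  qed
  have "negligible {x \<in> {a..b}. w x - K \<noteq> 0}"
  proof (rule AE_eq_0_if_integral_Ioo_subintervals[OF wK])
    fix c d assume cd: "a < c" "c < d" "d < b"
    let ?g = "\<lambda>x. if x \<in> {c<..<d} then w x - K else 0"
    \<comment> \<open>The bumps are bounded by 1, so \<open>norm (w x - K)\<close> dominates and the
      sequence, constantly 0 by \<open>key\<close>, converges to the integral over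
      \<open>{c<..<d}\<close>.\<close>
    have "(\<lambda>n. integral {a..b} (\<lambda>x. (w x - K) * B n c d x)) \<longlonglongrightarrow> integral {a..b} ?g"
    proof (rule dominated_convergence(2)[where h = "\<lambda>x. norm (w x - K)"])
      show "(\<lambda>x. (w x - K) * B n c d x) integrable_on {a..b}" for n
        by (rule integrable_norm_Icc(2)[OF absolutely_integrable_mult_continuous[OF Bc wK]]) auto
      show "(\<lambda>x. norm (w x - K)) integrable_on {a..b}"
        by (rule integrable_norm_Icc(1)[OF wK]) auto
      show "norm ((w x - K) * B n c d x) \<le> norm (w x - K)" for n x
        using bump_le_1[of n c d x] by (simp add: norm_mult B_def mult_left_le)
      show "(\<lambda>n. (w x - K) * B n c d x) \<longlonglongrightarrow> ?g x" for x
        using tendsto_mult[OF tendsto_const[of "w x - K"] tendsto_of_real[OF bump_tendsto[of c d x]]]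
        by (auto simp: B_def split: if_splits)
    qed
    then have "0 = integral {a..b} ?g" by (simp only: key[OF cd] LIMSEQ_const_iff)
    also have "\<dots> = integral ({a..b} \<inter> {c<..<d}) (\<lambda>x. w x - K)" by (simp only: integral_restrict_Int Int_commute)
    also have "{a..b} \<inter> {c<..<d} = {c<..<d}" using cd by auto
    finally have "integral {c<..<d} (\<lambda>x. w x - K) = 0" by (rule sym)
    then show "integral {c..d} (\<lambda>x. w x - K) = 0" by (simp only: integral_open_interval_real)
  qed
  then show ?thesis by (intro that[of K]) simp
qed

section \<open>Products of square integrable functions, powers of the weight, and integrability of
  \<open>\<rho>' h\<close>\<close>

lemma L2_on_mult:
  assumes "L2_on a b f" "L2_on a b g"
  shows "(\<lambda>x. f x * g x) absolutely_integrable_on {a..b}"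
proof (rule measurable_bounded_by_integrable_imp_absolutely_integrable)
  show "(\<lambda>x. f x * g x) \<in> borel_measurable (lebesgue_on {a..b})"
    using assms by (auto simp: L2_on_def)
  show "(\<lambda>x. (cmod (f x))\<^sup>2 + (cmod (g x))\<^sup>2) integrable_on {a..b}"
    using assms by (intro integrable_add integrable_on_lebesgue_on) (auto simp: L2_on_def)
  show "norm (f x * g x) \<le> (cmod (f x))\<^sup>2 + (cmod (g x))\<^sup>2" for x
    using sum_squares_bound[of "cmod (f x)" "cmod (g x)"]
      mult_nonneg_nonneg[OF norm_ge_zero norm_ge_zero, of "f x" "g x"] unfolding norm_mult by linarith
qed auto

lemma L2_on_absolutely_integrable:
  assumes "L2_on a b f"
  shows "f absolutely_integrable_on {a..b}"
proof -
  have "L2_on a b (\<lambda>x. 1)"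
    using continuous_imp_integrable_real[of a b "\<lambda>x. 1::real"] by (auto simp: L2_on_def)
  from L2_on_mult[OF assms this] show ?thesis by simp
qed

text \<open>\<open>ln \<rho>\<close> and the powers of \<open>\<rho>\<close> are handled through \<open>\<rho> = \<rho> a * exp (\<integral> \<rho>' / \<rho>)\<close>, so that only
  the product and exponential rules are needed.\<close>

lemma has_AC_derivative_ln:
  assumes \<rho>: "has_AC_derivative \<rho> \<rho>' a b" and pos: "\<And>x. x \<in> {a..b} \<Longrightarrow> \<rho> x > (0::real)"
  shows "has_AC_derivative (\<lambda>x. ln (\<rho> x)) (\<lambda>x. \<rho>' x / \<rho> x) a b"
proof -
  have c: "continuous_on {a..b} (\<lambda>x. 1 / \<rho> x)"
    using pos by (intro continuous_intros has_AC_derivative_continuous[OF \<rho>]) force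
  have q: "(\<lambda>x. \<rho>' x / \<rho> x) absolutely_integrable_on {a..b}"
    using absolutely_integrable_mult_continuous[OF c has_AC_derivative_integrable[OF \<rho>]] by simp
  define L where "L = (\<lambda>x. 0 + integral {a..x} (\<lambda>x. \<rho>' x / \<rho> x))"
  have L: "has_AC_derivative L (\<lambda>x. \<rho>' x / \<rho> x) a b"
    unfolding L_def by (rule has_AC_derivative_integral[OF q])
  note D = has_AC_derivative_mult[OF \<rho> has_AC_derivative_exp[OF has_AC_derivative_minus[OF L]]]
  have eq: "ln (\<rho> x) = ln (\<rho> a) + L x" if x: "x \<in> {a..b}" for x
  proof -
    have "\<rho> x * exp (- L x) = \<rho> a * exp (- L a) + integral {a..x} (\<lambda>x. \<rho> x * (exp (- L x) * - (\<rho>' x / \<rho> x)) + exp (- L x) * \<rho>' x)"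
      by (rule has_AC_derivative_eq[OF D x])
    also have "integral {a..x} (\<lambda>x. \<rho> x * (exp (- L x) * - (\<rho>' x / \<rho> x)) + exp (- L x) * \<rho>' x) = integral {a..x} (\<lambda>x. 0)"
    proof (rule integral_cong)
      fix t assume "t \<in> {a..x}"
      then have "\<rho> t \<noteq> 0" using pos[of t] x by auto
      then show "\<rho> t * (exp (- L t) * - (\<rho>' t / \<rho> t)) + exp (- L t) * \<rho>' t = 0" by simp
    qed
    finally have "\<rho> x * exp (- L x) = \<rho> a" by (simp add: L_def)
    then have "\<rho> x = \<rho> a * exp (L x)" by (simp add: exp_minus field_simps)
    moreover have "\<rho> a > 0" using pos[of a] x by auto
    ultimately show ?thesis by (simp add: ln_mult)
  qed
  show ?thesis
    by (rule has_AC_derivative_cong[OF has_AC_derivative_add[OF has_AC_derivative_const[of "ln (\<rho> a)"] L]])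
      (rule eq[symmetric], assumption, simp)
qed

lemma has_AC_derivative_powr:
  assumes \<rho>: "has_AC_derivative \<rho> \<rho>' a b" and pos: "\<And>x. x \<in> {a..b} \<Longrightarrow> \<rho> x > (0::real)"
  shows "has_AC_derivative (\<lambda>x. \<rho> x powr c) (\<lambda>x. \<rho> x powr c * (c * (\<rho>' x / \<rho> x))) a b"
  by (rule has_AC_derivative_cong[OF has_AC_derivative_exp[OF has_AC_derivative_cmult[OF has_AC_derivative_ln[OF \<rho> pos], of c]]])
    (use pos in \<open>force simp: powr_def\<close>)+

lemma test_functions_D:
  assumes "\<phi> \<in> test_functions a b"
  shows "has_AC_derivative \<phi> (\<lambda>x. vector_derivative \<phi> (at x)) a b" "\<phi> b = 0" "\<phi> a = 0"
    "continuous_on S (\<lambda>x. vector_derivative \<phi> (at x))"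
proof -
  have d: "\<And>n. ((\<lambda>g x. vector_derivative g (at x)) ^^ n) \<phi> differentiable_on UNIV"
    and supp: "closure {x. \<phi> x \<noteq> 0} \<subseteq> {a<..<b}"
    using assms by (auto simp: test_functions_def)
  show c: "continuous_on S (\<lambda>x. vector_derivative \<phi> (at x))" for S
    using differentiable_imp_continuous_on[OF d[of 1]] continuous_on_subset by auto
  have "(\<phi> has_vector_derivative vector_derivative \<phi> (at x)) (at x within {a..b})" for x
  proof -
    have "\<phi> differentiable (at x)" using d[of 0] by (simp add: differentiable_on_def)
    then show ?thesis
      by (rule has_vector_derivative_at_within[OF vector_derivative_works[THEN iffD1]])
  qed
  then show "has_AC_derivative \<phi> (\<lambda>x. vector_derivative \<phi> (at x)) a b"
    by (intro has_AC_derivative_C1 c)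
  have "\<phi> x = 0" if "x \<notin> {a<..<b}" for x using supp closure_subset[of "{x. \<phi> x \<noteq> 0}"] that by auto
  then show "\<phi> b = 0" "\<phi> a = 0" by auto
qed

text \<open>The definition of \<open>h\<close> hides an antiderivative \<open>v\<close> of
  \<open>q\<close> with \<open>v d\<close> integrable, where \<open>d\<close> represents the
  derivative of \<open>1 / sqrt \<rho>\<close>. Solving
  \<open>d = - \<rho>' / (2 \<rho> sqrt \<rho>)\<close> for \<open>\<rho>'\<close> makes
  \<open>\<rho>' v\<close> integrable. Du Bois-Reymond recovers \<open>h\<close>, up to a constant,
  as \<open>v / sqrt \<rho>\<close> minus a continuous function, so the property passes to
  \<open>\<rho>' h\<close>.\<close>

lemma derivative_times_antiderivative_integrable:
  assumes ab: "a < b" and \<rho>: "has_AC_derivative \<rho> \<rho>' a b" and pos: "\<And>x. x \<in> {a..b} \<Longrightarrow> \<rho> x > 0"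
    and h: "is_antiderivative_q_sqrt h q \<rho> a b"
  shows "(\<lambda>x. of_real (\<rho>' x) * h x) absolutely_integrable_on {a..b}"
proof -
  obtain Q v d where hL2: "L2_on a b h" and Qh: "has_distr_antiderivative Q h a b" and vL2: "L2_on a b v"
    and d: "has_AC_derivative (\<lambda>x. 1 / of_real (sqrt (\<rho> x))) d a b"
    and vd: "(\<lambda>x. v x * d x) absolutely_integrable_on {a..b}"
    and Q: "\<And>\<phi>. \<phi> \<in> test_functions a b \<Longrightarrow>
        Q \<phi> = - integral {a..b} (\<lambda>x. v x * (1 / of_real (sqrt (\<rho> x))) * vector_derivative \<phi> (at x))
                 - integral {a..b} (\<lambda>x. v x * d x * \<phi> x)"
    using h unfolding is_antiderivative_q_sqrt_def is_distr_product_def by blast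
  let ?i = "\<lambda>x. 1 / complex_of_real (sqrt (\<rho> x))"
  note ai_h = L2_on_absolutely_integrable[OF hL2] and ai_v = L2_on_absolutely_integrable[OF vL2]
  have \<rho>c: "continuous_on {a..b} \<rho>" by (rule has_AC_derivative_continuous[OF \<rho>])
  have ic: "continuous_on {a..b} ?i" by (rule has_AC_derivative_continuous[OF d])
  have "has_AC_derivative (\<lambda>x. complex_of_real (\<rho> x powr (-1/2)))
      (\<lambda>x. of_real (\<rho> x powr (-1/2) * ((-1/2) * (\<rho>' x / \<rho> x)))) a b"
    by (rule has_AC_derivative_linear[OF bounded_linear_of_real has_AC_derivative_powr[OF \<rho> pos]])
  then have "has_AC_derivative ?i (\<lambda>x. of_real (\<rho> x powr (-1/2) * ((-1/2) * (\<rho>' x / \<rho> x)))) a b"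
    by (rule has_AC_derivative_cong)
      (use pos in \<open>force simp: powr_minus powr_half_sqrt inverse_eq_divide less_imp_le\<close>)+
  from has_AC_derivative_unique[OF d this]
  have neg1: "negligible {x \<in> {a..b}. d x \<noteq> of_real (\<rho> x powr (-1/2) * ((-1/2) * (\<rho>' x / \<rho> x)))}" .
  have "(\<lambda>x. v x * d x * of_real (-2 * \<rho> x * sqrt (\<rho> x))) absolutely_integrable_on {a..b}"
    by (intro absolutely_integrable_mult_continuous vd continuous_intros \<rho>c)
  then have \<rho>v: "(\<lambda>x. of_real (\<rho>' x) * v x) absolutely_integrable_on {a..b}"
  proof (rule absolutely_integrable_spike[OF _ neg1])
    fix x assume x: "x \<in> {a..b} - {x \<in> {a..b}. d x \<noteq> of_real (\<rho> x powr (-1/2) * ((-1/2) * (\<rho>' x / \<rho> x)))}"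
    then have dx: "d x = of_real (\<rho> x powr (-1/2) * ((-1/2) * (\<rho>' x / \<rho> x)))" and "\<rho> x > 0"
      using pos[of x] by auto
    then have "\<rho> x powr (-1/2) * sqrt (\<rho> x) = 1"
      by (simp add: powr_minus powr_half_sqrt)
    then have "\<rho> x powr (-1/2) * ((-1/2) * (\<rho>' x / \<rho> x)) * (-2 * \<rho> x * sqrt (\<rho> x)) = \<rho>' x"
      using \<open>\<rho> x > 0\<close> by (simp add: field_simps)
    then show "of_real (\<rho>' x) * v x = v x * d x * of_real (-2 * \<rho> x * sqrt (\<rho> x))"
      unfolding dx mult.assoc of_real_mult[symmetric] by (simp add: mult_ac)
  qed
  define K where "K = (\<lambda>x. 0 + integral {a..x} (\<lambda>x. v x * d x))"
  have K: "has_AC_derivative K (\<lambda>x. v x * d x) a b"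
    unfolding K_def by (rule has_AC_derivative_integral[OF vd])
  have Kc: "continuous_on {a..b} K" by (rule has_AC_derivative_continuous[OF K])
  have vi: "(\<lambda>x. v x * ?i x) absolutely_integrable_on {a..b}"
    by (rule absolutely_integrable_mult_continuous[OF ic ai_v])
  \<comment> \<open>By the Leibniz rule in \<open>Q\<close> the distributional derivative of
    \<open>h\<close> is that of \<open>v / sqrt \<rho>\<close> minus \<open>v d\<close>. Adding the
    antiderivative \<open>K\<close> of \<open>v d\<close> makes the derivative of \<open>w\<close>
    vanish.\<close>
  define w where "w = (\<lambda>x. h x - v x * ?i x + K x)"
  have w: "w absolutely_integrable_on {a..b}"
    unfolding w_def by (intro set_integral_add(1) set_integral_diff(1) ai_h vi absolutely_integrable_continuous_real Kc)
  have "integral {a..b} (\<lambda>x. w x * vector_derivative \<phi> (at x)) = 0" if \<phi>: "\<phi> \<in> test_functions a b" for \<phi>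
  proof -
    note t = test_functions_D[OF \<phi>]
    let ?D = "\<lambda>x. vector_derivative \<phi> (at x)"
    have i: "(\<lambda>x. h x * ?D x) integrable_on {a..b}" "(\<lambda>x. v x * ?i x * ?D x) integrable_on {a..b}"
      "(\<lambda>x. K x * ?D x) integrable_on {a..b}" "(\<lambda>x. v x * d x * \<phi> x) integrable_on {a..b}"
      by (intro integrable_norm_Icc(2)[OF absolutely_integrable_mult_continuous[OF t(4) ai_h]]
           integrable_norm_Icc(2)[OF absolutely_integrable_mult_continuous[OF t(4) vi]]
           integrable_norm_Icc(2)[OF absolutely_integrable_mult_continuous[OF t(4) absolutely_integrable_continuous_real[OF Kc]]]
           integrable_norm_Icc(2)[OF absolutely_integrable_mult_continuous[OF has_AC_derivative_continuous[OF t(1)] vd]] order_refl)+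
    have "integral {a..b} (\<lambda>x. K x * ?D x + \<phi> x * (v x * d x)) = K b * \<phi> b - K a * \<phi> a"
      using ab by (intro has_AC_derivative_diff_integral[OF has_AC_derivative_mult[OF K t(1)]]) auto
    then have by_parts: "integral {a..b} (\<lambda>x. K x * ?D x) + integral {a..b} (\<lambda>x. v x * d x * \<phi> x) = 0"
      using t(2,3) integral_add[OF i(3,4)] by (simp add: mult.commute)
    have "- integral {a..b} (\<lambda>x. h x * ?D x) = - integral {a..b} (\<lambda>x. v x * ?i x * ?D x) - integral {a..b} (\<lambda>x. v x * d x * \<phi> x)"
      using Q[OF \<phi>] Qh \<phi> by (simp add: has_distr_antiderivative_def)
    moreover have "integral {a..b} (\<lambda>x. w x * ?D x)
       = integral {a..b} (\<lambda>x. h x * ?D x) - integral {a..b} (\<lambda>x. v x * ?i x * ?D x) + integral {a..b} (\<lambda>x. K x * ?D x)"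
      unfolding w_def ring_distribs
      by (subst integral_add[OF integrable_diff[OF i(1,2)] i(3)]) (subst integral_diff[OF i(1,2)], rule refl)
    ultimately show ?thesis using by_parts by algebra
  qed
  then obtain C where neg2: "negligible {x \<in> {a..b}. w x \<noteq> C}"
    by (rule du_bois_reymond[OF ab w])
  have c\<rho>': "(\<lambda>x. complex_of_real (\<rho>' x)) absolutely_integrable_on {a..b}"
    using absolutely_integrable_linear[OF has_AC_derivative_integrable[OF \<rho>] bounded_linear_of_real] by (simp add: o_def)
  have "(\<lambda>x. of_real (\<rho>' x) * v x * ?i x + of_real (\<rho>' x) * (C - K x)) absolutely_integrable_on {a..b}"
    by (intro set_integral_add(1) absolutely_integrable_mult_continuous[OF ic \<rho>v]
        absolutely_integrable_mult_continuous[OF _ c\<rho>'] continuous_intros Kc)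
  then show ?thesis
  proof (rule absolutely_integrable_spike[OF _ neg2])
    fix x assume "x \<in> {a..b} - {x \<in> {a..b}. w x \<noteq> C}"
    then have "w x = C" by auto
    then have h: "h x = v x * ?i x + (C - K x)" by (simp add: w_def algebra_simps)
    show "of_real (\<rho>' x) * h x = of_real (\<rho>' x) * v x * ?i x + of_real (\<rho>' x) * (C - K x)"
      unfolding h by (simp only: distrib_left mult.assoc)
  qed
qed

subsection \<open>The variable \<open>t\<close>\<close>

lemma has_AC_derivative_reflect:
  fixes f :: "real \<Rightarrow> 'a::euclidean_space"
  assumes f: "has_AC_derivative f f' 0 l"
  shows "has_AC_derivative (\<lambda>t. f (l - t)) (\<lambda>t. - f' (l - t)) 0 l"
proof -
  have img: "(\<lambda>x. l - x) ` {0..t} = {l - t..l}" for t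
    by (auto intro!: image_eqI[of _ _ "l - _"])
  \<comment> \<open>The change of variables theorem couples integrability and value in one
    equivalence; taking for \<open>c\<close> the actual integral extracts both.\<close>
  have eq: "(\<lambda>x. \<bar>- 1\<bar> *\<^sub>R f' (l - x)) absolutely_integrable_on {0..t} \<and>
      integral {0..t} (\<lambda>x. \<bar>- 1\<bar> *\<^sub>R f' (l - x)) = c \<longleftrightarrow>
      f' absolutely_integrable_on {l - t..l} \<and> integral {l - t..l} f' = c" for t c
    unfolding img[symmetric]
    by (rule has_absolute_integral_change_of_variables_real)
      (auto intro!: derivative_eq_intros simp: inj_on_def)
  have ai: "f' absolutely_integrable_on {l - t..l}" if "t \<in> {0..l}" for t
    using that by (intro absolutely_integrable_on_subinterval_Icc[OF has_AC_derivative_integrable[OF f]]) auto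
  have I: "(\<lambda>x. f' (l - x)) absolutely_integrable_on {0..t}" "integral {0..t} (\<lambda>x. f' (l - x)) = f l - f (l - t)"
    if "t \<in> {0..l}" for t
    using eq[of t "integral {l - t..l} f'"] ai[OF that]
      has_AC_derivative_diff_integral[OF f, of "l - t" l] that by auto
  show ?thesis
    unfolding has_AC_derivative_def
  proof (intro conjI ballI)
    show "(\<lambda>t. - f' (l - t)) absolutely_integrable_on {0..l}"
    proof (cases "0 \<le> l")
      case True
      have "(\<lambda>t. f' (l - t)) absolutely_integrable_on {0..l}" using True by (intro I) auto
      from absolutely_integrable_linear[OF this bounded_linear_minus[OF bounded_linear_ident]]
      show ?thesis by (simp add: o_def)
    qed simp
    show "f (l - t) = f (l - 0) + integral {0..t} (\<lambda>t. - f' (l - t))" if "t \<in> {0..l}" for t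
      using I(2)[OF that] by simp
  qed
qed

locale time_change =
  fixes a b :: real and \<rho> :: "real \<Rightarrow> real"
  assumes ab: "a < b" and \<rho>c: "continuous_on {a..b} \<rho>" and pos: "\<And>x. x \<in> {a..b} \<Longrightarrow> \<rho> x > 0"
begin

abbreviation "T \<equiv> t_of \<rho> a"
abbreviation "X \<equiv> x_of \<rho> a b"
abbreviation "l \<equiv> t_of \<rho> a b"

lemma sqrt_continuous: "continuous_on {a..b} (\<lambda>x. sqrt (\<rho> x))"
  by (intro continuous_intros \<rho>c)

lemma has_derivative_T: "x \<in> {a..b} \<Longrightarrow> (T has_real_derivative sqrt (\<rho> x)) (at x within {a..b})"
  unfolding t_of_def has_real_derivative_iff_has_vector_derivative
  by (rule integral_has_vector_derivative[OF sqrt_continuous])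

lemma T_a: "T a = 0" by (simp add: t_of_def)

lemma T_strict_mono:
  assumes "a \<le> x" "x < y" "y \<le> b"
  shows "T x < T y"
proof -
  have int: "(\<lambda>x. sqrt (\<rho> x)) integrable_on {a..y}"
    using assms by (intro integrable_continuous_real continuous_on_subset[OF sqrt_continuous]) auto
  have c: "continuous_on {x..y} (\<lambda>x. sqrt (\<rho> x))"
    using assms by (intro continuous_on_subset[OF sqrt_continuous]) auto
  have "integral {x..y} (\<lambda>x. sqrt (\<rho> x)) \<noteq> 0"
  proof
    assume "integral {x..y} (\<lambda>x. sqrt (\<rho> x)) = 0"
    moreover have "sqrt (\<rho> t) \<ge> 0" if "t \<in> {x..y}" for t
      using that assms pos[of t] by auto
    ultimately have "sqrt (\<rho> x) = 0"
      using integral_eq_0_iff[OF c assms(2)] assms(2) by auto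
    then show False using pos[of x] assms by auto
  qed
  moreover have "integral {x..y} (\<lambda>x. sqrt (\<rho> x)) \<ge> 0"
    using pos assms by (intro integral_nonneg integrable_continuous_real c) (auto intro: less_imp_le)
  ultimately show ?thesis
    using Henstock_Kurzweil_Integration.integral_combine[OF _ _ int, of x] assms by (simp add: t_of_def)
qed

lemma T_mono: "a \<le> x \<Longrightarrow> x \<le> y \<Longrightarrow> y \<le> b \<Longrightarrow> T x \<le> T y"
  using T_strict_mono[of x y] by (cases "x = y") auto

lemma T_inj: "inj_on T {a..b}"
  by (rule linorder_inj_onI') (use T_strict_mono in force)

lemma T_in: "x \<in> {a..b} \<Longrightarrow> T x \<in> {0..l}"
  using T_mono[of a x] T_mono[of x b] by (auto simp: T_a)

lemma l_pos: "l > 0" using T_strict_mono[of a b] ab by (simp add: T_a)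

lemma T_image: "x \<in> {a..b} \<Longrightarrow> T ` {a..x} = {0..T x}"
proof (rule subset_antisym)
  assume x: "x \<in> {a..b}"
  show "T ` {a..x} \<subseteq> {0..T x}" using x T_mono[of a] T_mono[of _ x] by (auto simp: T_a)
  have *: "continuous_on {a..x} T"
    by (rule continuous_on_subset[OF DERIV_continuous_on[OF has_derivative_T]]) (use x in auto)
  then have "t \<in> T ` {a..x}" if t: "0 \<le> t" "t \<le> T x" for t
  proof -
    have "T a \<le> t" "a \<le> x" using x t by (auto simp: T_a)
    from IVT'[OF this(1) t(2) this(2)] *
    obtain y where y: "a \<le> y" "y \<le> x" "T y = t" by blast
    then show ?thesis using imageI[of y "{a..x}" T] by (simp only: atLeastAtMost_iff)
  qed
  then show "{0..T x} \<subseteq> T ` {a..x}" by (simp add: subset_eq)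
qed

lemma X_T: "x \<in> {a..b} \<Longrightarrow> X (T x) = x"
  unfolding x_of_def by (rule the_inv_into_f_f[OF T_inj])

lemma X_in: assumes "t \<in> {0..l}" shows "X t \<in> {a..b}" "T (X t) = t"
proof -
  have "t \<in> T ` {a..b}" using assms T_image[of b] ab by simp
  then obtain x where "x \<in> {a..b}" "t = T x" by (rule imageE)
  then show "X t \<in> {a..b}" "T (X t) = t" using X_T by auto
qed

text \<open>On \<open>{a..x}\<close> the map \<open>T\<close> is injective with derivative
  \<open>sqrt \<rho>\<close>, so the substitution rule holds for every integrable
  \<open>\<Phi>\<close>, continuous or not. The equivalence moves integrability in both directions
  between the variables.\<close>

lemma change_of_variable:
  fixes \<Phi> :: "real \<Rightarrow> 'a::euclidean_space"
  assumes x: "x \<in> {a..b}"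
  shows "\<Phi> absolutely_integrable_on {0..T x} \<longleftrightarrow> (\<lambda>\<xi>. sqrt (\<rho> \<xi>) *\<^sub>R \<Phi> (T \<xi>)) absolutely_integrable_on {a..x}"
    and "\<Phi> absolutely_integrable_on {0..T x} \<Longrightarrow>
      integral {0..T x} \<Phi> = integral {a..x} (\<lambda>\<xi>. sqrt (\<rho> \<xi>) *\<^sub>R \<Phi> (T \<xi>))"
proof -
  have eq: "(\<lambda>\<xi>. \<bar>sqrt (\<rho> \<xi>)\<bar> *\<^sub>R \<Phi> (T \<xi>)) absolutely_integrable_on {a..x} \<and>
      integral {a..x} (\<lambda>\<xi>. \<bar>sqrt (\<rho> \<xi>)\<bar> *\<^sub>R \<Phi> (T \<xi>)) = c \<longleftrightarrow>
      \<Phi> absolutely_integrable_on {0..T x} \<and> integral {0..T x} \<Phi> = c" for c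
    unfolding T_image[OF x, symmetric]
  proof (rule has_absolute_integral_change_of_variables_real)
    show "(T has_real_derivative sqrt (\<rho> y)) (at y within {a..x})" if "y \<in> {a..x}" for y
      using that x by (intro DERIV_subset[OF has_derivative_T]) auto
    show "inj_on T {a..x}" using x by (intro inj_on_subset[OF T_inj]) auto
  qed auto
  have nn: "\<bar>sqrt (\<rho> \<xi>)\<bar> = sqrt (\<rho> \<xi>)" if "\<xi> \<in> {a..x}" for \<xi>
    using pos[of \<xi>] that x by auto
  have cong: "(\<lambda>\<xi>. \<bar>sqrt (\<rho> \<xi>)\<bar> *\<^sub>R \<Phi> (T \<xi>)) absolutely_integrable_on {a..x} \<longleftrightarrow>
      (\<lambda>\<xi>. sqrt (\<rho> \<xi>) *\<^sub>R \<Phi> (T \<xi>)) absolutely_integrable_on {a..x}"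
    by (rule absolutely_integrable_spike_eq[OF negligible_empty]) (simp add: nn)
  have icong: "integral {a..x} (\<lambda>\<xi>. \<bar>sqrt (\<rho> \<xi>)\<bar> *\<^sub>R \<Phi> (T \<xi>)) = integral {a..x} (\<lambda>\<xi>. sqrt (\<rho> \<xi>) *\<^sub>R \<Phi> (T \<xi>))"
    by (rule integral_cong) (simp add: nn)
  show "\<Phi> absolutely_integrable_on {0..T x} \<longleftrightarrow> (\<lambda>\<xi>. sqrt (\<rho> \<xi>) *\<^sub>R \<Phi> (T \<xi>)) absolutely_integrable_on {a..x}"
    using eq cong by blast
  show "integral {0..T x} \<Phi> = integral {a..x} (\<lambda>\<xi>. sqrt (\<rho> \<xi>) *\<^sub>R \<Phi> (T \<xi>))"
    if "\<Phi> absolutely_integrable_on {0..T x}"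
    using eq[of "integral {0..T x} \<Phi>"] icong that by simp
qed

lemma absolutely_integrable_compose_X:
  fixes F :: "real \<Rightarrow> 'a::euclidean_space"
  assumes "(\<lambda>x. sqrt (\<rho> x) *\<^sub>R F x) absolutely_integrable_on {a..b}"
  shows "(\<lambda>t. F (X t)) absolutely_integrable_on {0..l}"
proof -
  have "(\<lambda>\<xi>. sqrt (\<rho> \<xi>) *\<^sub>R F (X (T \<xi>))) absolutely_integrable_on {a..b}"
    by (rule absolutely_integrable_spike[OF assms negligible_empty]) (simp add: X_T)
  then show ?thesis using change_of_variable(1)[of b "\<lambda>t. F (X t)"] ab by simp
qed

text \<open>The derivative is known only up to a null set, so the chain rule is obtained from the
  substitution rule for integrals rather than pointwise.\<close>

lemma has_AC_derivative_compose_T: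
  assumes y: "has_AC_derivative y y' 0 l"
  shows "has_AC_derivative (\<lambda>x. y (T x)) (\<lambda>x. sqrt (\<rho> x) *\<^sub>R y' (T x)) a b"
  unfolding has_AC_derivative_def
proof (intro conjI ballI)
  show "(\<lambda>x. sqrt (\<rho> x) *\<^sub>R y' (T x)) absolutely_integrable_on {a..b}"
    using change_of_variable(1)[of b y'] ab has_AC_derivative_integrable[OF y] by simp
  fix x assume x: "x \<in> {a..b}"
  have "y' absolutely_integrable_on {0..T x}"
    using T_in[OF x] by (intro absolutely_integrable_on_subinterval_Icc[OF has_AC_derivative_integrable[OF y]]) auto
  then show "y (T x) = y (T a) + integral {a..x} (\<lambda>x. sqrt (\<rho> x) *\<^sub>R y' (T x))"
    using change_of_variable(2)[OF x, of y'] has_AC_derivative_eq[OF y T_in[OF x]] by (simp add: T_a)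
qed

lemma has_AC_derivative_compose_X:
  assumes f: "has_AC_derivative f f' a b"
  shows "has_AC_derivative (\<lambda>t. f (X t)) (\<lambda>t. f' (X t) /\<^sub>R sqrt (\<rho> (X t))) 0 l"
  unfolding has_AC_derivative_def
proof (intro conjI ballI)
  have eq: "sqrt (\<rho> x) *\<^sub>R (f' x /\<^sub>R sqrt (\<rho> x)) = f' x" if "x \<in> {a..b}" for x
    using pos[OF that] by simp
  have "(\<lambda>x. sqrt (\<rho> x) *\<^sub>R (f' x /\<^sub>R sqrt (\<rho> x))) absolutely_integrable_on {a..b}"
    by (rule absolutely_integrable_spike[OF has_AC_derivative_integrable[OF f] negligible_empty]) (rule eq, simp)
  then show ai: "(\<lambda>t. f' (X t) /\<^sub>R sqrt (\<rho> (X t))) absolutely_integrable_on {0..l}"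
    by (rule absolutely_integrable_compose_X)
  fix t assume t: "t \<in> {0..l}"
  define x where "x = X t"
  have x: "x \<in> {a..b}" "T x = t" using X_in[OF t] by (auto simp: x_def)
  have "integral {0..T x} (\<lambda>t. f' (X t) /\<^sub>R sqrt (\<rho> (X t))) = integral {a..x} (\<lambda>\<xi>. sqrt (\<rho> \<xi>) *\<^sub>R (f' (X (T \<xi>)) /\<^sub>R sqrt (\<rho> (X (T \<xi>)))))"
    using x t by (intro change_of_variable(2) absolutely_integrable_on_subinterval_Icc[OF ai]) auto
  also have "\<dots> = integral {a..x} f'"
    using x by (intro integral_cong) (simp add: X_T eq del: scaleR_scaleR)
  finally have "integral {0..t} (\<lambda>t. f' (X t) /\<^sub>R sqrt (\<rho> (X t))) = integral {a..x} f'" by (simp add: x)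
  moreover have "X 0 = a" using X_T[of a] ab by (simp add: T_a)
  ultimately show "f (X t) = f (X 0) + integral {0..t} (\<lambda>t. f' (X t) /\<^sub>R sqrt (\<rho> (X t)))"
    using has_AC_derivative_eq[OF f x(1)] by (simp add: x_def)
qed

end

subsection \<open>From the oscillatory system to the equation\<close>

text \<open>With \<open>s = \<sigma> - f / 2\<close>, the substitution \<open>y = B e (m + k)\<close>, \<open>w = - \<i> \<mu> B e (m - k)\<close>, where
  \<open>e = exp (- \<i> \<mu> t)\<close> and \<open>B' = B f / 2\<close>, turns the oscillatory system into the system for \<open>(y, w)\<close>.\<close>

lemma osc_system_to_solution:
  fixes B f \<sigma> g m k :: "real \<Rightarrow> complex"
  assumes B: "has_AC_derivative B (\<lambda>t. B t * (f t / 2)) 0 l"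
    and m: "has_AC_derivative m (\<lambda>t. (\<sigma> t - f t / 2) * k t - g t / (2 * \<i> * \<mu>) * (m t + k t)) 0 l"
    and k: "has_AC_derivative k (\<lambda>t. 2 * \<i> * \<mu> * k t + (\<sigma> t - f t / 2) * m t + g t / (2 * \<i> * \<mu>) * (m t + k t)) 0 l"
    and \<mu>: "\<mu> \<noteq> 0"
  defines "y \<equiv> \<lambda>t. B t * exp (- \<i> * \<mu> * of_real t) * (m t + k t)"
    and "w \<equiv> \<lambda>t. - \<i> * \<mu> * (B t * exp (- \<i> * \<mu> * of_real t) * (m t - k t))"
  shows "has_AC_derivative y (\<lambda>t. \<sigma> t * y t + w t) 0 l"
    and "has_AC_derivative w (\<lambda>t. (- \<mu>\<^sup>2 + g t) * y t + (f t - \<sigma> t) * w t) 0 l"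
proof -
  let ?e = "\<lambda>t. exp (- \<i> * \<mu> * of_real t)"
  have e: "has_AC_derivative ?e (\<lambda>t. ?e t * (- \<i> * \<mu>)) 0 l"
    by (intro has_AC_derivative_exp has_AC_derivative_C1 continuous_intros)
      (auto intro!: derivative_eq_intros)
  note Be = has_AC_derivative_mult[OF B e]
  \<comment> \<open>The algebra is isolated for arbitrary complex numbers, with \<open>G\<close> in
    place of the quotient \<open>g / (2 \<i> \<mu>)\<close>. The second identity recovers
    \<open>g\<close> from \<open>G\<close>, which is where \<open>\<mu> \<noteq> 0\<close>
    enters.\<close>
  have y_identity: "b * E * ((S - F / 2) * K - G * (M + K) + (2 * \<i> * \<mu> * K + (S - F / 2) * M + G * (M + K)))
      + (M + K) * (b * (E * (- \<i> * \<mu>)) + E * (b * (F / 2)))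
     = S * (b * E * (M + K)) + - \<i> * \<mu> * (b * E * (M - K))" for b E M K F S G :: complex
    by (simp add: field_simps)
  have w_identity: "- \<i> * \<mu> * (b * E * ((S - F / 2) * K - G * (M + K) - (2 * \<i> * \<mu> * K + (S - F / 2) * M + G * (M + K)))
      + (M - K) * (b * (E * (- \<i> * \<mu>)) + E * (b * (F / 2))))
     = (- \<mu>\<^sup>2 + g) * (b * E * (M + K)) + (F - S) * (- \<i> * \<mu> * (b * E * (M - K)))"
    if "g = 2 * \<i> * \<mu> * G" for b E M K F S G g :: complex
    unfolding that by (simp add: field_simps power2_eq_square)
  have G: "g t = 2 * \<i> * \<mu> * (g t / (2 * \<i> * \<mu>))" for t using \<mu> by simp
  show "has_AC_derivative y (\<lambda>t. \<sigma> t * y t + w t) 0 l"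
  proof (rule has_AC_derivative_cong[OF has_AC_derivative_mult[OF Be has_AC_derivative_add[OF m k]]])
    show "B t * ?e t * ((\<sigma> t - f t / 2) * k t - g t / (2 * \<i> * \<mu>) * (m t + k t) +
         (2 * \<i> * \<mu> * k t + (\<sigma> t - f t / 2) * m t + g t / (2 * \<i> * \<mu>) * (m t + k t))) +
         (m t + k t) * (B t * (?e t * (- \<i> * \<mu>)) + ?e t * (B t * (f t / 2))) = \<sigma> t * y t + w t" for t
      unfolding y_def w_def by (rule y_identity)
  qed (simp add: y_def)
  show "has_AC_derivative w (\<lambda>t. (- \<mu>\<^sup>2 + g t) * y t + (f t - \<sigma> t) * w t) 0 l"
  proof (rule has_AC_derivative_cong[OF has_AC_derivative_cmult[OF has_AC_derivative_mult[OF Be has_AC_derivative_diff[OF m k]], of "- \<i> * \<mu>"]])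
    show "- \<i> * \<mu> * (B t * ?e t * ((\<sigma> t - f t / 2) * k t - g t / (2 * \<i> * \<mu>) * (m t + k t) -
         (2 * \<i> * \<mu> * k t + (\<sigma> t - f t / 2) * m t + g t / (2 * \<i> * \<mu>) * (m t + k t))) +
         (m t - k t) * (B t * (?e t * (- \<i> * \<mu>)) + ?e t * (B t * (f t / 2)))) = (- \<mu>\<^sup>2 + g t) * y t + (f t - \<sigma> t) * w t" for t
      unfolding y_def w_def by (rule w_identity[OF G])
  qed (simp add: w_def)
qed

section \<open>The equation in the variable \<open>t\<close>\<close>

locale sturm_liouville = time_change a b \<rho> for a b :: real and \<rho> :: "real \<Rightarrow> real" +
  fixes p h :: "real \<Rightarrow> complex" and \<rho>' :: "real \<Rightarrow> real"
  assumes p: "L2_on a b p" and h: "L2_on a b h" and \<rho>: "has_AC_derivative \<rho> \<rho>' a b"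
    and \<rho>'h: "(\<lambda>x. of_real (\<rho>' x) * h x) absolutely_integrable_on {a..b}"
begin

definition "\<sigma> t = h (X t)"
definition "\<rho>t' t = \<rho>' (X t) /\<^sub>R sqrt (\<rho> (X t))"
definition "f t = p (X t) / of_real (sqrt (\<rho> (X t))) - 1/2 * of_real (\<rho>t' t / \<rho> (X t))"
definition "g t = f t * \<sigma> t - (\<sigma> t)\<^sup>2"
definition "s t = \<sigma> t - f t / 2"
definition "A x = of_real (\<rho> x powr (-1/4)) * exp (1/2 * integral {a..x} p)"

lemma p_integrable: "p absolutely_integrable_on {a..b}"
  by (rule L2_on_absolutely_integrable[OF p])

lemma \<rho>'_integrable: "(\<lambda>x. complex_of_real (\<rho>' x)) absolutely_integrable_on {a..b}"
  using absolutely_integrable_linear[OF has_AC_derivative_integrable[OF \<rho>] bounded_linear_of_real] by (simp add: o_def)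

lemma inverse_\<rho>_continuous: "continuous_on {a..b} (\<lambda>x. 1 / complex_of_real (\<rho> x))"
  using pos by (intro continuous_intros \<rho>c) force

lemma \<sigma>_integrable: "\<sigma> absolutely_integrable_on {0..l}"
  unfolding \<sigma>_def
  by (rule absolutely_integrable_compose_X, unfold scaleR_conv_of_real)
    (intro absolutely_integrable_continuous_mult L2_on_absolutely_integrable[OF h] continuous_intros sqrt_continuous)

lemma f_integrable: "f absolutely_integrable_on {0..l}"
  unfolding f_def \<rho>t'_def
proof (rule absolutely_integrable_compose_X)
  have "(\<lambda>x. p x - 1/2 * (of_real (\<rho>' x) * (1 / of_real (\<rho> x)))) absolutely_integrable_on {a..b}"
    by (intro set_integral_diff(1) p_integrable set_integrable_mult_right absolutely_integrable_mult_continuous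
        \<rho>'_integrable inverse_\<rho>_continuous)
  then show "(\<lambda>x. sqrt (\<rho> x) *\<^sub>R (p x / of_real (sqrt (\<rho> x)) - 1/2 * of_real (\<rho>' x /\<^sub>R sqrt (\<rho> x) / \<rho> x))) absolutely_integrable_on {a..b}"
  proof (rule absolutely_integrable_spike[OF _ negligible_empty])
    fix x assume "x \<in> {a..b} - {}"
    then have "sqrt (\<rho> x) > 0" using pos[of x] by auto
    then show "sqrt (\<rho> x) *\<^sub>R (p x / of_real (sqrt (\<rho> x)) - 1/2 * of_real (\<rho>' x /\<^sub>R sqrt (\<rho> x) / \<rho> x))
        = p x - 1/2 * (of_real (\<rho>' x) * (1 / of_real (\<rho> x)))"
      by (simp add: scaleR_conv_of_real right_diff_distrib)
  qed
qed

text \<open>Integrability of \<open>f\<close> and square integrability of \<open>\<sigma>\<close>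
  would not suffice for the product. In the variable \<open>x\<close> it splits into
  \<open>p h\<close> and \<open>sqrt \<rho> h\<^sup>2\<close>, covered by the \<open>L2\<close>
  assumptions, and \<open>\<rho>' h / \<rho>\<close>, covered by the integrability of
  \<open>\<rho>' h\<close>.\<close>

lemma g_integrable: "g absolutely_integrable_on {0..l}"
  unfolding g_def f_def \<rho>t'_def \<sigma>_def
proof (rule absolutely_integrable_compose_X)
  have "(\<lambda>x. p x * h x - 1/2 * (of_real (\<rho>' x) * h x * (1 / of_real (\<rho> x))) - of_real (sqrt (\<rho> x)) * (h x * h x))
      absolutely_integrable_on {a..b}"
    by (intro set_integral_diff(1) set_integrable_mult_right L2_on_mult p h absolutely_integrable_mult_continuous
        absolutely_integrable_continuous_mult \<rho>'h inverse_\<rho>_continuous continuous_intros sqrt_continuous)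
  then show "(\<lambda>x. sqrt (\<rho> x) *\<^sub>R ((p x / of_real (sqrt (\<rho> x)) - 1/2 * of_real (\<rho>' x /\<^sub>R sqrt (\<rho> x) / \<rho> x)) * h x - (h x)\<^sup>2))
      absolutely_integrable_on {a..b}"
  proof (rule absolutely_integrable_spike[OF _ negligible_empty])
    fix x assume "x \<in> {a..b} - {}"
    then have "sqrt (\<rho> x) > 0" using pos[of x] by auto
    then show "sqrt (\<rho> x) *\<^sub>R ((p x / of_real (sqrt (\<rho> x)) - 1/2 * of_real (\<rho>' x /\<^sub>R sqrt (\<rho> x) / \<rho> x)) * h x - (h x)\<^sup>2)
        = p x * h x - 1/2 * (of_real (\<rho>' x) * h x * (1 / of_real (\<rho> x))) - of_real (sqrt (\<rho> x)) * (h x * h x)"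
      by (simp add: scaleR_conv_of_real ring_distribs power2_eq_square)
  qed
qed

lemma s_integrable: "s absolutely_integrable_on {0..l}"
  unfolding s_def by (intro set_integral_diff(1) \<sigma>_integrable absolutely_integrable_divide_const f_integrable)

lemma A_nonzero: "x \<in> {a..b} \<Longrightarrow> A x \<noteq> 0"
  using pos[of x] by (simp add: A_def)

lemma has_AC_derivative_A: "has_AC_derivative A (\<lambda>x. A x * (1/2 * p x - 1/4 * of_real (\<rho>' x / \<rho> x))) a b"
proof -
  have P: "has_AC_derivative (\<lambda>x. exp (1/2 * (0 + integral {a..x} p))) (\<lambda>x. exp (1/2 * (0 + integral {a..x} p)) * (1/2 * p x)) a b"
    by (intro has_AC_derivative_exp has_AC_derivative_cmult has_AC_derivative_integral p_integrable)
  have R: "has_AC_derivative (\<lambda>x. complex_of_real (\<rho> x powr (-1/4)))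
      (\<lambda>x. of_real (\<rho> x powr (-1/4) * ((-1/4) * (\<rho>' x / \<rho> x)))) a b"
    by (rule has_AC_derivative_linear[OF bounded_linear_of_real has_AC_derivative_powr[OF \<rho> pos]])
  show ?thesis
    by (rule has_AC_derivative_cong[OF has_AC_derivative_mult[OF R P]]) (simp_all add: A_def algebra_simps)
qed

text \<open>In \<open>x\<close> the logarithmic derivative of \<open>A\<close> is
  \<open>p / 2 - \<rho>' / (4 \<rho>)\<close>; dividing by \<open>sqrt \<rho>\<close> gives
  \<open>f / 2\<close>, as required of the amplitude in
  \<open>osc_system_to_solution\<close>.\<close>

lemma has_AC_derivative_A_X: "has_AC_derivative (\<lambda>t. A (X t)) (\<lambda>t. A (X t) * (f t / 2)) 0 l"
proof (rule has_AC_derivative_cong[OF has_AC_derivative_compose_X[OF has_AC_derivative_A]])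
  fix t assume "t \<in> {0..l}"
  then have "sqrt (\<rho> (X t)) > 0" using X_in pos by simp
  then show "(A (X t) * (1/2 * p (X t) - 1/4 * of_real (\<rho>' (X t) / \<rho> (X t)))) /\<^sub>R sqrt (\<rho> (X t)) = A (X t) * (f t / 2)"
    by (simp add: f_def \<rho>t'_def scaleR_conv_of_real field_simps)
qed simp

lemma has_AC_derivative_\<rho>_X: "has_AC_derivative (\<lambda>t. \<rho> (X t)) \<rho>t' 0 l"
  using has_AC_derivative_compose_X[OF \<rho>] by (simp add: \<rho>t'_def[abs_def])

text \<open>\<open>osc_system\<close> without its initial conditions: the reflected solutions have
  their data at \<open>t = l\<close> instead of \<open>t = 0\<close>.\<close>

definition osc_ode where
  "osc_ode \<mu> m k \<longleftrightarrow>
     has_AC_derivative m (\<lambda>t. s t * k t - g t / (2 * \<i> * \<mu>) * (m t + k t)) 0 l \<and>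
     has_AC_derivative k (\<lambda>t. 2 * \<i> * \<mu> * k t + s t * m t + g t / (2 * \<i> * \<mu>) * (m t + k t)) 0 l"

definition y_t where "y_t \<mu> m k t = A (X t) * exp (- \<i> * \<mu> * of_real t) * (m t + k t)"
definition w_t where "w_t \<mu> m k t = - \<i> * \<mu> * (A (X t) * exp (- \<i> * \<mu> * of_real t) * (m t - k t))"

definition sol where "sol \<mu> m k x = A x * exp (- \<i> * \<mu> * of_real (T x)) * (m (T x) + k (T x))"
definition qsol where "qsol \<mu> m k x = of_real (sqrt (\<rho> x)) *
  (- \<i> * \<mu> * (A x * exp (- \<i> * \<mu> * of_real (T x)) * (m (T x) - k (T x))))"

context
  fixes \<mu> m k
  assumes ode: "osc_ode \<mu> m k" and \<mu>: "\<mu> \<noteq> 0"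
begin

lemma has_AC_derivative_y_w:
  "has_AC_derivative (y_t \<mu> m k) (\<lambda>t. \<sigma> t * y_t \<mu> m k t + w_t \<mu> m k t) 0 l"
  "has_AC_derivative (w_t \<mu> m k) (\<lambda>t. (- \<mu>\<^sup>2 + g t) * y_t \<mu> m k t + (f t - \<sigma> t) * w_t \<mu> m k t) 0 l"
  using osc_system_to_solution[OF has_AC_derivative_A_X _ _ \<mu>, of m \<sigma> k g] ode
  unfolding osc_ode_def s_def y_t_def[abs_def] w_t_def[abs_def] by blast+

lemma is_solution_sol: "is_solution (sol \<mu> m k) p h \<rho> \<mu> a b"
  unfolding is_solution_def Let_def
proof (intro exI conjI)
  show "AE t in lebesgue_on {0..l}. (\<sigma> t * y_t \<mu> m k t + w_t \<mu> m k t) = h (X t) * y_t \<mu> m k t + w_t \<mu> m k t \<and>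
    (- \<mu>\<^sup>2 + g t) * y_t \<mu> m k t + (f t - \<sigma> t) * w_t \<mu> m k t =
    (- \<mu>\<^sup>2 + ((p (X t) / of_real (sqrt (\<rho> (X t))) - 1/2 * of_real (\<rho>t' t / \<rho> (X t))) * h (X t) - (h (X t))\<^sup>2)) * y_t \<mu> m k t +
    (p (X t) / of_real (sqrt (\<rho> (X t))) - 1/2 * of_real (\<rho>t' t / \<rho> (X t)) - h (X t)) * w_t \<mu> m k t"
    by (intro AE_I2) (simp add: g_def f_def \<sigma>_def)
  show "\<forall>x\<in>{a..b}. sol \<mu> m k x = y_t \<mu> m k (T x)"
    by (simp add: sol_def y_t_def X_T)
qed (rule has_AC_derivative_y_w has_AC_derivative_\<rho>_X)+

lemma is_quasi_derivative_qsol: "is_quasi_derivative (qsol \<mu> m k) (sol \<mu> m k) h \<rho> a b"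
  unfolding is_quasi_derivative_def
proof (intro exI conjI)
  have "continuous_on {a..b} (\<lambda>x. of_real (sqrt (\<rho> x)) * w_t \<mu> m k (T x))"
    by (intro continuous_intros sqrt_continuous
      has_AC_derivative_continuous[OF has_AC_derivative_compose_T[OF has_AC_derivative_y_w(2)]])
  then show "continuous_on {a..b} (qsol \<mu> m k)"
    by (rule continuous_on_eq) (simp add: qsol_def w_t_def X_T)
  show "has_AC_derivative (sol \<mu> m k) (\<lambda>x. sqrt (\<rho> x) *\<^sub>R (\<sigma> (T x) * y_t \<mu> m k (T x) + w_t \<mu> m k (T x))) a b"
    by (rule has_AC_derivative_cong[OF has_AC_derivative_compose_T[OF has_AC_derivative_y_w(1)]])
      (simp_all add: sol_def y_t_def X_T)
  show "AE x in lebesgue_on {a..b}. qsol \<mu> m k x =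
      sqrt (\<rho> x) *\<^sub>R (\<sigma> (T x) * y_t \<mu> m k (T x) + w_t \<mu> m k (T x)) - h x * of_real (sqrt (\<rho> x)) * sol \<mu> m k x"
    by (intro AE_I2) (simp add: qsol_def sol_def \<sigma>_def y_t_def w_t_def X_T scaleR_conv_of_real algebra_simps)
qed

end

lemma is_solution_minus: "is_solution Y p h \<rho> (- lam) a b \<longleftrightarrow> is_solution Y p h \<rho> lam a b"
  by (simp add: is_solution_def)

text \<open>If the combination of the \<open>y\<close> components vanishes identically, the system
  forces the same for the \<open>w\<close> components. At \<open>t = 0\<close> this gives
  \<open>c (m1 + k1) + d = 0\<close> and \<open>c (m1 - k1) - d = 0\<close>, whose sum is
  \<open>2 c m1 = 0\<close>. For the solution started at the right end only
  \<open>m1 0 \<noteq> 0\<close> can be asked for.\<close>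

lemma is_fundamental_system_sol:
  assumes ode1: "osc_ode (- lam) m1 k1" and ode2: "osc_ode lam m2 k2" and lam: "lam \<noteq> 0"
    and init: "m1 0 \<noteq> 0" "m2 0 = 1" "k2 0 = 0"
  shows "is_fundamental_system (sol (- lam) m1 k1) (sol lam m2 k2) p h \<rho> lam a b"
  unfolding is_fundamental_system_def
proof (intro conjI allI impI)
  have lam': "- lam \<noteq> 0" using lam by simp
  show "is_solution (sol (- lam) m1 k1) p h \<rho> lam a b"
    using is_solution_sol[OF ode1 lam'] by (simp only: is_solution_minus)
  show "is_solution (sol lam m2 k2) p h \<rho> lam a b" by (rule is_solution_sol[OF ode2 lam])
  fix c d assume eq: "\<forall>x\<in>{a..b}. c * sol (- lam) m1 k1 x + d * sol lam m2 k2 x = 0"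
  let ?y = "\<lambda>t. c * y_t (- lam) m1 k1 t + d * y_t lam m2 k2 t"
  let ?w = "\<lambda>t. c * w_t (- lam) m1 k1 t + d * w_t lam m2 k2 t"
  have y0: "?y t = 0" if "t \<in> {0..l}" for t
    using eq[rule_format, OF X_in(1)[OF that]] X_in(2)[OF that] by (simp add: sol_def y_t_def)
  have "has_AC_derivative ?y (\<lambda>t. c * (\<sigma> t * y_t (- lam) m1 k1 t + w_t (- lam) m1 k1 t) + d * (\<sigma> t * y_t lam m2 k2 t + w_t lam m2 k2 t)) 0 l"
    by (intro has_AC_derivative_add has_AC_derivative_cmult has_AC_derivative_y_w ode1 ode2 lam lam')
  then have D: "has_AC_derivative (\<lambda>t. 0) ?w 0 l"
  proof (rule has_AC_derivative_cong)
    fix t assume t: "t \<in> {0..l}"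
    show "?y t = 0" by (rule y0[OF t])
    have "c * (\<sigma> t * y_t (- lam) m1 k1 t + w_t (- lam) m1 k1 t) + d * (\<sigma> t * y_t lam m2 k2 t + w_t lam m2 k2 t) = \<sigma> t * ?y t + ?w t"
      by (simp add: algebra_simps)
    then show "c * (\<sigma> t * y_t (- lam) m1 k1 t + w_t (- lam) m1 k1 t) + d * (\<sigma> t * y_t lam m2 k2 t + w_t lam m2 k2 t) = ?w t"
      by (simp add: y0[OF t])
  qed
  have wc: "continuous_on {0..l} ?w"
    by (intro continuous_intros has_AC_derivative_continuous[OF has_AC_derivative_y_w(2)] ode1 ode2 lam lam')
  have 0: "0 \<in> {0..l}" using l_pos by simp
  \<comment> \<open>An a.e. derivative of the zero function says nothing at a single point;
    continuity of \<open>?w\<close> turns it into a genuine derivative at 0.\<close>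
  have "((\<lambda>t. integral {0..t} ?w) has_vector_derivative ?w 0) (at 0 within {0..l})"
    by (rule integral_has_vector_derivative[OF wc 0])
  moreover have "0 = integral {0..t} ?w" if "t \<in> {0..l}" for t
    using has_AC_derivative_eq[OF D that] unfolding add_0_left .
  ultimately have "((\<lambda>t. 0) has_vector_derivative ?w 0) (at 0 within {0..l})"
    by (rule has_vector_derivative_transform[OF 0, rotated])
  then have w0: "?w 0 = 0"
    using vector_derivative_unique_within_closed_interval[of 0 l 0 "\<lambda>t. 0" "?w 0" 0] l_pos by simp
  have X0: "A (X 0) \<noteq> 0" using A_nonzero[OF X_in(1)[OF 0]] .
  have "A (X 0) * (c * (m1 0 + k1 0) + d) = 0"
    using y0[OF 0] init by (simp add: y_t_def algebra_simps)
  then have 1: "c * (m1 0 + k1 0) + d = 0" using X0 by simp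
  have "\<i> * lam * A (X 0) * (c * (m1 0 - k1 0) - d) = 0"
    using w0 init by (simp add: w_t_def algebra_simps)
  then have 2: "c * (m1 0 - k1 0) - d = 0" using X0 lam by simp
  have "2 * (c * m1 0) = (c * (m1 0 + k1 0) + d) + (c * (m1 0 - k1 0) - d)" by (simp add: algebra_simps)
  also have "\<dots> = 0" unfolding 1 2 by simp
  finally show "c = 0" using init(1) by simp
  with 1 show "d = 0" by simp
qed

section \<open>Explicit formulas and the passage to the two half-planes\<close>

lemma exp_half_minus:
  "exp (1/2 * P - \<i> * lam * \<tau>) = exp (1/2 * P) * exp (- \<i> * lam * \<tau>)" for P lam \<tau> :: complex
  unfolding exp_add[symmetric] by simp

lemma one_add_diff_one: "1 + (z - 1) = z" for z :: complex
  by simp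

text \<open>Identifies the remainder as \<open>m + k - 1\<close>; in \<open>qsol_eq\<close> it is
  \<open>m - k - 1\<close>. Both are small because \<open>m\<close> tends to 1 and \<open>k\<close>
  to 0.\<close>

lemma sol_eq:
  "sol lam m k x = of_real (\<rho> x powr (-1/4)) *
     exp (1/2 * integral {a..x} p - \<i> * lam * of_real (integral {a..x} (\<lambda>\<tau>. sqrt (\<rho> \<tau>)))) *
     (1 + (m (T x) + k (T x) - 1))"
  unfolding sol_def A_def t_of_def exp_half_minus by (simp only: one_add_diff_one mult_ac)

lemma qsol_eq:
  assumes "x \<in> {a..b}"
  shows "qsol lam m k x = - \<i> * lam * of_real (\<rho> x powr (1/4)) *
     exp (1/2 * integral {a..x} p - \<i> * lam * of_real (integral {a..x} (\<lambda>\<tau>. sqrt (\<rho> \<tau>)))) *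
     (1 + (m (T x) - k (T x) - 1))"
proof -
  have "\<rho> x powr (1/2 + -1/4) = \<rho> x powr (1/2) * \<rho> x powr (-1/4)" by (rule powr_add)
  then have R: "complex_of_real (\<rho> x powr (1/4)) = of_real (sqrt (\<rho> x)) * of_real (\<rho> x powr (-1/4))"
    unfolding powr_half_sqrt[OF less_imp_le[OF pos[OF assms]]] of_real_mult[symmetric] by simp
  show ?thesis
    unfolding qsol_def A_def t_of_def exp_half_minus R
    by (simp only: one_add_diff_one mult_ac)
qed

end

text \<open>\<open>ym\<close> comes from the system with parameter \<open>lam\<close> started at
  \<open>t = 0\<close>. For \<open>yp\<close> the reflected system is solved with the same
  \<open>lam\<close>, so that the kernel bound for \<open>Im lam \<ge> - r\<close> still applies;
  reflecting back yields a solution with parameter \<open>- lam\<close>, hence the opposite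
  exponential.\<close>

lemma (in sturm_liouville) half_plane_solutions:
  assumes r: "r \<ge> 0"
  shows "\<exists>R>0. \<exists>yp ym yp1 ym1 \<phi>p \<phi>m \<psi>p \<psi>m :: complex \<Rightarrow> real \<Rightarrow> complex.
    (\<forall>lam. Im lam \<ge> - r \<longrightarrow> cmod lam > R \<longrightarrow>
       is_fundamental_system (yp lam) (ym lam) p h \<rho> lam a b \<and>
       is_quasi_derivative (yp1 lam) (yp lam) h \<rho> a b \<and>
       is_quasi_derivative (ym1 lam) (ym lam) h \<rho> a b \<and>
       (\<forall>x\<in>{a..b}.
          yp lam x = of_real (\<rho> x powr (-1/4)) *
            exp (1/2 * integral {a..x} p + \<i> * lam * of_real (integral {a..x} (\<lambda>\<tau>. sqrt (\<rho> \<tau>)))) *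
            (1 + \<phi>p lam x) \<and>
          ym lam x = of_real (\<rho> x powr (-1/4)) *
            exp (1/2 * integral {a..x} p - \<i> * lam * of_real (integral {a..x} (\<lambda>\<tau>. sqrt (\<rho> \<tau>)))) *
            (1 + \<phi>m lam x) \<and>
          yp1 lam x = \<i> * lam * of_real (\<rho> x powr (1/4)) *
            exp (1/2 * integral {a..x} p + \<i> * lam * of_real (integral {a..x} (\<lambda>\<tau>. sqrt (\<rho> \<tau>)))) *
            (1 + \<psi>p lam x) \<and>
          ym1 lam x = - \<i> * lam * of_real (\<rho> x powr (1/4)) *
            exp (1/2 * integral {a..x} p - \<i> * lam * of_real (integral {a..x} (\<lambda>\<tau>. sqrt (\<rho> \<tau>)))) *
            (1 + \<psi>m lam x))) \<and>
    (\<forall>\<epsilon>>0. \<exists>R. \<forall>lam. Im lam \<ge> - r \<longrightarrow> cmod lam > R \<longrightarrow> (\<forall>x\<in>{a..b}.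
       cmod (\<phi>p lam x) + cmod (\<phi>m lam x) < \<epsilon> \<and> cmod (\<psi>p lam x) + cmod (\<psi>m lam x) < \<epsilon>))"
proof -
  have l0: "0 \<le> l" using l_pos by simp
  \<comment> \<open>Reversing \<open>t\<close> changes the sign of every derivative. For
    \<open>s\<close> the sign is built into \<open>s'\<close>; for \<open>2 \<i> lam\<close> and
    \<open>g / (2 \<i> lam)\<close> it is absorbed by passing from \<open>lam\<close> to
    \<open>- lam\<close>.\<close>
  define s' g' where "s' = (\<lambda>t. - s (l - t))" and "g' = (\<lambda>t. g (l - t))"
  have refl: "(\<lambda>t. F (l - t)) absolutely_integrable_on {0..l}" if F: "F absolutely_integrable_on {0..l}" for F :: "real \<Rightarrow> complex"
  proof -
    have "(\<lambda>t. - F (l - t)) absolutely_integrable_on {0..l}"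
      by (rule has_AC_derivative_integrable[OF has_AC_derivative_reflect[OF has_AC_derivative_integral[OF F, of 0]]])
    from absolutely_integrable_linear[OF this bounded_linear_minus[OF bounded_linear_ident]]
    show ?thesis by (simp add: o_def)
  qed
  have g': "g' absolutely_integrable_on {0..l}" unfolding g'_def by (rule refl[OF g_integrable])
  have s': "s' absolutely_integrable_on {0..l}"
    using absolutely_integrable_linear[OF refl[OF s_integrable] bounded_linear_minus[OF bounded_linear_ident]]
    by (simp add: s'_def o_def)
  obtain m k where mk: "\<And>lam. osc_system s g lam l (m lam) (k lam)"
    using osc_system_exists[OF l0 s_integrable g_integrable] by metis
  obtain m' k' where mk': "\<And>lam. osc_system s' g' lam l (m' lam) (k' lam)"
    using osc_system_exists[OF l0 s' g'] by metis
  define mr kr where "mr = (\<lambda>lam t. m' lam (l - t))" and "kr = (\<lambda>lam t. k' lam (l - t))"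
  have ode: "osc_ode lam (m lam) (k lam)" for lam
    using mk[of lam] by (simp add: osc_system_def osc_ode_def)
  have ode_r: "osc_ode (- lam) (mr lam) (kr lam)" for lam
  proof -
    have "has_AC_derivative (m' lam) (\<lambda>t. s' t * k' lam t - g' t / (2 * \<i> * lam) * (m' lam t + k' lam t)) 0 l"
      "has_AC_derivative (k' lam) (\<lambda>t. 2 * \<i> * lam * k' lam t + s' t * m' lam t + g' t / (2 * \<i> * lam) * (m' lam t + k' lam t)) 0 l"
      using mk'[of lam] by (auto simp: osc_system_def)
    note R = this[THEN has_AC_derivative_reflect]
    show ?thesis
      unfolding osc_ode_def mr_def kr_def
      by (intro conjI has_AC_derivative_cong[OF R(1)] has_AC_derivative_cong[OF R(2)])
        (simp_all add: s'_def g'_def)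
  qed
  have small: "\<exists>R. \<forall>lam. Im lam \<ge> - r \<longrightarrow> cmod lam > R \<longrightarrow> (\<forall>t\<in>{0..l}.
      norm (m lam t - 1) < \<epsilon> \<and> norm (k lam t) < \<epsilon> \<and> norm (mr lam t - 1) < \<epsilon> \<and> norm (kr lam t) < \<epsilon>)"
    if \<epsilon>: "\<epsilon> > 0" for \<epsilon>
  proof -
    obtain R1 R2 where R1: "\<And>lam t. Im lam \<ge> - r \<Longrightarrow> cmod lam > R1 \<Longrightarrow> t \<in> {0..l} \<Longrightarrow> norm (m lam t - 1) < \<epsilon> \<and> norm (k lam t) < \<epsilon>"
      and R2: "\<And>lam t. Im lam \<ge> - r \<Longrightarrow> cmod lam > R2 \<Longrightarrow> t \<in> {0..l} \<Longrightarrow> norm (m' lam t - 1) < \<epsilon> \<and> norm (k' lam t) < \<epsilon>"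
      using osc_system_asymptotics[OF s_integrable g_integrable l0 r \<epsilon>] osc_system_asymptotics[OF s' g' l0 r \<epsilon>] mk mk'
      by metis
    show ?thesis
    proof (intro exI[of _ "max R1 R2"] allI impI ballI)
      fix lam t assume "Im lam \<ge> - r" "cmod lam > max R1 R2" and t: "t \<in> {0..l}"
      moreover from t have "l - t \<in> {0..l}" by auto
      ultimately show "norm (m lam t - 1) < \<epsilon> \<and> norm (k lam t) < \<epsilon> \<and> norm (mr lam t - 1) < \<epsilon> \<and> norm (kr lam t) < \<epsilon>"
        using R1[of lam t] R2[of lam "l - t"] unfolding mr_def kr_def by auto
    qed
  qed
  \<comment> \<open>Distance less than 1 from 1 keeps \<open>mr lam 0\<close> away from 0, which is
    the nonvanishing needed for independence.\<close>
  obtain R0 where R0: "\<And>lam t. Im lam \<ge> - r \<Longrightarrow> cmod lam > R0 \<Longrightarrow> t \<in> {0..l} \<Longrightarrow> norm (mr lam t - 1) < 1"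
    using small[OF zero_less_one] by blast
  let ?yp = "\<lambda>lam. sol (- lam) (mr lam) (kr lam)" and ?ym = "\<lambda>lam. sol lam (m lam) (k lam)"
  let ?yp1 = "\<lambda>lam. qsol (- lam) (mr lam) (kr lam)" and ?ym1 = "\<lambda>lam. qsol lam (m lam) (k lam)"
  let ?\<phi>p = "\<lambda>lam x. mr lam (T x) + kr lam (T x) - 1" and ?\<phi>m = "\<lambda>lam x. m lam (T x) + k lam (T x) - 1"
  let ?\<psi>p = "\<lambda>lam x. mr lam (T x) - kr lam (T x) - 1" and ?\<psi>m = "\<lambda>lam x. m lam (T x) - k lam (T x) - 1"
  have sys: "is_fundamental_system (?yp lam) (?ym lam) p h \<rho> lam a b \<and>
       is_quasi_derivative (?yp1 lam) (?yp lam) h \<rho> a b \<and> is_quasi_derivative (?ym1 lam) (?ym lam) h \<rho> a b"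
    if lam: "Im lam \<ge> - r" "cmod lam > max 1 R0" for lam
  proof (intro conjI is_fundamental_system_sol is_quasi_derivative_qsol ode ode_r)
    show "lam \<noteq> 0" "lam \<noteq> 0" "- lam \<noteq> 0" using lam(2) by auto
    show "mr lam 0 \<noteq> 0" using R0[of lam 0] lam l0 by auto
    show "m lam 0 = 1" "k lam 0 = 0" using mk[of lam] by (auto simp: osc_system_def)
  qed
  have formulas: "?yp lam x = of_real (\<rho> x powr (-1/4)) *
            exp (1/2 * integral {a..x} p + \<i> * lam * of_real (integral {a..x} (\<lambda>\<tau>. sqrt (\<rho> \<tau>)))) *
            (1 + ?\<phi>p lam x) \<and>
          ?ym lam x = of_real (\<rho> x powr (-1/4)) *
            exp (1/2 * integral {a..x} p - \<i> * lam * of_real (integral {a..x} (\<lambda>\<tau>. sqrt (\<rho> \<tau>)))) *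
            (1 + ?\<phi>m lam x) \<and>
          ?yp1 lam x = \<i> * lam * of_real (\<rho> x powr (1/4)) *
            exp (1/2 * integral {a..x} p + \<i> * lam * of_real (integral {a..x} (\<lambda>\<tau>. sqrt (\<rho> \<tau>)))) *
            (1 + ?\<psi>p lam x) \<and>
          ?ym1 lam x = - \<i> * lam * of_real (\<rho> x powr (1/4)) *
            exp (1/2 * integral {a..x} p - \<i> * lam * of_real (integral {a..x} (\<lambda>\<tau>. sqrt (\<rho> \<tau>)))) *
            (1 + ?\<psi>m lam x)" if x: "x \<in> {a..b}" for lam x
  proof (intro conjI)
    have neg: "- \<i> * - lam = \<i> * lam" "z - \<i> * - lam * w = z + \<i> * lam * w" for z w by simp_all
    show "?ym lam x = of_real (\<rho> x powr (-1/4)) *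
            exp (1/2 * integral {a..x} p - \<i> * lam * of_real (integral {a..x} (\<lambda>\<tau>. sqrt (\<rho> \<tau>)))) *
            (1 + ?\<phi>m lam x)" by (rule sol_eq)
    show "?ym1 lam x = - \<i> * lam * of_real (\<rho> x powr (1/4)) *
            exp (1/2 * integral {a..x} p - \<i> * lam * of_real (integral {a..x} (\<lambda>\<tau>. sqrt (\<rho> \<tau>)))) *
            (1 + ?\<psi>m lam x)" by (rule qsol_eq[OF x])
    show "?yp lam x = of_real (\<rho> x powr (-1/4)) *
            exp (1/2 * integral {a..x} p + \<i> * lam * of_real (integral {a..x} (\<lambda>\<tau>. sqrt (\<rho> \<tau>)))) *
            (1 + ?\<phi>p lam x)" using sol_eq[of "- lam" "mr lam" "kr lam" x] unfolding neg .
    show "?yp1 lam x = \<i> * lam * of_real (\<rho> x powr (1/4)) *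
            exp (1/2 * integral {a..x} p + \<i> * lam * of_real (integral {a..x} (\<lambda>\<tau>. sqrt (\<rho> \<tau>)))) *
            (1 + ?\<psi>p lam x)" using qsol_eq[OF x, of "- lam" "mr lam" "kr lam"] unfolding neg .
  qed
  have tends: "\<exists>R. \<forall>lam. Im lam \<ge> - r \<longrightarrow> cmod lam > R \<longrightarrow> (\<forall>x\<in>{a..b}.
       cmod (?\<phi>p lam x) + cmod (?\<phi>m lam x) < \<epsilon> \<and> cmod (?\<psi>p lam x) + cmod (?\<psi>m lam x) < \<epsilon>)"
    if \<epsilon>: "\<epsilon> > 0" for \<epsilon>
  proof -
    obtain R where R: "\<And>lam t. Im lam \<ge> - r \<Longrightarrow> cmod lam > R \<Longrightarrow> t \<in> {0..l} \<Longrightarrow>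
        norm (m lam t - 1) < \<epsilon> / 4 \<and> norm (k lam t) < \<epsilon> / 4 \<and> norm (mr lam t - 1) < \<epsilon> / 4 \<and> norm (kr lam t) < \<epsilon> / 4"
      using small[OF divide_pos_pos[OF \<epsilon>, of 4]] by (metis zero_less_numeral)
    have tri: "norm (u + v - 1) \<le> norm (u - 1) + norm v" "norm (u - v - 1) \<le> norm (u - 1) + norm v" for u v :: complex
      using norm_triangle_ineq[of "u - 1" v] norm_triangle_ineq4[of "u - 1" v] by (simp_all add: algebra_simps)
    show ?thesis
    proof (intro exI[of _ R] allI impI ballI)
      fix lam x assume "Im lam \<ge> - r" "cmod lam > R" "x \<in> {a..b}"
      then show "cmod (?\<phi>p lam x) + cmod (?\<phi>m lam x) < \<epsilon> \<and> cmod (?\<psi>p lam x) + cmod (?\<psi>m lam x) < \<epsilon>"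
        using R[of lam "T x"] T_in[of x] tri[of "m lam (T x)" "k lam (T x)"] tri[of "mr lam (T x)" "kr lam (T x)"]
        by linarith
    qed
  qed
  show ?thesis
  proof (rule exI[of _ "max 1 R0"], rule conjI)
    show "0 < max 1 R0" by simp
  qed (rule exI[of _ ?yp], rule exI[of _ ?ym], rule exI[of _ ?yp1], rule exI[of _ ?ym1],
      rule exI[of _ ?\<phi>p], rule exI[of _ ?\<phi>m], rule exI[of _ ?\<psi>p], rule exI[of _ ?\<psi>m],
      use sys formulas tends in blast)
qed

text \<open>The filter expresses that \<open>lam\<close> tends to infinity inside \<open>H\<close>.
  The bound \<open>R + 1\<close> accounts for the non-strict inequality in
  \<open>eventually_at_infinity\<close>.\<close>

lemma uniform_limit_0_at_infinity_within:
  fixes F :: "complex \<Rightarrow> real \<Rightarrow> real"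
  assumes "\<And>\<epsilon>. \<epsilon> > 0 \<Longrightarrow> \<exists>R. \<forall>lam\<in>H. cmod lam > R \<longrightarrow> (\<forall>x\<in>S. \<bar>F lam x\<bar> < \<epsilon>)"
  shows "uniform_limit S F (\<lambda>x. 0) (inf at_infinity (principal H))"
proof (rule uniform_limitI)
  fix \<epsilon> :: real assume "\<epsilon> > 0"
  then obtain R where R: "\<forall>lam\<in>H. cmod lam > R \<longrightarrow> (\<forall>x\<in>S. \<bar>F lam x\<bar> < \<epsilon>)" using assms by blast
  have "\<forall>lam. R + 1 \<le> cmod lam \<longrightarrow> lam \<in> H \<longrightarrow> (\<forall>x\<in>S. dist (F lam x) 0 < \<epsilon>)"
    using R by (auto simp: dist_real_def)
  then show "\<forall>\<^sub>F lam in inf at_infinity (principal H). \<forall>x\<in>S. dist (F lam x) 0 < \<epsilon>"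
    unfolding eventually_inf_principal eventually_at_infinity by blast
qed

text \<open>The equation depends on \<open>lam\<^sup>2\<close> only, and replacing \<open>lam\<close> by \<open>- lam\<close> exchanges the two
  half-planes and the roles of \<open>y\<^sub>+\<close> and \<open>y\<^sub>-\<close>.\<close>

theorem mainTheorem1:
  fixes a b :: real
    and p u h :: "real \<Rightarrow> complex"
    and q :: "(real \<Rightarrow> complex) \<Rightarrow> complex"
    and \<rho> \<rho>' :: "real \<Rightarrow> real"
  assumes "a < b"
    and "L2_on a b p"
    and "L2_on a b u" and "has_distr_antiderivative q u a b"
    and "has_AC_derivative \<rho> \<rho>' a b" and "\<And>x. x \<in> {a..b} \<Longrightarrow> \<rho> x > 0"
    and "(\<lambda>x. of_real (\<rho>' x) * u x) absolutely_integrable_on {a..b}"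
    and "is_antiderivative_q_sqrt h q \<rho> a b"
  shows "\<forall>r\<ge>0. \<forall>H \<in> {{lam. Im lam \<ge> - r}, {lam. Im lam \<le> r}}.
    \<exists>R>0. \<exists>yp ym yp1 ym1 \<phi>p \<phi>m \<psi>p \<psi>m :: complex \<Rightarrow> real \<Rightarrow> complex.
      (\<forall>lam\<in>H. cmod lam > R \<longrightarrow>
         is_fundamental_system (yp lam) (ym lam) p h \<rho> lam a b \<and>
         is_quasi_derivative (yp1 lam) (yp lam) h \<rho> a b \<and>
         is_quasi_derivative (ym1 lam) (ym lam) h \<rho> a b \<and>
         (\<forall>x\<in>{a..b}.
            yp lam x = of_real (\<rho> x powr (-1/4)) *
              exp (1/2 * integral {a..x} p + \<i> * lam * of_real (integral {a..x} (\<lambda>\<tau>. sqrt (\<rho> \<tau>)))) *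
              (1 + \<phi>p lam x) \<and>
            ym lam x = of_real (\<rho> x powr (-1/4)) *
              exp (1/2 * integral {a..x} p - \<i> * lam * of_real (integral {a..x} (\<lambda>\<tau>. sqrt (\<rho> \<tau>)))) *
              (1 + \<phi>m lam x) \<and>
            yp1 lam x = \<i> * lam * of_real (\<rho> x powr (1/4)) *
              exp (1/2 * integral {a..x} p + \<i> * lam * of_real (integral {a..x} (\<lambda>\<tau>. sqrt (\<rho> \<tau>)))) *
              (1 + \<psi>p lam x) \<and>
            ym1 lam x = - \<i> * lam * of_real (\<rho> x powr (1/4)) *
              exp (1/2 * integral {a..x} p - \<i> * lam * of_real (integral {a..x} (\<lambda>\<tau>. sqrt (\<rho> \<tau>)))) *
              (1 + \<psi>m lam x))) \<and>
      uniform_limit {a..b} (\<lambda>lam x. cmod (\<phi>p lam x) + cmod (\<phi>m lam x)) (\<lambda>x. 0)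
        (inf at_infinity (principal H)) \<and>
      uniform_limit {a..b} (\<lambda>lam x. cmod (\<psi>p lam x) + cmod (\<psi>m lam x)) (\<lambda>x. 0)
        (inf at_infinity (principal H))"
proof (intro allI impI ballI)
  fix r :: real and H :: "complex set"
  assume r: "0 \<le> r" and H: "H \<in> {{lam. Im lam \<ge> - r}, {lam. Im lam \<le> r}}"
  have h: "L2_on a b h"
    using assms(8) by (simp add: is_antiderivative_q_sqrt_def)
  \<comment> \<open>Here the distributional information on \<open>q\<close> is traded for the
    integrability of \<open>\<rho>' h\<close>; from this point on only \<open>h\<close>
    occurs.\<close>
  interpret sturm_liouville a b \<rho> p h \<rho>'
    using assms has_AC_derivative_continuous[OF assms(5)] h
      derivative_times_antiderivative_integrable[OF assms(1,5,6,8)]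
    by unfold_locales auto
  let ?e = "\<lambda>lam x. exp (1/2 * integral {a..x} p + \<i> * lam * of_real (integral {a..x} (\<lambda>\<tau>. sqrt (\<rho> \<tau>))))"
  let ?e' = "\<lambda>lam x. exp (1/2 * integral {a..x} p - \<i> * lam * of_real (integral {a..x} (\<lambda>\<tau>. sqrt (\<rho> \<tau>))))"
  let ?P = "\<lambda>H R (yp::complex \<Rightarrow> real \<Rightarrow> complex) ym yp1 ym1 \<phi>p \<phi>m \<psi>p \<psi>m. \<forall>lam\<in>H. cmod lam > R \<longrightarrow>
         is_fundamental_system (yp lam) (ym lam) p h \<rho> lam a b \<and>
         is_quasi_derivative (yp1 lam) (yp lam) h \<rho> a b \<and>
         is_quasi_derivative (ym1 lam) (ym lam) h \<rho> a b \<and>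
         (\<forall>x\<in>{a..b}.
            yp lam x = of_real (\<rho> x powr (-1/4)) * ?e lam x * (1 + \<phi>p lam x) \<and>
            ym lam x = of_real (\<rho> x powr (-1/4)) * ?e' lam x * (1 + \<phi>m lam x) \<and>
            yp1 lam x = \<i> * lam * of_real (\<rho> x powr (1/4)) * ?e lam x * (1 + \<psi>p lam x) \<and>
            ym1 lam x = - \<i> * lam * of_real (\<rho> x powr (1/4)) * ?e' lam x * (1 + \<psi>m lam x))"
  let ?Q = "\<lambda>H (\<phi>p :: complex \<Rightarrow> real \<Rightarrow> complex) (\<phi>m :: complex \<Rightarrow> real \<Rightarrow> complex).
      uniform_limit {a..b} (\<lambda>lam x. cmod (\<phi>p lam x) + cmod (\<phi>m lam x)) (\<lambda>x. 0) (inf at_infinity (principal H))"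
  obtain R yp ym yp1 ym1 \<phi>p \<phi>m \<psi>p \<psi>m where R: "R > 0"
    and P: "?P {lam. Im lam \<ge> - r} R yp ym yp1 ym1 \<phi>p \<phi>m \<psi>p \<psi>m"
    and small: "\<And>\<epsilon>. \<epsilon> > 0 \<Longrightarrow> \<exists>R. \<forall>lam. Im lam \<ge> - r \<longrightarrow> cmod lam > R \<longrightarrow> (\<forall>x\<in>{a..b}.
       cmod (\<phi>p lam x) + cmod (\<phi>m lam x) < \<epsilon> \<and> cmod (\<psi>p lam x) + cmod (\<psi>m lam x) < \<epsilon>)"
    using half_plane_solutions[OF r] unfolding Ball_def mem_Collect_eq by blast
  \<comment> \<open>One \<open>R\<close> serves both half-planes, since \<open>lam\<close> and
    \<open>- lam\<close> have the same modulus.\<close>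
  have main: "\<exists>yp ym yp1 ym1 \<phi>p \<phi>m \<psi>p \<psi>m. ?P H R yp ym yp1 ym1 \<phi>p \<phi>m \<psi>p \<psi>m \<and> ?Q H \<phi>p \<phi>m \<and> ?Q H \<psi>p \<psi>m"
  proof (cases "H = {lam. Im lam \<ge> - r}")
    case True
    have "?Q H \<phi>p \<phi>m" "?Q H \<psi>p \<psi>m"
      unfolding True
      by (rule uniform_limit_0_at_infinity_within, drule small, simp add: abs_of_nonneg, blast)+
    then show ?thesis
      using P unfolding True by (intro exI conjI)
  next
    case False
    then have Heq: "H = {lam. Im lam \<le> r}" using H by auto
    let ?n = "\<lambda>(F :: complex \<Rightarrow> real \<Rightarrow> complex) lam. F (- lam)"
    have "?P H R (?n ym) (?n yp) (?n ym1) (?n yp1) (?n \<phi>m) (?n \<phi>p) (?n \<psi>m) (?n \<psi>p)"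
    proof (intro ballI impI)
      fix lam assume "lam \<in> H" "cmod lam > R"
      then have "- lam \<in> {lam. Im lam \<ge> - r}" "cmod (- lam) > R" by (auto simp: Heq)
      note * = P[rule_format, OF this]
      \<comment> \<open>Exchanging the two solutions amounts to exchanging the coefficients
        \<open>c\<close> and \<open>d\<close>, hence commutativity of addition.\<close>
      have "is_fundamental_system (ym (- lam)) (yp (- lam)) p h \<rho> lam a b"
        using * unfolding is_fundamental_system_def is_solution_minus by (metis add.commute)
      moreover have "?e (- lam) x = ?e' lam x" "?e' (- lam) x = ?e lam x" for x by simp_all
      ultimately show "is_fundamental_system (?n ym lam) (?n yp lam) p h \<rho> lam a b \<and>
         is_quasi_derivative (?n ym1 lam) (?n ym lam) h \<rho> a b \<and>
         is_quasi_derivative (?n yp1 lam) (?n yp lam) h \<rho> a b \<and>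
         (\<forall>x\<in>{a..b}.
            ?n ym lam x = of_real (\<rho> x powr (-1/4)) * ?e lam x * (1 + ?n \<phi>m lam x) \<and>
            ?n yp lam x = of_real (\<rho> x powr (-1/4)) * ?e' lam x * (1 + ?n \<phi>p lam x) \<and>
            ?n ym1 lam x = \<i> * lam * of_real (\<rho> x powr (1/4)) * ?e lam x * (1 + ?n \<psi>m lam x) \<and>
            ?n yp1 lam x = - \<i> * lam * of_real (\<rho> x powr (1/4)) * ?e' lam x * (1 + ?n \<psi>p lam x))"
        using * by simp
    qed
    moreover have small': "\<exists>R. \<forall>lam. Im lam \<le> r \<longrightarrow> cmod lam > R \<longrightarrow> (\<forall>x\<in>{a..b}.
       cmod (\<phi>m (- lam) x) + cmod (\<phi>p (- lam) x) < \<epsilon> \<and> cmod (\<psi>m (- lam) x) + cmod (\<psi>p (- lam) x) < \<epsilon>)"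
      if \<epsilon>: "\<epsilon> > 0" for \<epsilon>
    proof -
      obtain R where R: "\<forall>lam. Im lam \<ge> - r \<longrightarrow> cmod lam > R \<longrightarrow> (\<forall>x\<in>{a..b}.
         cmod (\<phi>p lam x) + cmod (\<phi>m lam x) < \<epsilon> \<and> cmod (\<psi>p lam x) + cmod (\<psi>m lam x) < \<epsilon>)"
        using small[OF \<epsilon>] by blast
      show ?thesis
        by (intro exI[of _ R] allI impI) (use R[rule_format, of "- lam" for lam] in \<open>simp add: add.commute\<close>)
    qed
    have "?Q H (?n \<phi>m) (?n \<phi>p)" "?Q H (?n \<psi>m) (?n \<psi>p)"
      unfolding Heq
      by (rule uniform_limit_0_at_infinity_within, drule small', simp add: abs_of_nonneg, blast)+
    ultimately show ?thesis by (intro exI conjI)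
  qed
  show "\<exists>R>0. \<exists>yp ym yp1 ym1 \<phi>p \<phi>m \<psi>p \<psi>m :: complex \<Rightarrow> real \<Rightarrow> complex.
      ?P H R yp ym yp1 ym1 \<phi>p \<phi>m \<psi>p \<psi>m \<and> ?Q H \<phi>p \<phi>m \<and> ?Q H \<psi>p \<psi>m"
    by (rule exI[of _ R], rule conjI[OF R main])
qed

end
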